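(* Let $\mathcal G$ be a compact, connected, finite metric graph with non-empty Dirichlet vertex set $\mathsf V_{\mathrm D}$ and total length $|\mathcal G|$. Then \[ T(\mathcal G)\le\frac{|\mathcal G|^3}{3}, \] with equality if and only if $\mathcal G$ is an interval with mixed Dirichlet/Neumann conditions (Dirichlet at one endpoint, Neumann at the other). If, additionally, $\mathcal G$ is doubly connected upon gluing all vertices in $\mathsf V_{\mathrm D}$, then \[ T(\mathcal G)\le\frac{|\mathcal G|^3}{12}, \] and in this case equality holds if and only if $\mathcal G$ is a caterpillar graph.
   Context: A compact, connected, finite metric graph consists of finitely many edges $\mathsf e\simeq[0,\ell_{\mathsf e}]$, $0<\ell_{\mathsf e}<\infty$, glued at their endpoints (vertices) to form a connected space; $|\mathcal G|=\sum_{\mathsf e}\ell_{\mathsf e}$. The torsion function $v$ with respect to $\mathsf V_{\mathrm D}$ is the unique function that is continuous on $\mathcal G$, in $H^2$ on each edge, with $-v_{\mathsf e}''=1$ on each edge, $v=0$ on $\mathsf V_{\mathrm D}$, and sum of normal derivatives over all incident edges equal to $0$ at each vertex not in $\mathsf V_{\mathrm D}$. The torsional rigidity is $T(\mathcal G)=\int_{\mathcal G}v\,dx$. A graph is doubly connected if it has edge connectivity at least $2$, i.e. it stays connected when the interior of any one edge is removed. A caterpillar graph is a 2-regular pumpkin chain one of whose two end vertices (of degree two) carries the Dirichlet condition: there are vertices $\mathsf v_0,\dots,\mathsf v_m$ ($m\ge1$), for each $j$ the vertices $\mathsf v_{j-1},\mathsf v_j$ are joined by exactly two edges, of equal length, there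 are no other edges, and $\mathsf v_0$ is the Dirichlet vertex. Graphs are identified if they differ only by gluing or splitting Dirichlet vertices (which does not affect torsion), or by insertion or removal of degree-two non-Dirichlet vertices in the interior of edges. *)

theory Defs
  imports "HOL-Analysis.Analysis" "Graph_Theory.Digraph_Component"
begin

text \<open>
  A metric graph is given by its combinatorial data: a finite multigraph (loops and parallel
  edges allowed), edge lengths, and the set of Dirichlet vertices.  The orientation of an arc
  \<open>e\<close> only fixes the coordinate on the edge, identified with \<open>[0, len e]\<close>: the tail
  sits at \<open>0\<close>, the head at \<open>len e\<close>.
\<close>

record ('v, 'e) mgraph =
  graph :: "('v, 'e) pre_digraph"
  len :: "'e \<Rightarrow> real"
  dirichlet :: "'v set"

text \<open>
  Vertices are endpoints of edges, so there are no isolated vertices and at least one edge.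
  Connectedness and non-emptiness of the Dirichlet set are not part of this definition.
\<close>

definition metric_graph :: "('v, 'e) mgraph \<Rightarrow> bool" where
  "metric_graph G \<longleftrightarrow>
     fin_digraph (graph G) \<and> arcs (graph G) \<noteq> {} \<and>
     (\<forall>w\<in>verts (graph G). \<exists>e\<in>arcs (graph G). w \<in> {tail (graph G) e, head (graph G) e}) \<and>
     (\<forall>e\<in>arcs (graph G). 0 < len G e) \<and>
     dirichlet G \<subseteq> verts (graph G)"

definition total_length :: "('v, 'e) mgraph \<Rightarrow> real" where
  "total_length G = (\<Sum>e\<in>arcs (graph G). len G e)"


text \<open>
  \<open>H1_deriv l u g\<close>: \<open>u\<close> is the continuous representative of an element of the Sobolev space
  \<open>H\<^sup>1(0,l)\<close> with weak derivative \<open>g\<close>, i.e. \<open>u\<close> is a primitive of \<open>g \<in> L\<^sup>2(0,l)\<close> on \<open>[0,l]\<close>.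
  \<open>H2_deriv2 l u h\<close>: \<open>u \<in> H\<^sup>2(0,l)\<close> with weak second derivative \<open>h\<close>.
\<close>

definition H1_deriv :: "real \<Rightarrow> (real \<Rightarrow> real) \<Rightarrow> (real \<Rightarrow> real) \<Rightarrow> bool" where
  "H1_deriv l u g \<longleftrightarrow>
     g \<in> borel_measurable (lebesgue_on {0..l}) \<and>
     integrable (lebesgue_on {0..l}) (\<lambda>x. (g x)\<^sup>2) \<and>
     (\<forall>x\<in>{0..l}. u x = u 0 + (LINT t|lebesgue_on {0..x}. g t))"

definition H2_deriv2 :: "real \<Rightarrow> (real \<Rightarrow> real) \<Rightarrow> (real \<Rightarrow> real) \<Rightarrow> bool" where
  "H2_deriv2 l u h \<longleftrightarrow> (\<exists>u'. H1_deriv l u u' \<and> H1_deriv l u' h)"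

text \<open>
  A function on the metric graph is a family \<open>v e :: [0, len e] \<rightarrow> \<real>\<close>; it is continuous on the
  graph iff it is continuous on each edge and the values at all edge ends glued at a vertex agree.
\<close>

definition continuous_on_graph :: "('v, 'e) mgraph \<Rightarrow> ('e \<Rightarrow> real \<Rightarrow> real) \<Rightarrow> ('v \<Rightarrow> real) \<Rightarrow> bool" where
  "continuous_on_graph G v val \<longleftrightarrow>
     (\<forall>e\<in>arcs (graph G). continuous_on {0..len G e} (v e) \<and>
        v e 0 = val (tail (graph G) e) \<and> v e (len G e) = val (head (graph G) e))"

text \<open>
  Sum over all edge ends at \<open>w\<close> of the derivative in the direction pointing into the edge;
  a loop at \<open>w\<close> contributes both of its ends.
\<close>

definition normal_deriv_sum :: "('v, 'e) mgraph \<Rightarrow> ('e \<Rightarrow> real \<Rightarrow> real) \<Rightarrow> 'v \<Rightarrow> real" where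
  "normal_deriv_sum G v w =
     (\<Sum>e\<in>out_arcs (graph G) w. vector_derivative (v e) (at 0 within {0..len G e})) -
     (\<Sum>e\<in>in_arcs (graph G) w. vector_derivative (v e) (at (len G e) within {0..len G e}))"

text \<open>
  The first conjunct (extensionality) only normalises \<open>v\<close> off the graph, so that the torsion
  function is unique as a HOL function.
\<close>

definition is_torsion_function :: "('v, 'e) mgraph \<Rightarrow> ('e \<Rightarrow> real \<Rightarrow> real) \<Rightarrow> bool" where
  "is_torsion_function G v \<longleftrightarrow>
     v \<in> (\<Pi>\<^sub>E e\<in>arcs (graph G). {0..len G e} \<rightarrow>\<^sub>E UNIV) \<and>
     (\<exists>val. continuous_on_graph G v val \<and> (\<forall>w\<in>dirichlet G. val w = 0)) \<and>
     (\<forall>e\<in>arcs (graph G). \<exists>h. H2_deriv2 (len G e) (v e) h \<and>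
        (AE x in lebesgue_on {0..len G e}. - h x = 1)) \<and>
     (\<forall>w\<in>verts (graph G) - dirichlet G. normal_deriv_sum G v w = 0)"

definition torsion_function :: "('v, 'e) mgraph \<Rightarrow> 'e \<Rightarrow> real \<Rightarrow> real" where
  "torsion_function G = (THE v. is_torsion_function G v)"

definition torsional_rigidity :: "('v, 'e) mgraph \<Rightarrow> real" where
  "torsional_rigidity G =
     (\<Sum>e\<in>arcs (graph G). LINT x|lebesgue_on {0..len G e}. torsion_function G e x)"


definition map_verts :: "('v \<Rightarrow> 'w) \<Rightarrow> ('v, 'e) pre_digraph \<Rightarrow> ('w, 'e) pre_digraph" where
  "map_verts f H = \<lparr> verts = f ` verts H, arcs = arcs H, tail = f \<circ> tail H, head = f \<circ> head H \<rparr>"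

text \<open>Quotient of the vertex set collapsing \<open>D\<close> to a point (classes of the partition).\<close>

definition glue_set :: "'v set \<Rightarrow> ('v, 'e) pre_digraph \<Rightarrow> ('v set, 'e) pre_digraph" where
  "glue_set D = map_verts (\<lambda>w. if w \<in> D then D else {w})"

definition doubly_connected :: "('v, 'e) pre_digraph \<Rightarrow> bool" where
  "doubly_connected H \<longleftrightarrow>
     Digraph_Component.connected H \<and>
     (\<forall>e\<in>arcs H. Digraph_Component.connected (pre_digraph.del_arc H e))"


text \<open>Isomorphism of metric graphs; edges may be reversed.\<close>

definition mgraph_iso :: "('v, 'e) mgraph \<Rightarrow> ('w, 'f) mgraph \<Rightarrow> bool" where
  "mgraph_iso G H \<longleftrightarrow>
     (\<exists>f g. bij_betw f (verts (graph G)) (verts (graph H)) \<and>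
            bij_betw g (arcs (graph G)) (arcs (graph H)) \<and>
            f ` dirichlet G = dirichlet H \<and>
            (\<forall>e\<in>arcs (graph G). len H (g e) = len G e \<and>
               {tail (graph H) (g e), head (graph H) (g e)} =
               f ` {tail (graph G) e, head (graph G) e}))"

definition glue_two :: "'v \<Rightarrow> 'v \<Rightarrow> ('v, 'e) mgraph \<Rightarrow> ('v, 'e) mgraph" where
  "glue_two a b G =
     \<lparr> graph = map_verts (\<lambda>w. if w = b then a else w) (graph G),
       len = len G, dirichlet = dirichlet G - {b} \<rparr>"

text \<open>Insert the new vertex \<open>w\<close> in the edge \<open>e\<close> at coordinate \<open>s\<close>; \<open>e'\<close> is the new second half.\<close>

definition subdivide_edge :: "'e \<Rightarrow> 'e \<Rightarrow> 'v \<Rightarrow> real \<Rightarrow> ('v, 'e) mgraph \<Rightarrow> ('v, 'e) mgraph" where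
  "subdivide_edge e e' w s G =
     \<lparr> graph = \<lparr> verts = insert w (verts (graph G)), arcs = insert e' (arcs (graph G)),
                 tail = (tail (graph G))(e' := w),
                 head = (head (graph G))(e := w, e' := head (graph G) e) \<rparr>,
       len = (len G)(e := s, e' := len G e - s),
       dirichlet = dirichlet G \<rparr>"

inductive elementary_step :: "('v, 'e) mgraph \<Rightarrow> ('v, 'e) mgraph \<Rightarrow> bool" where
  iso: "elementary_step G H" if "metric_graph G" "metric_graph H" "mgraph_iso G H"
| glue: "elementary_step G (glue_two a b G)"
    if "metric_graph G" "a \<in> dirichlet G" "b \<in> dirichlet G" "a \<noteq> b"
| subdivide: "elementary_step G (subdivide_edge e e' w s G)"
    if "metric_graph G" "e \<in> arcs (graph G)" "e' \<notin> arcs (graph G)" "w \<notin> verts (graph G)"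
       "0 < s" "s < len G e"

text \<open>
  Identification of metric graphs: the equivalence relation generated by isomorphism, gluing
  (inversely, splitting) Dirichlet vertices and inserting (inversely, removing) degree-two
  non-Dirichlet vertices.  It is formed on graphs over the natural numbers, where fresh vertices
  and edges are always available; an arbitrary graph is first copied there.
\<close>

definition identified :: "('v, 'e) mgraph \<Rightarrow> (nat, nat) mgraph \<Rightarrow> bool" where
  "identified G K \<longleftrightarrow> (\<exists>G'. mgraph_iso G G' \<and> equivclp elementary_step G' K)"

definition mixed_interval :: "('v, 'e) mgraph \<Rightarrow> bool" where
  "mixed_interval K \<longleftrightarrow>
     metric_graph K \<and>
     (\<exists>a b e. a \<noteq> b \<and> verts (graph K) = {a, b} \<and> arcs (graph K) = {e} \<and>
        {tail (graph K) e, head (graph K) e} = {a, b} \<and> dirichlet K = {a})"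

definition edges_between :: "('v, 'e) pre_digraph \<Rightarrow> 'v \<Rightarrow> 'v \<Rightarrow> 'e set" where
  "edges_between H a b = {e \<in> arcs H. {tail H e, head H e} = {a, b}}"

definition caterpillar :: "('v, 'e) mgraph \<Rightarrow> bool" where
  "caterpillar K \<longleftrightarrow>
     metric_graph K \<and>
     (\<exists>(m::nat) p. 1 \<le> m \<and> bij_betw p {0..m} (verts (graph K)) \<and>
        (\<forall>j\<in>{1..m}. card (edges_between (graph K) (p (j - 1)) (p j)) = 2 \<and>
           (\<forall>e\<in>edges_between (graph K) (p (j - 1)) (p j).
            \<forall>e'\<in>edges_between (graph K) (p (j - 1)) (p j). len K e = len K e')) \<and>
        arcs (graph K) = (\<Union>j\<in>{1..m}. edges_between (graph K) (p (j - 1)) (p j)) \<and>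
        dirichlet K = {p 0})"

definition is_mixed_interval :: "('v, 'e) mgraph \<Rightarrow> bool" where
  "is_mixed_interval G \<longleftrightarrow> (\<exists>K. identified G K \<and> mixed_interval K)"

definition is_caterpillar :: "('v, 'e) mgraph \<Rightarrow> bool" where
  "is_caterpillar G \<longleftrightarrow> (\<exists>K. identified G K \<and> caterpillar K)"

end

(*
  On an edge of length l the torsion function is a parabola, so it is determined by its vertex values
  and T is the energy of a flux of divergence 1.  By Thomson's principle T is the minimum of the
  energy over all such fluxes, and upper bounds come from competitors.  Taking off an edge at the
  Dirichlet set and letting all the rest flow through it bounds the integral of q^2 over this edge by
  the integral of s^2 over [L - l, L].  In the doubly connected case one takes off an ear, i.e. a
  path with both ends in the Dirichlet set, and divides the total load M evenly between its ends: the
  flux decreases from M/2 to -M/2 along the ear, and the integral of q^2 is largest if the load from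
  the rest enters at the midpoint.  Both inductions add up to the integral of s^2, or of (s/2)^2, over
  [0, L].  Equality forces the whole rest to hang on a single vertex, the far end of the edge or the
  midpoint of the ear, and so determines the graph.
*)
theory Submission
  imports Defs
begin

section \<open>Discrete networks and Thomson's principle\<close>

text \<open>Both inductions extend fluxes and never compare torsion functions: removing an edge or
  an ear turns its vertices into Dirichlet vertices, and while a flux of the rest can be continued
  through the removed piece, the torsion function of the rest is a different function. This shapes
  the statements. The rest may be disconnected, so connectivity is replaced by reachability of the
  Dirichlet set. The Dirichlet set grows, so the bounds are for arbitrary \<open>D\<close>, and only
  the equality case assumes that \<open>D\<close> meets the edges in at most one vertex; gluing
  brings a graph into this form. To see that the rest hangs on one vertex, each Dirichlet vertex
  that it touches must receive a strictly positive load, which \<open>pos_flow\<close> carries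
  along. Equality is a sandwich: T is at most the energy of the competitor, which is at most the
  bound, so if T attains the bound, then so does the competitor, and its construction is read
  backwards. The window [L - l, L] is the worst one because the rest delivers at most its own
  length.\<close>

locale network =
  fixes src tgt :: "'e \<Rightarrow> 'v" and l :: "'e \<Rightarrow> real"
begin

text \<open>
  A flux with divergence \<open>1\<close> on the edge \<open>e\<close> is affine with slope \<open>1\<close>, hence given by its value \<open>\<phi> e\<close>
  at the midpoint, counted positive towards the source.  The load at a vertex is what arrives there
  from the edges, and the energy is the integral of the squared flux.
\<close>

definition load :: "'e set \<Rightarrow> ('e \<Rightarrow> real) \<Rightarrow> 'v \<Rightarrow> real" where
  "load E \<phi> w = (\<Sum>e\<in>E. of_bool (src e = w) * (l e / 2 + \<phi> e) + of_bool (tgt e = w) * (l e / 2 - \<phi> e))"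

definition energy :: "'e set \<Rightarrow> ('e \<Rightarrow> real) \<Rightarrow> real" where
  "energy E \<phi> = (\<Sum>e\<in>E. l e ^ 3 / 12 + l e * (\<phi> e)\<^sup>2)"

text \<open>The slope of a parabola at the midpoint of an interval is its difference quotient, so
  this is the midpoint flux of the function with vertex values \<open>f\<close> and -u'' = 1 on the
  edge.\<close>

definition grad :: "('v \<Rightarrow> real) \<Rightarrow> 'e \<Rightarrow> real" where
  "grad f e = (f (tgt e) - f (src e)) / l e"

definition flow :: "'e set \<Rightarrow> 'v set \<Rightarrow> ('e \<Rightarrow> real) \<Rightarrow> bool" where
  "flow E D \<phi> \<longleftrightarrow> (\<forall>w. w \<notin> D \<longrightarrow> load E \<phi> w = 0)"

definition sol :: "'e set \<Rightarrow> 'v set \<Rightarrow> ('v \<Rightarrow> real) \<Rightarrow> bool" where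
  "sol E D f \<longleftrightarrow> (\<forall>w\<in>D. f w = 0) \<and> flow E D (grad f)"

definition ends :: "'e set \<Rightarrow> 'v set" where
  "ends E = src ` E \<union> tgt ` E"

text \<open>For nonempty \<open>D\<close>, all vertices reach \<open>D\<close> iff the graph is
  connected once \<open>D\<close> is glued to a point. This survives the removal of edges whose ends
  are added to \<open>D\<close>.\<close>

inductive reach :: "'e set \<Rightarrow> 'v set \<Rightarrow> 'v \<Rightarrow> bool" for E D where
  base: "w \<in> D \<Longrightarrow> reach E D w"
| step: "e \<in> E \<Longrightarrow> {src e, tgt e} = {w, u} \<Longrightarrow> reach E D u \<Longrightarrow> reach E D w"

lemma load_cong:
  "E = E' \<Longrightarrow> (\<And>e. e \<in> E' \<Longrightarrow> \<phi> e = \<psi> e) \<Longrightarrow> load E \<phi> w = load E' \<psi> w"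
  by (simp add: load_def)

lemma energy_cong:
  "E = E' \<Longrightarrow> (\<And>e. e \<in> E' \<Longrightarrow> \<phi> e = \<psi> e) \<Longrightarrow> energy E \<phi> = energy E' \<psi>"
  by (simp add: energy_def)

lemma load_Un:
  "finite A \<Longrightarrow> finite B \<Longrightarrow> A \<inter> B = {} \<Longrightarrow> load (A \<union> B) \<phi> w = load A \<phi> w + load B \<phi> w"
  by (simp add: load_def sum.union_disjoint)

lemma energy_Un:
  "finite A \<Longrightarrow> finite B \<Longrightarrow> A \<inter> B = {} \<Longrightarrow> energy (A \<union> B) \<phi> = energy A \<phi> + energy B \<phi>"
  by (simp add: energy_def sum.union_disjoint)

lemma load_not_end: "w \<notin> ends E \<Longrightarrow> load E \<phi> w = 0"
  unfolding load_def ends_def by (rule sum.neutral) auto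

lemma finite_ends: "finite E \<Longrightarrow> finite (ends E)"
  by (simp add: ends_def)

lemma sum_weighted_load:
  assumes "finite E" "finite V" "ends E \<subseteq> V"
  shows "(\<Sum>w\<in>V. f w * load E \<phi> w)
    = (\<Sum>e\<in>E. f (src e) * (l e / 2 + \<phi> e) + f (tgt e) * (l e / 2 - \<phi> e))"
proof -
  have "(\<Sum>w\<in>V. f w * load E \<phi> w)
    = (\<Sum>e\<in>E. \<Sum>w\<in>V. f w * (of_bool (src e = w) * (l e / 2 + \<phi> e) + of_bool (tgt e = w) * (l e / 2 - \<phi> e)))"
    unfolding load_def sum_distrib_left by (rule sum.swap)
  also have "\<dots> = (\<Sum>e\<in>E. f (src e) * (l e / 2 + \<phi> e) + f (tgt e) * (l e / 2 - \<phi> e))"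
  proof (rule sum.cong)
    fix e assume "e \<in> E"
    then have "src e \<in> V" "tgt e \<in> V" using assms by (auto simp: ends_def)
    moreover have "f w * (of_bool (src e = w) * (l e / 2 + \<phi> e) + of_bool (tgt e = w) * (l e / 2 - \<phi> e))
      = (if src e = w then f w * (l e / 2 + \<phi> e) else 0) + (if tgt e = w then f w * (l e / 2 - \<phi> e) else 0)" for w
      by (auto simp: algebra_simps)
    ultimately show "(\<Sum>w\<in>V. f w * (of_bool (src e = w) * (l e / 2 + \<phi> e) + of_bool (tgt e = w) * (l e / 2 - \<phi> e)))
      = f (src e) * (l e / 2 + \<phi> e) + f (tgt e) * (l e / 2 - \<phi> e)"
      using assms(2) by (simp add: sum.distrib)
  qed simp
  finally show ?thesis .
qed

lemma sum_load:
  assumes "finite E" "finite V" "ends E \<subseteq> V"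
  shows "(\<Sum>w\<in>V. load E \<phi> w) = sum l E"
  using sum_weighted_load[OF assms, of "\<lambda>_. 1"] by simp

text \<open>Discrete integration by parts: \<open>f\<close> vanishes on \<open>D\<close> and the
  load vanishes elsewhere, so their pairing is zero. The right-hand side does not involve \<phi>, so
  the difference of two flows is orthogonal to \<open>grad f\<close>.\<close>

lemma flow_pairing:
  assumes "finite E" "\<forall>e\<in>E. 0 < l e" "\<forall>w\<in>D. f w = 0" "flow E D \<phi>"
  shows "(\<Sum>e\<in>E. l e * (\<phi> e * grad f e)) = (\<Sum>e\<in>E. l e * (f (src e) + f (tgt e)) / 2)"
proof -
  have "f w * load E \<phi> w = 0" for w
    using assms(3,4) by (cases "w \<in> D") (auto simp: flow_def)
  then have "0 = (\<Sum>w\<in>ends E. f w * load E \<phi> w)" by (simp only: sum.neutral_const)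
  also have "\<dots> = (\<Sum>e\<in>E. f (src e) * (l e / 2 + \<phi> e) + f (tgt e) * (l e / 2 - \<phi> e))"
    using assms by (intro sum_weighted_load) (auto simp: finite_ends)
  also have "\<dots> = (\<Sum>e\<in>E. l e * (f (src e) + f (tgt e)) / 2 - l e * (\<phi> e * grad f e))"
    using assms(2) by (intro sum.cong) (auto simp: grad_def field_simps)
  finally show ?thesis by (simp add: sum_subtractf)
qed

text \<open>The right-hand side sums the integrals of the edge parabolas; this is how the torsional
  rigidity becomes an energy.\<close>

lemma energy_grad:
  assumes "finite E" "\<forall>e\<in>E. 0 < l e" "sol E D f"
  shows "energy E (grad f) = (\<Sum>e\<in>E. l e ^ 3 / 12 + l e * (f (src e) + f (tgt e)) / 2)"
  using flow_pairing[OF assms(1,2), of D f "grad f"] assms(3)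
  by (simp add: energy_def sol_def power2_eq_square sum.distrib)

text \<open>Pythagoras: by \<open>flow_pairing\<close>, \<phi> - \<open>grad f\<close> is orthogonal
  to \<open>grad f\<close> in the inner product weighted by \<open>l\<close>.\<close>

lemma thomson:
  assumes "finite E" "\<forall>e\<in>E. 0 < l e" "sol E D f" "flow E D \<phi>"
  shows "energy E \<phi> = energy E (grad f) + (\<Sum>e\<in>E. l e * (\<phi> e - grad f e)\<^sup>2)"
proof -
  have a: "(\<Sum>e\<in>E. l e * (\<phi> e * grad f e)) = (\<Sum>e\<in>E. l e * (grad f e * grad f e))"
    using flow_pairing[OF assms(1,2), of D f \<phi>] flow_pairing[OF assms(1,2), of D f "grad f"] assms(3,4)
    by (simp add: sol_def)
  have "(\<Sum>e\<in>E. l e * (\<phi> e - grad f e)\<^sup>2)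
    = (\<Sum>e\<in>E. l e * (\<phi> e)\<^sup>2) - 2 * (\<Sum>e\<in>E. l e * (\<phi> e * grad f e)) + (\<Sum>e\<in>E. l e * (grad f e * grad f e))"
    by (simp add: sum_distrib_left sum.distrib[symmetric] sum_subtractf[symmetric] power2_eq_square algebra_simps)
  with a show ?thesis by (simp add: energy_def sum.distrib power2_eq_square)
qed

lemma energy_grad_le:
  assumes "finite E" "\<forall>e\<in>E. 0 < l e" "sol E D f" "flow E D \<phi>"
  shows "energy E (grad f) \<le> energy E \<phi>"
proof -
  have "0 \<le> (\<Sum>e\<in>E. l e * (\<phi> e - grad f e)\<^sup>2)"
    using assms(2) by (intro sum_nonneg) (simp add: less_imp_le)
  then show ?thesis using thomson[OF assms] by simp
qed

lemma reach_mono: "reach E D w \<Longrightarrow> E \<subseteq> E' \<Longrightarrow> D \<subseteq> D' \<Longrightarrow> reach E' D' w"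
  by (induction rule: reach.induct) (auto intro: reach.intros)

lemma reach_const:
  assumes "reach E D w" "\<forall>e\<in>E. f (src e) = f (tgt e)" "\<forall>w\<in>D. f w = c"
  shows "f w = c"
  using assms by (induction rule: reach.induct) (auto simp: doubleton_eq_iff)

text \<open>Each gradient flux competes against the other, so the energies agree and the square term
  in \<open>thomson\<close> vanishes. Then f - g is constant along every edge, and zero on
  \<open>D\<close>.\<close>

lemma sol_unique:
  assumes "finite E" "\<forall>e\<in>E. 0 < l e" "sol E D f" "sol E D g" "reach E D w"
  shows "f w = g w"
proof -
  have "energy E (grad f) = energy E (grad g)"
    using energy_grad_le[OF assms(1,2,3), of "grad g"] energy_grad_le[OF assms(1,2,4), of "grad f"] assms(3,4)
    by (simp add: sol_def)
  then have "(\<Sum>e\<in>E. l e * (grad g e - grad f e)\<^sup>2) = 0"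
    using thomson[OF assms(1,2,3), of "grad g"] assms(4) by (simp add: sol_def)
  then have "\<forall>e\<in>E. l e * (grad g e - grad f e)\<^sup>2 = 0"
    using assms(1,2) by (subst (asm) sum_nonneg_eq_0_iff) (auto simp: less_imp_le)
  then have "\<forall>e\<in>E. (\<lambda>v. f v - g v) (src e) = (\<lambda>v. f v - g v) (tgt e)"
    using assms(2) by (fastforce simp: grad_def field_simps)
  from reach_const[OF assms(5) this, of 0] show ?thesis
    using assms(3,4) by (simp add: sol_def)
qed

end

text \<open>Elimination of one unknown replaces the matrix by its Schur complement, which inherits positivity.\<close>

lemma positive_system_solvable:
  fixes A :: "'i \<Rightarrow> 'i \<Rightarrow> real"
  assumes "finite I"
    and "\<And>x. \<exists>i\<in>I. x i \<noteq> 0 \<Longrightarrow> 0 < (\<Sum>i\<in>I. x i * (\<Sum>j\<in>I. A i j * x j))"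
  shows "\<exists>x. \<forall>i\<in>I. (\<Sum>j\<in>I. A i j * x j) = b i"
  using assms
proof (induction I arbitrary: A b rule: finite_induct)
  case (insert k I)
  let ?a = "A k k"
  have a: "0 < ?a"
  proof -
    have z: "(\<Sum>i\<in>I. of_bool (i = k) * g i) = 0" "(\<Sum>i\<in>I. g i * of_bool (i = k)) = 0" for g :: "'i \<Rightarrow> real"
      using insert.hyps by (auto intro!: sum.neutral)
    show ?thesis using insert.prems[of "\<lambda>i. of_bool (i = k)"] insert.hyps by (simp add: z)
  qed
  define B where "B i j = A i j - A i k * A k j / ?a" for i j
  have row: "(\<Sum>j\<in>I. B i j * x j) = (\<Sum>j\<in>I. A i j * x j) - A i k * (\<Sum>j\<in>I. A k j * x j) / ?a" for i x
    by (simp add: B_def algebra_simps sum_subtractf sum_distrib_left sum_divide_distrib)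
  have "\<exists>x. \<forall>i\<in>I. (\<Sum>j\<in>I. B i j * x j) = b i - A i k * b k / ?a"
  proof (rule insert.IH)
    fix x :: "'i \<Rightarrow> real" assume x: "\<exists>i\<in>I. x i \<noteq> 0"
    let ?s = "\<Sum>j\<in>I. A k j * x j"
    \<comment> \<open>This value at \<open>k\<close> annihilates row \<open>k\<close>, so the form
      of \<open>A\<close> at \<open>y\<close> equals the form of \<open>B\<close> at
      \<open>x\<close>.\<close>
    define y where "y = x(k := - ?s / ?a)"
    have yI: "(\<Sum>j\<in>I. g j * y j) = (\<Sum>j\<in>I. g j * x j)" for g
      using insert.hyps by (auto simp: y_def intro!: sum.cong)
    have rk: "(\<Sum>j\<in>insert k I. A k j * y j) = 0"
      using insert.hyps a by (simp add: yI) (simp add: y_def)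
    have ri: "(\<Sum>j\<in>insert k I. A i j * y j) = (\<Sum>j\<in>I. B i j * x j)" for i
      using insert.hyps a by (simp add: yI row) (simp add: y_def)
    have "\<exists>i\<in>insert k I. y i \<noteq> 0" using x insert.hyps by (auto simp: y_def)
    from insert.prems[OF this] have "0 < (\<Sum>i\<in>I. y i * (\<Sum>j\<in>insert k I. A i j * y j))"
      using insert.hyps rk by simp
    also have "\<dots> = (\<Sum>i\<in>I. x i * (\<Sum>j\<in>I. B i j * x j))"
      using insert.hyps unfolding ri by (auto simp: y_def intro!: sum.cong)
    finally show "0 < (\<Sum>i\<in>I. x i * (\<Sum>j\<in>I. B i j * x j))" .
  qed
  then obtain x where x: "\<forall>i\<in>I. (\<Sum>j\<in>I. B i j * x j) = b i - A i k * b k / ?a" by blast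
  define y where "y = x(k := (b k - (\<Sum>j\<in>I. A k j * x j)) / ?a)"
  have yI: "(\<Sum>j\<in>I. g j * y j) = (\<Sum>j\<in>I. g j * x j)" for g
    using insert.hyps by (auto simp: y_def intro!: sum.cong)
  have "(\<Sum>j\<in>insert k I. A k j * y j) = b k"
    using insert.hyps a by (simp add: yI) (simp add: y_def)
  moreover have "(\<Sum>j\<in>insert k I. A i j * y j) = b i" if "i \<in> I" for i
  proof -
    have "(\<Sum>j\<in>insert k I. A i j * y j) = A i k * (b k - (\<Sum>j\<in>I. A k j * x j)) / ?a + (\<Sum>j\<in>I. A i j * x j)"
      using insert.hyps by (simp add: yI) (simp add: y_def)
    also have "\<dots> = (\<Sum>j\<in>I. B i j * x j) + A i k * b k / ?a"
      by (simp add: row diff_divide_distrib right_diff_distrib)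
    finally show ?thesis using x that by simp
  qed
  ultimately show ?case by (intro exI[of _ y]) auto
qed simp

context network
begin

text \<open>The balance outside \<open>D\<close> is a linear system with the weighted graph
  Laplacian \<open>A\<close> as matrix and half the incident length as right-hand side. Its
  quadratic form is the sum of squared differences over lengths; it vanishes only for functions
  constant along edges, hence zero wherever \<open>D\<close> is reached.\<close>

lemma sol_exists:
  assumes fin: "finite E" and pos: "\<forall>e\<in>E. 0 < l e" and conn: "\<forall>w\<in>ends E. reach E D w"
  shows "\<exists>f. sol E D f"
proof -
  define U where "U = ends E - D"
  define dl where "dl e w = (of_bool (src e = w) - of_bool (tgt e = w) :: real)" for e w
  define A where "A i j = (\<Sum>e\<in>E. dl e i * dl e j / l e)" for i j
  define ext where "ext x w = (if w \<in> U then x w else 0 :: real)" for x w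
  have finU: "finite U" by (simp add: U_def fin finite_ends)
  have dl: "(\<Sum>j\<in>U. dl e j * x j) = ext x (src e) - ext x (tgt e)" for e x
  proof -
    have "dl e j * x j = (if src e = j then x j else 0) - (if tgt e = j then x j else 0)" for j
      by (auto simp: dl_def)
    then show ?thesis using finU by (auto simp: sum_subtractf ext_def)
  qed
  have row: "(\<Sum>j\<in>U. A i j * x j) = (\<Sum>e\<in>E. dl e i * (ext x (src e) - ext x (tgt e)) / l e)" for i x
  proof -
    have "(\<Sum>j\<in>U. A i j * x j) = (\<Sum>j\<in>U. \<Sum>e\<in>E. dl e i * (dl e j * x j) / l e)"
      unfolding A_def sum_distrib_right by (simp add: mult.assoc)
    also have "\<dots> = (\<Sum>e\<in>E. \<Sum>j\<in>U. dl e i * (dl e j * x j) / l e)" by (rule sum.swap)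
    also have "\<dots> = (\<Sum>e\<in>E. dl e i * (ext x (src e) - ext x (tgt e)) / l e)"
      by (simp add: dl[symmetric] sum_distrib_left sum_divide_distrib)
    finally show ?thesis .
  qed
  have "\<exists>x. \<forall>i\<in>U. (\<Sum>j\<in>U. A i j * x j) = load E (\<lambda>_. 0) i"
  proof (rule positive_system_solvable[OF finU])
    fix x :: "'v \<Rightarrow> real" assume x: "\<exists>i\<in>U. x i \<noteq> 0"
    have "(\<Sum>i\<in>U. x i * (\<Sum>j\<in>U. A i j * x j)) = (\<Sum>i\<in>U. \<Sum>e\<in>E. (dl e i * x i) * (ext x (src e) - ext x (tgt e)) / l e)"
      unfolding row sum_distrib_left by (simp add: mult_ac)
    also have "\<dots> = (\<Sum>e\<in>E. \<Sum>i\<in>U. (dl e i * x i) * (ext x (src e) - ext x (tgt e)) / l e)" by (rule sum.swap)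
    also have "\<dots> = (\<Sum>e\<in>E. (ext x (src e) - ext x (tgt e))\<^sup>2 / l e)"
      by (simp add: sum_divide_distrib[symmetric] sum_distrib_right[symmetric] dl power2_eq_square)
    finally have q: "(\<Sum>i\<in>U. x i * (\<Sum>j\<in>U. A i j * x j)) = \<dots>" .
    have nn: "0 \<le> (ext x (src e) - ext x (tgt e))\<^sup>2 / l e" if "e \<in> E" for e
      using that pos by (simp add: less_imp_le)
    have "(\<Sum>e\<in>E. (ext x (src e) - ext x (tgt e))\<^sup>2 / l e) \<noteq> 0"
    proof
      assume "(\<Sum>e\<in>E. (ext x (src e) - ext x (tgt e))\<^sup>2 / l e) = 0"
      then have "\<forall>e\<in>E. (ext x (src e) - ext x (tgt e))\<^sup>2 / l e = 0"
        using nn fin by (subst (asm) sum_nonneg_eq_0_iff) auto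
      then have "\<forall>e\<in>E. ext x (src e) = ext x (tgt e)" using pos by fastforce
      then have "ext x w = 0" if "w \<in> ends E" for w
        using conn that by (intro reach_const[of E D]) (auto simp: ext_def U_def)
      with x show False by (force simp: ext_def U_def)
    qed
    moreover have "0 \<le> (\<Sum>e\<in>E. (ext x (src e) - ext x (tgt e))\<^sup>2 / l e)" by (rule sum_nonneg) (rule nn)
    ultimately show "0 < (\<Sum>i\<in>U. x i * (\<Sum>j\<in>U. A i j * x j))" unfolding q by simp
  qed
  then obtain x where x: "\<forall>i\<in>U. (\<Sum>j\<in>U. A i j * x j) = load E (\<lambda>_. 0) i" by blast
  have "load E (grad (ext x)) w = 0" if "w \<notin> D" for w
  proof (cases "w \<in> ends E")
    case True
    have "load E (grad (ext x)) w = load E (\<lambda>_. 0) w - (\<Sum>e\<in>E. dl e w * (ext x (src e) - ext x (tgt e)) / l e)"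
      unfolding load_def sum_subtractf[symmetric]
      by (intro sum.cong) (auto simp: grad_def dl_def diff_divide_distrib)
    also have "\<dots> = 0" using x row[of w x] that True by (auto simp: U_def)
    finally show ?thesis .
  qed (simp add: load_not_end)
  then show ?thesis
    by (intro exI[of _ "ext x"]) (auto simp: sol_def flow_def ext_def U_def)
qed

end


section \<open>Fluxes along a path\<close>

text \<open>The primitive of the positive part of \<open>s\<^sup>2 - c\<^sup>2\<close> that vanishes at \<open>0\<close>.\<close>

definition excess :: "real \<Rightarrow> real \<Rightarrow> real" where
  "excess c s = (if c \<le> s then (s - c)\<^sup>2 * (s + 2 * c) / 3
     else if s \<le> - c then (s + c)\<^sup>2 * (s - 2 * c) / 3 else 0)"

text \<open>The left-hand side is the integral of s^2 - c^2 over [z - d, z], the right-hand side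
  that of its positive part. For c > 0 they agree only if the interval avoids (-c, c).\<close>

lemma excess_edge:
  assumes "0 \<le> c" "0 < d"
  shows "(z ^ 3 - (z - d) ^ 3) / 3 - c\<^sup>2 * d \<le> excess c z - excess c (z - d)" (is ?le)
    and "0 < c \<Longrightarrow> (z ^ 3 - (z - d) ^ 3) / 3 - c\<^sup>2 * d = excess c z - excess c (z - d)
      \<Longrightarrow> z \<le> - c \<or> c \<le> z - d" (is "_ \<Longrightarrow> ?eq \<Longrightarrow> ?out")
proof -
  define y where "y = z - d"
  have d: "d = z - y" "y < z" using assms(2) by (auto simp: y_def)
  let ?k = "\<lambda>s. s ^ 3 / 3 - c\<^sup>2 * s"
  have lhs: "(z ^ 3 - y ^ 3) / 3 - c\<^sup>2 * d = ?k z - ?k y"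
    by (simp add: d(1) algebra_simps diff_divide_distrib)
  have up: "?k s + 2 * c ^ 3 / 3 = (s - c)\<^sup>2 * (s + 2 * c) / 3" for s
    by (simp add: power2_eq_square power3_eq_cube algebra_simps)
  have lo: "?k s - 2 * c ^ 3 / 3 = (s + c)\<^sup>2 * (s - 2 * c) / 3" for s
    by (simp add: power2_eq_square power3_eq_cube algebra_simps)
  have ex: "excess c s = (if c \<le> s then ?k s + 2 * c ^ 3 / 3 else if s \<le> - c then ?k s - 2 * c ^ 3 / 3 else 0)" for s
    by (simp add: excess_def up lo)
  have c3: "0 \<le> c ^ 3" using assms(1) by simp
  have upos: "- 2 * c ^ 3 / 3 < ?k s" if "- c < s" "s < c" for s
  proof -
    have "0 < (s - c)\<^sup>2 * (s + 2 * c) / 3" using that assms(1) by simp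
    then show ?thesis by (simp add: up[symmetric])
  qed
  have lneg: "?k s < 2 * c ^ 3 / 3" if "- c < s" "s < c" for s
  proof -
    have "(s + c)\<^sup>2 * (s - 2 * c) / 3 < 0" using that assms(1) by (simp add: mult_pos_neg)
    then show ?thesis by (simp add: lo[symmetric])
  qed
  have mid: "?k z < ?k y" if "- c < y" "z < c"
  proof -
    have "z\<^sup>2 < c\<^sup>2" "y\<^sup>2 < c\<^sup>2" using that d(2) assms(1) by (auto intro!: power2_strict_mono simp: abs_less_iff)
    moreover have "2 * (z * y) \<le> z\<^sup>2 + y\<^sup>2" using sum_squares_bound[of z y] by simp
    ultimately have "z\<^sup>2 + z * y + y\<^sup>2 - 3 * c\<^sup>2 < 0" by linarith
    then have "(z - y) * (z\<^sup>2 + z * y + y\<^sup>2 - 3 * c\<^sup>2) < 0" using d(2) by (simp add: mult_pos_neg)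
    also have "(z - y) * (z\<^sup>2 + z * y + y\<^sup>2 - 3 * c\<^sup>2) = 3 * (?k z - ?k y)"
      by (simp add: power2_eq_square power3_eq_cube algebra_simps)
    finally show ?thesis by simp
  qed
  have *: "?k z - ?k y \<le> excess c z - excess c y \<and>
      (0 < c \<longrightarrow> ?k z - ?k y = excess c z - excess c y \<longrightarrow> z \<le> - c \<or> c \<le> y)"
  proof (cases "z \<le> - c")
    case True
    show ?thesis
    proof (cases "c \<le> z \<or> c \<le> y")
      case True
      then have "c = 0" "z = 0" using \<open>z \<le> - c\<close> d(2) assms(1) by auto
      then show ?thesis using d(2) by (simp add: excess_def power2_eq_square power3_eq_cube)
    qed (use True d(2) in \<open>auto simp: ex\<close>)
  next
    case z: False
    show ?thesis
    proof (cases "c \<le> y")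
      case True
      then show ?thesis using d(2) by (auto simp: ex)
    next
      case False
      consider "c \<le> z" "y \<le> - c" | "c \<le> z" "- c < y" | "z < c" "y \<le> - c" | "z < c" "- c < y" by linarith
      then show ?thesis
      proof cases
        case 1 then show ?thesis using False z c3 by (auto simp: ex)
      next
        case 2 then show ?thesis using False z upos[of y] by (auto simp: ex)
      next
        case 3 then show ?thesis using False z lneg[of z] by (auto simp: ex)
      next
        case 4 then show ?thesis using False z mid by (auto simp: ex)
      qed
    qed
  qed
  show ?le using * unfolding y_def[symmetric] lhs by blast
  show "0 < c \<Longrightarrow> ?eq \<Longrightarrow> ?out" using * unfolding y_def[symmetric] lhs by blast
qed

text \<open>The integrand behind \<open>excess\<close> is nonnegative and vanishes exactly on
  [-c, c].\<close>

lemma excess_mono: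
  assumes "0 \<le> c" "y \<le> z"
  shows "excess c y \<le> excess c z"
    and "y < z \<Longrightarrow> excess c y = excess c z \<Longrightarrow> - c \<le> y \<and> z \<le> c"
proof -
  have up: "(s - c)\<^sup>2 * (s + 2 * c) / 3 < (r - c)\<^sup>2 * (r + 2 * c) / 3" if "c \<le> s" "s < r" for s r
  proof -
    have "(s - c)\<^sup>2 * (s + 2 * c) \<le> (s - c)\<^sup>2 * (r + 2 * c)"
      using that assms by (intro mult_left_mono) auto
    also have "\<dots> < (r - c)\<^sup>2 * (r + 2 * c)"
      using that assms by (intro mult_strict_right_mono power_strict_mono) auto
    finally show ?thesis by simp
  qed
  have lo: "(s + c)\<^sup>2 * (s - 2 * c) / 3 < (r + c)\<^sup>2 * (r - 2 * c) / 3" if "s < r" "r \<le> - c" for s r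
  proof -
    have "(- x - c)\<^sup>2 * (- x + 2 * c) / 3 = - ((x + c)\<^sup>2 * (x - 2 * c) / 3)" for x
      by (simp add: power2_eq_square field_simps)
    then show ?thesis using up[of "- r" "- s"] that by simp
  qed
  have nn: "0 \<le> (s - c)\<^sup>2 * (s + 2 * c) / 3" if "c \<le> s" for s
    using that assms by simp
  have np: "(s + c)\<^sup>2 * (s - 2 * c) / 3 \<le> 0" if "s \<le> - c" for s
    using that assms by (simp add: mult_nonneg_nonpos)
  have *: "excess c y \<le> excess c z \<and> (excess c y = excess c z \<longrightarrow> - c \<le> y \<and> z \<le> c)" if lt: "y < z"
  proof -
    have zc: "0 < (z - c)\<^sup>2 * (z + 2 * c) / 3" if "c < z" using that assms by simp
    have yc: "(y + c)\<^sup>2 * (y - 2 * c) / 3 < 0" if "y < - c" using that assms by (simp add: mult_pos_neg)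
    consider "c \<le> y" | "- c < y" "y < c" | "y \<le> - c" "y < c" by linarith
    then show ?thesis
    proof cases
      case 1 then show ?thesis using lt up[of y z] by (auto simp: excess_def)
    next
      case 2 then show ?thesis using lt nn[of z] zc by (auto simp: excess_def)
    next
      case 3
      consider "z \<le> - c" "z < c" | "- c < z" "z < c" | "c \<le> z" by linarith
      then show ?thesis
      proof cases
        case 1 then show ?thesis using lt 3 lo[of y z] by (auto simp: excess_def)
      next
        case 2 then show ?thesis using lt 3 yc np[of y] assms by (cases "y = -c") (auto simp: excess_def)
      next
        case b: 3
        have e: "excess c y = (y + c)\<^sup>2 * (y - 2 * c) / 3" "excess c z = (z - c)\<^sup>2 * (z + 2 * c) / 3"
          using 3 b by (auto simp: excess_def)
        show ?thesis
        proof (cases "y < - c \<or> c < z")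
          case True
          then have "excess c y < excess c z"
            unfolding e using yc zc np[OF 3(1)] nn[OF b] by linarith
          then show ?thesis by simp
        next
          case False
          then show ?thesis using 3 b by (auto simp: excess_def)
        qed
      qed
    qed
  qed
  show "excess c y \<le> excess c z" using * assms(2) by (cases "y = z") auto
  show "y < z \<Longrightarrow> excess c y = excess c z \<Longrightarrow> - c \<le> y \<and> z \<le> c" using * by blast
qed

lemma excess_minus: "0 \<le> c \<Longrightarrow> excess c (- s) = - excess c s"
proof (cases "c \<le> s \<and> c \<le> - s")
  case True
  moreover assume "0 \<le> c"
  ultimately have "s = 0" "c = 0" by linarith+
  then show ?thesis by (simp add: excess_def)
next
  case False
  have "(- s - c)\<^sup>2 = (s + c)\<^sup>2" "(- s + c)\<^sup>2 = (s - c)\<^sup>2"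
    by (simp_all add: power2_eq_square algebra_simps)
  then show ?thesis using False by (auto simp: excess_def field_simps)
qed

text \<open>
  The integral of the squared flux along a path: the flux starts at \<open>z\<close>, decreases with slope 1 along
  an edge of length \<open>d\<close> and jumps down by \<open>m\<close> at the vertex behind it.
\<close>

fun drop_energy :: "real \<Rightarrow> (real \<times> real) list \<Rightarrow> real" where
  "drop_energy z [] = 0"
| "drop_energy z ((d, m) # xs) = (z ^ 3 - (z - d) ^ 3) / 3 + drop_energy (z - d - m) xs"

text \<open>Split s^2 into c^2 and s^2 - c^2. The first part costs c^2 times the length. The second
  is at most the increment of \<open>excess\<close> on each edge, and these increments telescope,
  since a jump only skips a further nonnegative increment. So the bound does not depend on where the
  jumps occur.\<close>

lemma drop_energy_le:
  assumes "0 \<le> c" "\<forall>(d, m)\<in>set xs. 0 < d \<and> 0 \<le> m"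
  shows "drop_energy z xs \<le> c\<^sup>2 * sum_list (map fst xs) + excess c z
    - excess c (z - sum_list (map fst xs) - sum_list (map snd xs))"
  using assms(2)
proof (induction xs arbitrary: z)
  case (Cons x xs)
  obtain d m where x: "x = (d, m)" by (cases x)
  show ?case
    using Cons.IH[of "z - d - m"] Cons.prems excess_edge(1)[OF assms(1), of d z]
      excess_mono(1)[OF assms(1), of "z - d - m" "z - d"]
    by (simp add: x algebra_simps)
qed simp

text \<open>Equality leaves no edge with flux in (-c, c) and allows nonzero jumps only inside
  [-c, c]. Starting at or above c, with jumps of total size 2c, the flux must come down to exactly c
  and jump to -c at once.\<close>

lemma drop_energy_eq:
  assumes "0 < c" "\<forall>(d, m)\<in>set xs. 0 < d \<and> 0 \<le> m" "c \<le> z" "sum_list (map snd xs) = 2 * c"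
    and "drop_energy z xs = c\<^sup>2 * sum_list (map fst xs) + excess c z
      - excess c (z - sum_list (map fst xs) - sum_list (map snd xs))"
  shows "\<exists>ys d zs. xs = ys @ (d, 2 * c) # zs \<and> z - sum_list (map fst ys) - d = c"
  using assms(2-)
proof (induction xs arbitrary: z)
  case Nil
  then show ?case using assms(1) by simp
next
  case (Cons x xs)
  obtain d m where x: "x = (d, m)" by (cases x)
  have c: "0 \<le> c" and dm: "0 < d" "0 \<le> m" and xs: "\<forall>(d, m)\<in>set xs. 0 < d \<and> 0 \<le> m"
    using assms(1) Cons.prems x by auto
  let ?z = "z - d - m"
  have all: "(z ^ 3 - (z - d) ^ 3) / 3 - c\<^sup>2 * d = excess c z - excess c (z - d)"
    "excess c (z - d) = excess c ?z"
    "drop_energy ?z xs = c\<^sup>2 * sum_list (map fst xs) + excess c ?z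
      - excess c (?z - sum_list (map fst xs) - sum_list (map snd xs))"
    using drop_energy_le[OF c xs, of ?z] excess_edge(1)[OF c dm(1), of z]
      excess_mono(1)[OF c, of ?z "z - d"] Cons.prems(4) dm
    by (auto simp: x algebra_simps)
  have zd: "c \<le> z - d" using excess_edge(2)[OF c dm(1) assms(1) all(1)] Cons.prems(2) assms(1) by auto
  show ?case
  proof (cases "m = 0")
    case True
    with Cons.IH[OF xs _ _ all(3)] zd Cons.prems(3) obtain ys d' zs where
      "xs = ys @ (d', 2 * c) # zs" "z - d - sum_list (map fst ys) - d' = c" by (auto simp: x)
    then show ?thesis by (intro exI[of _ "(d, m) # ys"] exI[of _ d'] exI[of _ zs]) (simp add: x)
  next
    case False
    with dm have "- c \<le> ?z \<and> z - d \<le> c"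
      using excess_mono(2)[OF c, of ?z "z - d"] all(2) by auto
    with zd have z: "z - d = c" "m \<le> 2 * c" by auto
    \<comment> \<open>A smaller jump would land strictly between -c and c. As the jumps add up to
      2c, another edge follows; its flux would start there, against equality on that edge.\<close>
    have "m = 2 * c"
    proof (rule ccontr)
      assume "m \<noteq> 2 * c"
      with z have lt: "m < 2 * c" by simp
      then obtain d' m' xs' where xs': "xs = (d', m') # xs'"
        using Cons.prems(3) by (cases xs) (auto simp: x)
      have "(?z ^ 3 - (?z - d') ^ 3) / 3 - c\<^sup>2 * d' = excess c ?z - excess c (?z - d')"
        using all(3) drop_energy_le[OF c, of xs' "?z - d' - m'"] xs xs'
          excess_edge(1)[OF c, of d' ?z] excess_mono(1)[OF c, of "?z - d' - m'" "?z - d'"]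
        by (auto simp: algebra_simps)
      then have "?z \<le> - c \<or> c \<le> ?z - d'"
        using excess_edge(2)[OF c, of d' ?z] assms(1) xs xs' by auto
      then show False using z lt xs xs' False dm by auto
    qed
    then show ?thesis using z by (intro exI[of _ "[]"] exI[of _ d] exI[of _ xs]) (simp add: x)
  qed
qed

context network
begin

fun path :: "'v \<Rightarrow> ('e \<times> 'v) list \<Rightarrow> 'v \<Rightarrow> bool" where
  "path w [] b \<longleftrightarrow> w = b"
| "path w ((e, u) # xs) b \<longleftrightarrow> {src e, tgt e} = {w, u} \<and> path u xs b"

lemma path_append: "path a (xs @ ys) b \<longleftrightarrow> (\<exists>c. path a xs c \<and> path c ys b)"
  by (induction a xs b rule: path.induct) auto

lemma path_last: "path a xs b \<Longrightarrow> xs \<noteq> [] \<Longrightarrow> snd (last xs) = b"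
proof (induction xs arbitrary: a)
  case (Cons x xs)
  then show ?case by (cases x; cases xs) auto
qed simp

lemma ends_empty [simp]: "ends {} = {}"
  by (simp add: ends_def)

lemma ends_Un [simp]: "ends (A \<union> B) = ends A \<union> ends B"
  by (auto simp: ends_def)

lemma ends_insert: "ends (insert e A) = {src e, tgt e} \<union> ends A"
  by (auto simp: ends_def)

lemma ends_path:
  "path a xs b \<Longrightarrow> insert a (ends (set (map fst xs))) = insert a (set (map snd xs))"
  "path a xs b \<Longrightarrow> xs \<noteq> [] \<Longrightarrow> ends (set (map fst xs)) = insert a (set (map snd xs))"
proof -
  have "ends (set (map fst xs)) = (if xs = [] then {} else insert a (set (map snd xs)))" if "path a xs b" for xs
    using that by (induction a xs b rule: path.induct) (auto simp: ends_insert)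
  then show "path a xs b \<Longrightarrow> insert a (ends (set (map fst xs))) = insert a (set (map snd xs))"
    "path a xs b \<Longrightarrow> xs \<noteq> [] \<Longrightarrow> ends (set (map fst xs)) = insert a (set (map snd xs))"
    by auto
qed

text \<open>
  The flux along a path that starts with value \<open>z\<close>, directed towards the start, and absorbs the
  external load \<open>\<mu>\<close> at every vertex it reaches.
\<close>

fun path_flux :: "('v \<Rightarrow> real) \<Rightarrow> real \<Rightarrow> 'v \<Rightarrow> ('e \<times> 'v) list \<Rightarrow> 'e \<Rightarrow> real" where
  "path_flux \<mu> z w [] = (\<lambda>_. 0)"
| "path_flux \<mu> z w ((e, u) # xs) =
     (path_flux \<mu> (z - l e - \<mu> u) u xs)(e := if src e = w then z - l e / 2 else l e / 2 - z)"

definition path_len :: "('e \<times> 'v) list \<Rightarrow> real" where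
  "path_len xs = (\<Sum>(e, u)\<leftarrow>xs. l e)"

definition path_load :: "('v \<Rightarrow> real) \<Rightarrow> ('e \<times> 'v) list \<Rightarrow> real" where
  "path_load \<mu> xs = (\<Sum>(e, u)\<leftarrow>xs. \<mu> u)"

lemma path_len_simps [simp]:
  "path_len [] = 0" "path_len ((e, u) # xs) = l e + path_len xs"
  "path_len (xs @ ys) = path_len xs + path_len ys"
  by (simp_all add: path_len_def)

lemma path_load_simps [simp]:
  "path_load \<mu> [] = 0" "path_load \<mu> ((e, u) # xs) = \<mu> u + path_load \<mu> xs"
  "path_load \<mu> (xs @ ys) = path_load \<mu> xs + path_load \<mu> ys"
  by (simp_all add: path_load_def)

lemma path_len_eq_sum: "distinct (map fst xs) \<Longrightarrow> path_len xs = sum l (set (map fst xs))"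
  by (induction xs) (auto simp: path_len_def)

lemma path_load_eq_sum: "distinct (map snd xs) \<Longrightarrow> path_load \<mu> xs = sum \<mu> (set (map snd xs))"
  by (induction xs) (auto simp: path_load_def)

text \<open>At a vertex inside the path the contributions of the two edges cancel up to
  -\<open>\<mu> u\<close>, to be compensated by the load that the rest of the graph delivers there.
  The end \<open>b\<close> receives the negative of the remaining flux. The case distinction in
  \<open>path_flux\<close> is due to the sign convention: midpoint values count towards the source,
  whichever way the edge is traversed.\<close>

lemma load_path_flux:
  assumes "path w xs b" "distinct (map fst xs)"
  shows "load (set (map fst xs)) (path_flux \<mu> z w xs) x = of_bool (x = w) * z
    - (\<Sum>(e, u)\<leftarrow>xs. of_bool (x = u) * \<mu> u)
    - of_bool (x = b) * (z - path_len xs - path_load \<mu> xs)"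
  using assms
proof (induction \<mu> z w xs rule: path_flux.induct)
  case (1 \<mu> z w)
  then show ?case by (simp add: load_def)
next
  case (2 \<mu> z w e u xs)
  let ?z = "z - l e - \<mu> u"
  let ?f = "path_flux \<mu> z w ((e, u) # xs)"
  have e: "e \<notin> set (map fst xs)" "{src e, tgt e} = {w, u}" using 2 by auto
  have "load (set (map fst ((e, u) # xs))) ?f x = load {e} ?f x + load (set (map fst xs)) ?f x"
    using e(1) load_Un[of "{e}" "set (map fst xs)" ?f x] by simp
  also have "load (set (map fst xs)) ?f x = load (set (map fst xs)) (path_flux \<mu> ?z u xs) x"
    using e(1) by (intro load_cong) auto
  also have "load {e} ?f x = of_bool (x = w) * z + of_bool (x = u) * (l e - z)"
    using e(2) by (auto simp: load_def doubleton_eq_iff)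
  finally show ?case
    using 2 by (auto simp: algebra_simps)
qed

lemma energy_path_flux:
  assumes "path w xs b" "distinct (map fst xs)"
  shows "energy (set (map fst xs)) (path_flux \<mu> z w xs)
    = drop_energy z (map (\<lambda>(e, u). (l e, \<mu> u)) xs)"
  using assms
proof (induction \<mu> z w xs rule: path_flux.induct)
  case (1 \<mu> z w)
  then show ?case by (simp add: energy_def)
next
  case (2 \<mu> z w e u xs)
  let ?f = "path_flux \<mu> z w ((e, u) # xs)"
  have e: "e \<notin> set (map fst xs)" using 2 by auto
  have "energy (set (map fst ((e, u) # xs))) ?f = energy {e} ?f + energy (set (map fst xs)) ?f"
    using e energy_Un[of "{e}" "set (map fst xs)" ?f] by simp
  also have "energy (set (map fst xs)) ?f = energy (set (map fst xs)) (path_flux \<mu> (z - l e - \<mu> u) u xs)"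
    using e by (intro energy_cong) auto
  also have "energy {e} ?f = (z ^ 3 - (z - l e) ^ 3) / 3"
  proof -
    have "(?f e)\<^sup>2 = (z - l e / 2)\<^sup>2" by (simp add: power2_commute)
    then have "energy {e} ?f = l e ^ 3 / 12 + l e * (z - l e / 2)\<^sup>2" by (simp add: energy_def)
    also have "\<dots> = (z ^ 3 - (z - l e) ^ 3) / 3"
      by (simp add: power2_eq_square power3_eq_cube field_simps)
    finally show ?thesis .
  qed
  finally show ?case using 2 by simp
qed

text \<open>Let c be half the external load. The flux runs from M/2 to -M/2 and
  \<open>excess\<close> is odd, so \<open>drop_energy_le\<close> gives c^2 times the length plus
  twice \<open>excess c (M / 2)\<close>, which is the integral of (s/2)^2 over [2c, M]. In the
  equality case the jump from c to -c comes after a drop of M/2 - c, which is half the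
  length.\<close>

lemma energy_ear:
  fixes \<mu> :: "'v \<Rightarrow> real"
  assumes "path a xs b" "distinct (map fst xs)" "\<forall>(e, u)\<in>set xs. 0 < l e \<and> 0 \<le> \<mu> u"
    and "M = path_len xs + path_load \<mu> xs"
  shows "energy (set (map fst xs)) (path_flux \<mu> (M / 2) a xs) \<le> (M ^ 3 - path_load \<mu> xs ^ 3) / 12" (is ?le)
    and "0 < path_load \<mu> xs
      \<Longrightarrow> energy (set (map fst xs)) (path_flux \<mu> (M / 2) a xs) = (M ^ 3 - path_load \<mu> xs ^ 3) / 12
      \<Longrightarrow> \<exists>ys e u zs. xs = ys @ (e, u) # zs \<and> \<mu> u = path_load \<mu> xs \<and> path_len (ys @ [(e, u)]) = path_len zs"
proof -
  let ?ps = "map (\<lambda>(e, u). (l e, \<mu> u)) xs"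
  define c where "c = path_load \<mu> xs / 2"
  have fst: "sum_list (map fst (map (\<lambda>(e, u). (l e, \<mu> u)) xs)) = path_len xs" for xs
    by (induction xs) auto
  have snd: "sum_list (map snd ?ps) = 2 * c"
    unfolding c_def by (induction xs) auto
  have ps: "\<forall>(d, m)\<in>set ?ps. 0 < d \<and> 0 \<le> m" using assms(3) by auto
  have c: "0 \<le> c" using ps snd by (smt (verit) case_prodE split_conv sum_list_nonneg image_iff list.set_map snd_conv)
  have len: "0 \<le> path_len xs"
    using assms(3) unfolding path_len_def by (intro sum_list_nonneg) (auto simp: less_imp_le)
  have M: "M = path_len xs + 2 * c" using assms(4) by (simp add: c_def)
  have Mc: "c \<le> M / 2" using M len by simp
  have ex: "c\<^sup>2 * path_len xs + excess c (M / 2) - excess c (- (M / 2)) = (M ^ 3 - (2 * c) ^ 3) / 12"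
  proof -
    have a: "excess c (- (M / 2)) = - excess c (M / 2)" by (rule excess_minus[OF c])
    have b: "excess c (M / 2) = (M / 2 - c)\<^sup>2 * (M / 2 + 2 * c) / 3"
      using Mc by (simp add: excess_def)
    have d: "path_len xs = M - 2 * c" using M by simp
    show ?thesis unfolding a b d
      by (simp add: power2_eq_square power3_eq_cube field_simps)
  qed
  have last: "M / 2 - path_len xs - 2 * c = - (M / 2)" using M by linarith
  have "drop_energy (M / 2) ?ps \<le> (M ^ 3 - (2 * c) ^ 3) / 12"
    using drop_energy_le[OF c ps, of "M / 2"] unfolding fst snd last ex .
  then show ?le using energy_path_flux[OF assms(1,2)] by (simp add: c_def)
  assume pos: "0 < path_load \<mu> xs"
    and eq: "energy (set (map fst xs)) (path_flux \<mu> (M / 2) a xs) = (M ^ 3 - path_load \<mu> xs ^ 3) / 12"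
  have "drop_energy (M / 2) ?ps = (M ^ 3 - (2 * c) ^ 3) / 12"
    using eq energy_path_flux[OF assms(1,2)] by (simp add: c_def)
  then have "drop_energy (M / 2) ?ps = c\<^sup>2 * sum_list (map fst ?ps) + excess c (M / 2)
      - excess c (M / 2 - sum_list (map fst ?ps) - sum_list (map snd ?ps))"
    unfolding fst snd last ex .
  moreover have "0 < c" using pos by (simp add: c_def)
  ultimately obtain ys' d zs' where
    *: "?ps = ys' @ (d, 2 * c) # zs'" "M / 2 - sum_list (map fst ys') - d = c"
    using drop_energy_eq[OF _ ps Mc snd] by blast
  from *(1) obtain ys e u zs where s: "xs = ys @ (e, u) # zs" "l e = d" "\<mu> u = 2 * c"
    "ys' = map (\<lambda>(e, u). (l e, \<mu> u)) ys"
    by (auto simp: map_eq_append_conv map_eq_Cons_conv)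
  have "path_len (ys @ [(e, u)]) = path_len zs"
    using *(2) s(2) M unfolding s(4) fst unfolding s(1) path_len_simps by (simp add: field_simps)
  moreover have "\<mu> u = path_load \<mu> xs" by (simp add: s(3) c_def)
  ultimately show "\<exists>ys e u zs. xs = ys @ (e, u) # zs \<and> \<mu> u = path_load \<mu> xs \<and> path_len (ys @ [(e, u)]) = path_len zs"
    using s(1) by blast
qed

end


section \<open>Ear decomposition and competitor fluxes\<close>

context network
begin

text \<open>A walk to \<open>D\<close> that uses an edge of \<open>C\<close> has already met
  \<open>D'\<close> at an end of that edge and can be stopped there.\<close>

lemma reach_contract:
  assumes "reach E D w" "D \<subseteq> D'" "ends C \<subseteq> D'"
  shows "reach (E - C) D' w"
  using assms
proof (induction rule: reach.induct)
  case (step e w u)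
  show ?case
  proof (cases "w \<in> D'")
    case False
    with step have "e \<notin> C" by (auto simp: ends_def doubleton_eq_iff)
    with step show ?thesis by (auto intro: reach.step)
  qed (rule reach.base)
qed (auto intro: reach.base)

lemma reach_imp_edge:
  "reach E D w \<Longrightarrow> w \<in> ends E \<Longrightarrow> \<exists>e\<in>E. \<exists>a\<in>D. \<exists>u. {src e, tgt e} = {a, u}"
proof (induction rule: reach.induct)
  case (base w)
  then show ?case by (auto simp: ends_def)
next
  case (step e w u)
  show ?case
  proof (cases "u \<in> D")
    case True
    with step show ?thesis by (metis insert_commute)
  next
    case False
    with step show ?thesis by (auto simp: ends_def doubleton_eq_iff)
  qed
qed

text \<open>Loop erasure: if the walk is extended backwards to a vertex that it already visits, the
  part before that visit is dropped; at a vertex of \<open>D\<close> it starts anew. The last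
  condition says that only the final vertex lies in \<open>D\<close>.\<close>

lemma reach_simple_path:
  assumes "reach E D u"
  obtains xs b where "path u xs b" "b \<in> D" "set (map fst xs) \<subseteq> E" "distinct (map fst xs)"
    "distinct (u # map snd xs)" "set (butlast (u # map snd xs)) \<inter> D = {}"
proof -
  have "\<exists>xs b. path u xs b \<and> b \<in> D \<and> set (map fst xs) \<subseteq> E \<and> distinct (map fst xs) \<and>
    distinct (u # map snd xs) \<and> set (butlast (u # map snd xs)) \<inter> D = {}"
    using assms
  proof (induction rule: reach.induct)
    case (base w)
    then show ?case by (intro exI[of _ "[]"]) auto
  next
    case (step e w u)
    then obtain xs b where xs: "path u xs b" "b \<in> D" "set (map fst xs) \<subseteq> E" "distinct (map fst xs)"
      "distinct (u # map snd xs)" "set (butlast (u # map snd xs)) \<inter> D = {}" by blast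
    consider "w \<in> D" | "w = u" | "w \<in> set (map snd xs)" "w \<noteq> u" | "w \<notin> D" "w \<notin> set (u # map snd xs)" by auto
    then show ?case
    proof cases
      case 1
      then show ?thesis by (intro exI[of _ "[]"]) auto
    next
      case 2
      with xs show ?thesis by blast
    next
      case 3
      then obtain e' where "(e', w) \<in> set xs" by auto
      then obtain ys zs where s: "xs = (ys @ [(e', w)]) @ zs" by (metis append.assoc append_Cons append_Nil split_list)
      with xs(1) obtain c where c: "path u (ys @ [(e', w)]) c" "path c zs b"
        using path_append[of u "ys @ [(e', w)]" zs b] by blast
      from path_last[OF c(1)] have "path w zs b" using c(2) by simp
      moreover have "set (butlast (w # map snd zs)) \<subseteq> set (butlast (u # map snd xs))"
        by (auto simp: s butlast_append)
      ultimately show ?thesis using xs by (intro exI[of _ zs] exI[of _ b]) (auto simp: s)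
    next
      case 4
      have "e \<notin> set (map fst xs)"
      proof
        assume "e \<in> set (map fst xs)"
        then have "w \<in> ends (set (map fst xs))" using step(2) by (auto simp: ends_def doubleton_eq_iff)
        with ends_path(1)[OF xs(1)] 4 show False by auto
      qed
      with 4 xs step show ?thesis by (intro exI[of _ "(e, u) # xs"] exI[of _ b]) auto
    qed
  qed
  with that show ?thesis by blast
qed

text \<open>Edge connectivity at least two after gluing \<open>D\<close>: no single edge separates a
  vertex from \<open>D\<close>.\<close>

definition two_reach :: "'e set \<Rightarrow> 'v set \<Rightarrow> bool" where
  "two_reach E D \<longleftrightarrow> (\<forall>w\<in>ends E. \<forall>e\<in>E. reach (E - {e}) D w)"

text \<open>Take an edge e from \<open>D\<close> to some u. Since u still reaches \<open>D\<close>
  without e, a simple path closes the ear. Its ends may coincide, and if u lies in \<open>D\<close>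
  the ear is the single edge e.\<close>

lemma ear_exists:
  assumes "two_reach E D" "E \<noteq> {}"
  obtains a xs b where "path a xs b" "a \<in> D" "b \<in> D" "xs \<noteq> []" "set (map fst xs) \<subseteq> E"
    "distinct (map fst xs)" "distinct (map snd xs)" "set (butlast (map snd xs)) \<inter> D = {}"
proof -
  from assms obtain e0 where e0: "e0 \<in> E" by blast
  then have "reach E D (src e0)" "src e0 \<in> ends E"
    using assms by (auto simp: two_reach_def ends_def intro: reach_mono)
  then obtain e a u where e: "e \<in> E" "a \<in> D" "{src e, tgt e} = {a, u}" using reach_imp_edge by blast
  then have "u \<in> ends E" by (auto simp: ends_def doubleton_eq_iff)
  with e(1) assms(1) have "reach (E - {e}) D u" by (auto simp: two_reach_def)
  then obtain xs b where "path u xs b" "b \<in> D" "set (map fst xs) \<subseteq> E - {e}" "distinct (map fst xs)"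
    "distinct (u # map snd xs)" "set (butlast (u # map snd xs)) \<inter> D = {}"
    by (rule reach_simple_path)
  with e show ?thesis by (intro that[of a "(e, u) # xs" b]) auto
qed

text \<open>
  Caterpillars rooted at a vertex, with arbitrarily subdivided edges; the last ring is a cycle
  through its root, as its far vertex need not be a vertex of the graph.
\<close>

inductive ring_chain :: "'e set \<Rightarrow> 'v \<Rightarrow> bool" where
  loop: "ring_chain (set (map fst xs)) d"
    if "path d xs d" "xs \<noteq> []" "distinct (map fst xs)" "distinct (map snd xs)"
| ring: "ring_chain (set (map fst (xs @ ys)) \<union> E) d"
    if "path d xs b" "path b ys d" "xs \<noteq> []" "ys \<noteq> []" "path_len xs = path_len ys"
      "distinct (map fst (xs @ ys))" "distinct (map snd (xs @ ys))"
      "E \<inter> set (map fst (xs @ ys)) = {}" "ends E \<inter> set (map snd (xs @ ys)) \<subseteq> {b}" "ring_chain E b"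

text \<open>The strict part serves the equality case. The inductions maintain it, as the removed
  edge or ear delivers a positive amount to each of its ends in \<open>D\<close>.\<close>

definition pos_flow :: "'e set \<Rightarrow> 'v set \<Rightarrow> ('e \<Rightarrow> real) \<Rightarrow> bool" where
  "pos_flow E D \<phi> \<longleftrightarrow> flow E D \<phi> \<and> (\<forall>w\<in>D. 0 \<le> load E \<phi> w) \<and> (\<forall>w\<in>D \<inter> ends E. 0 < load E \<phi> w)"

lemma pos_flow_nonneg: "pos_flow E D \<phi> \<Longrightarrow> 0 \<le> load E \<phi> w"
  by (cases "w \<in> D") (auto simp: pos_flow_def flow_def)

lemma pos_flow_sum_le:
  assumes "finite E" "pos_flow E D \<phi>" "finite A"
  shows "sum (load E \<phi>) A \<le> sum l E"
proof -
  have "sum (load E \<phi>) A \<le> sum (load E \<phi>) (A \<union> ends E)"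
    using assms by (intro sum_mono2) (auto simp: finite_ends pos_flow_nonneg)
  also have "\<dots> = sum l E" using assms by (intro sum_load) (auto simp: finite_ends)
  finally show ?thesis .
qed

text \<open>The loads are nonnegative and add up to the total length. If \<open>u\<close> takes
  everything, another vertex of \<open>D\<close> at an edge would receive nothing, against strict
  positivity.\<close>

lemma pos_flow_concentrated:
  assumes "finite E" "pos_flow E D \<phi>" "load E \<phi> u = sum l E"
  shows "D \<inter> ends E \<subseteq> {u}"
proof
  fix w assume w: "w \<in> D \<inter> ends E"
  show "w \<in> {u}"
  proof (rule ccontr)
    assume "w \<notin> {u}"
    with pos_flow_sum_le[OF assms(1,2), of "{w, u}"] assms(3) have "load E \<phi> w \<le> 0" by simp
    with w assms(2) show False by (auto simp: pos_flow_def not_less[symmetric])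
  qed
qed

lemma load_attach:
  assumes "finite E'" "path a xs b" "distinct (map fst xs)" "distinct (map snd xs)"
    and "E' \<inter> set (map fst xs) = {}"
    and "\<phi> = (\<lambda>e. if e \<in> E' then \<phi>' e else path_flux \<mu> z a xs e)"
  shows "load (set (map fst xs) \<union> E') \<phi> w = of_bool (w = a) * z
      - (if w \<in> set (map snd xs) then \<mu> w else 0)
      - of_bool (w = b) * (z - path_len xs - path_load \<mu> xs) + load E' \<phi>' w"
    and "energy (set (map fst xs) \<union> E') \<phi> = energy (set (map fst xs)) (path_flux \<mu> z a xs) + energy E' \<phi>'"
proof -
  have d: "set (map fst xs) \<inter> E' = {}" using assms(5) by auto
  have "(\<Sum>(e, u)\<leftarrow>xs. of_bool (w = u) * \<mu> u) = (if w \<in> set (map snd xs) then \<mu> w else 0)"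
    using assms(4) by (induction xs) (auto, (metis imageI snd_conv)+)
  moreover have "load (set (map fst xs) \<union> E') \<phi> w = load (set (map fst xs)) \<phi> w + load E' \<phi> w"
    by (rule load_Un[OF _ assms(1) d]) simp
  moreover have "load (set (map fst xs)) \<phi> w = load (set (map fst xs)) (path_flux \<mu> z a xs) w"
    using d by (intro load_cong) (auto simp: assms(6))
  moreover have "load E' \<phi> w = load E' \<phi>' w" by (intro load_cong) (auto simp: assms(6))
  ultimately show "load (set (map fst xs) \<union> E') \<phi> w = of_bool (w = a) * z
      - (if w \<in> set (map snd xs) then \<mu> w else 0)
      - of_bool (w = b) * (z - path_len xs - path_load \<mu> xs) + load E' \<phi>' w"
    using load_path_flux[OF assms(2,3), of \<mu> z w] by simp
  have "energy (set (map fst xs) \<union> E') \<phi> = energy (set (map fst xs)) \<phi> + energy E' \<phi>"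
    by (rule energy_Un[OF _ assms(1) d]) simp
  moreover have "energy (set (map fst xs)) \<phi> = energy (set (map fst xs)) (path_flux \<mu> z a xs)"
    using d by (intro energy_cong) (auto simp: assms(6))
  moreover have "energy E' \<phi> = energy E' \<phi>'" by (intro energy_cong) (auto simp: assms(6))
  ultimately show "energy (set (map fst xs) \<union> E') \<phi> = energy (set (map fst xs)) (path_flux \<mu> z a xs) + energy E' \<phi>'"
    by simp
qed

text \<open>Both sides are three times the integral of s^2 over a window of length p, which grows
  strictly as the window moves right. With it the load delivered by the rest is replaced by the
  whole length of the rest.\<close>

lemma cube_diff_le:
  fixes p x y :: real
  assumes "0 < p" "0 \<le> x" "x \<le> y"
  shows "(p + x) ^ 3 - x ^ 3 \<le> (p + y) ^ 3 - y ^ 3"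
    and "(p + x) ^ 3 - x ^ 3 = (p + y) ^ 3 - y ^ 3 \<Longrightarrow> x = y"
proof -
  have "(p + y) ^ 3 - y ^ 3 - ((p + x) ^ 3 - x ^ 3) = 3 * p * (y - x) * (p + x + y)"
    by (simp add: power3_eq_cube algebra_simps)
  moreover have "0 \<le> 3 * p * (y - x) * (p + x + y)" "0 < y - x \<Longrightarrow> 0 < 3 * p * (y - x) * (p + x + y)"
    using assms by auto
  ultimately show "(p + x) ^ 3 - x ^ 3 \<le> (p + y) ^ 3 - y ^ 3"
    "(p + x) ^ 3 - x ^ 3 = (p + y) ^ 3 - y ^ 3 \<Longrightarrow> x = y" using assms(3) by argo+
qed

text \<open>
  The ear is removed and its inner vertices become Dirichlet vertices of the rest; what the flux of
  the rest delivers there is carried to the two ends of the ear in equal parts.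
\<close>

lemma two_reach_flow:
  assumes "finite E" "\<forall>e\<in>E. 0 < l e" "two_reach E D"
  shows "\<exists>\<phi>. pos_flow E D \<phi> \<and> energy E \<phi> \<le> sum l E ^ 3 / 12 \<and>
    (energy E \<phi> = sum l E ^ 3 / 12 \<longrightarrow> E \<noteq> {} \<longrightarrow> (\<forall>d. D \<inter> ends E \<subseteq> {d} \<longrightarrow> ring_chain E d))"
  using assms
proof (induction E arbitrary: D rule: finite_psubset_induct)
  case (psubset E)
  show ?case
  proof (cases "E = {}")
    case True
    then show ?thesis by (auto simp: pos_flow_def flow_def load_def energy_def)
  next
    case False
    with psubset.prems(2) obtain a xs b where xs: "path a xs b" "a \<in> D" "b \<in> D" "xs \<noteq> []" "set (map fst xs) \<subseteq> E"
      "distinct (map fst xs)" "distinct (map snd xs)" "set (butlast (map snd xs)) \<inter> D = {}"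
      by (rule ear_exists)
    let ?C = "set (map fst xs)" and ?S = "set (map snd xs)"
    define E' where "E' = E - ?C"
    define D' where "D' = D \<union> ?S"
    have "?C \<inter> E \<noteq> {}" using xs(4,5) by (cases xs) auto
    then have "E' \<subset> E" unfolding E'_def by blast
    then have E: "E = ?C \<union> E'" "E' \<inter> ?C = {}" "E' \<subset> E" "finite E'"
      using xs(5) psubset.hyps unfolding E'_def by auto
    have endsC: "ends ?C = insert a ?S" by (rule ends_path(2)[OF xs(1,4)])
    have endsE: "ends E = insert a ?S \<union> ends E'" unfolding endsC[symmetric] ends_Un[symmetric] E(1)[symmetric] ..
    have b: "b \<in> ?S" using path_last[OF xs(1,4)] xs(4) by auto
    have "two_reach E' D'"
      unfolding two_reach_def
    proof (intro ballI)
      fix w e assume "w \<in> ends E'" "e \<in> E'"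
      then have "reach (E - {e}) D w" using psubset.prems(2) E by (auto simp: two_reach_def ends_def)
      then have "reach (E - {e} - ?C) D' w"
        using endsC xs(2) by (intro reach_contract[of "E - {e}" D w D' ?C]) (auto simp: D'_def)
      then show "reach (E' - {e}) D' w" by (rule reach_mono) (auto simp: E'_def)
    qed
    with psubset.IH[OF E(3), of D'] psubset.prems(1) E(1) obtain \<phi>' where
      \<phi>': "pos_flow E' D' \<phi>'" "energy E' \<phi>' \<le> sum l E' ^ 3 / 12"
      "energy E' \<phi>' = sum l E' ^ 3 / 12 \<Longrightarrow> E' \<noteq> {} \<Longrightarrow> D' \<inter> ends E' \<subseteq> {d} \<Longrightarrow> ring_chain E' d" for d
      by blast
    \<comment> \<open>What the rest delivers to a vertex of \<open>D\<close> stays there; in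
      particular the ear takes over nothing at its end \<open>b\<close>.\<close>
    define \<mu> where "\<mu> u = (if u \<in> D then 0 else load E' \<phi>' u)" for u
    define M where "M = path_len xs + path_load \<mu> xs"
    define \<phi> where "\<phi> = (\<lambda>e. if e \<in> E' then \<phi>' e else path_flux \<mu> (M / 2) a xs e)"
    have \<mu>: "0 \<le> \<mu> u" "\<mu> u \<le> load E' \<phi>' u" for u
      using pos_flow_nonneg[OF \<phi>'(1), of u] by (auto simp: \<mu>_def)
    have lpos: "\<forall>(e, u)\<in>set xs. 0 < l e \<and> 0 \<le> \<mu> u" using psubset.prems(1) xs(5) \<mu>(1) by fastforce
    have plen: "path_len xs = sum l ?C" by (rule path_len_eq_sum[OF xs(6)])
    have pload: "path_load \<mu> xs = sum \<mu> ?S" by (rule path_load_eq_sum[OF xs(7)])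
    have load0: "0 \<le> path_load \<mu> xs" unfolding pload by (intro sum_nonneg) (rule \<mu>)
    have loadL: "path_load \<mu> xs \<le> sum l E'"
      unfolding pload using pos_flow_sum_le[OF E(4) \<phi>'(1), of ?S] \<mu>(2)
      by (meson List.finite_set order_trans sum_mono)
    have len0: "0 < path_len xs"
      unfolding plen using xs(4,5) psubset.prems(1) by (intro sum_pos) auto
    have L: "sum l E = path_len xs + sum l E'"
      unfolding plen using sum.union_disjoint[of ?C E' l] E by (metis List.finite_set inf_commute)
    have "load E \<phi> w = of_bool (w = a) * (M / 2) - (if w \<in> ?S then \<mu> w else 0)
      - of_bool (w = b) * (M / 2 - path_len xs - path_load \<mu> xs) + load E' \<phi>' w" for w
      unfolding E(1) by (rule load_attach[OF E(4) xs(1,6,7) E(2) \<phi>_def])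
    \<comment> \<open>Having started with half of the total load, the flux ends with -M/2, so both
      ends receive M/2.\<close>
    moreover have "M / 2 - path_len xs - path_load \<mu> xs = - (M / 2)" using M_def by (simp add: field_simps)
    ultimately have load: "load E \<phi> w = of_bool (w = a) * (M / 2) + of_bool (w = b) * (M / 2)
      + (load E' \<phi>' w - (if w \<in> ?S then \<mu> w else 0))" for w by simp
    have M0: "0 < M / 2" using len0 load0 by (simp add: M_def)
    have energy: "energy E \<phi> = energy ?C (path_flux \<mu> (M / 2) a xs) + energy E' \<phi>'"
      unfolding E(1) by (rule load_attach(2)[OF E(4) xs(1,6,7) E(2) \<phi>_def])
    have "pos_flow E D \<phi>"
      unfolding pos_flow_def flow_def
    proof (intro conjI allI ballI impI)
      fix w assume "w \<notin> D"
      with xs(2,3) \<phi>'(1) show "load E \<phi> w = 0"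
        by (auto simp: load \<mu>_def pos_flow_def flow_def D'_def)
    next
      fix w assume "w \<in> D"
      with \<mu>(2) pos_flow_nonneg[OF \<phi>'(1)] M0 show "0 \<le> load E \<phi> w"
        by (auto simp: load \<mu>_def)
    next
      fix w assume w: "w \<in> D \<inter> ends E"
      have "w = a \<or> w = b \<or> w \<in> ends E'"
      proof -
        have "?S \<subseteq> insert b (set (butlast (map snd xs)))"
          using xs(4) path_last[OF xs(1,4)] by (metis append_butlast_last_id last_map list.map_disc_iff
              list.set(2) rotate1.simps(2) set_rotate1 subset_refl)
        with w xs(8) endsE show ?thesis by auto
      qed
      then have "w = a \<or> w = b \<or> 0 < load E' \<phi>' w" using w \<phi>'(1) by (auto simp: pos_flow_def D'_def)
      moreover have "load E \<phi> w = of_bool (w = a) * (M / 2) + of_bool (w = b) * (M / 2) + load E' \<phi>' w"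
        using w by (simp add: load \<mu>_def)
      ultimately show "0 < load E \<phi> w"
        using pos_flow_nonneg[OF \<phi>'(1), of w] M0 by (cases "w = a"; cases "w = b") simp_all
    qed
    moreover have ear: "energy ?C (path_flux \<mu> (M / 2) a xs) \<le> (M ^ 3 - path_load \<mu> xs ^ 3) / 12"
      by (rule energy_ear(1)[OF xs(1,6) lpos M_def])
    moreover note cube = cube_diff_le[OF len0 load0 loadL, folded M_def L]
    have le: "energy E \<phi> \<le> sum l E ^ 3 / 12" using ear cube(1) \<phi>'(2) unfolding energy diff_divide_distrib by linarith
    moreover have "ring_chain E d" if eq: "energy E \<phi> = sum l E ^ 3 / 12" and d: "D \<inter> ends E \<subseteq> {d}" for d
    proof -
      have ab: "a = d" "b = d" using d xs(2,3) b endsE by auto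
      show ?thesis
      proof (cases "E' = {}")
        case True
        then show ?thesis using ring_chain.loop[of d xs] xs ab E(1) by simp
      next
        case False
        \<comment> \<open>The estimates for the ear, for the position of the window and for the rest
          add up to the bound, so each is an equality. For the window this means that the ear takes
          over the full length of the rest.\<close>
        have eqs: "energy ?C (path_flux \<mu> (M / 2) a xs) = (M ^ 3 - path_load \<mu> xs ^ 3) / 12"
          "energy E' \<phi>' = sum l E' ^ 3 / 12" "M ^ 3 - path_load \<mu> xs ^ 3 = sum l E ^ 3 - sum l E' ^ 3"
          using ear cube(1) \<phi>'(2) eq unfolding energy diff_divide_distrib by linarith+
        have full: "path_load \<mu> xs = sum l E'" using cube(2) eqs(3) by blast
        have pos: "0 < sum l E'"
          using E(1,4) False psubset.prems(1) by (intro sum_pos) auto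
        then obtain ys e u zs where s: "xs = ys @ (e, u) # zs" "\<mu> u = sum l E'" "path_len (ys @ [(e, u)]) = path_len zs"
          using energy_ear(2)[OF xs(1,6) lpos M_def _ eqs(1)] unfolding full by metis
        have s1: "xs = (ys @ [(e, u)]) @ zs" using s(1) by simp
        from s(2) pos have u: "u \<notin> D" "load E' \<phi>' u = sum l E'" by (auto simp: \<mu>_def split: if_splits)
        \<comment> \<open>The ear ends in \<open>D\<close> and \<open>u\<close> lies outside, so
          \<open>u\<close> is not its last vertex.\<close>
        have "zs \<noteq> []" using path_last[OF xs(1,4)] xs(3) u(1) by (auto simp: s(1))
        moreover have "path a (ys @ [(e, u)]) u" "path u zs b"
          using xs(1) path_last unfolding s1 path_append[of a "ys @ [(e, u)]"] by fastforce+
        \<comment> \<open>Besides feeding the induction hypothesis, this says that the rest meets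
          the ear in \<open>u\<close> at most, which is the side condition of
          \<open>ring_chain.ring\<close>.\<close>
        moreover have conc: "D' \<inter> ends E' \<subseteq> {u}" by (rule pos_flow_concentrated[OF E(4) \<phi>'(1) u(2)])
        then have "ring_chain E' u" using \<phi>'(3) eqs(2) False by blast
        ultimately have "ring_chain (set (map fst ((ys @ [(e, u)]) @ zs)) \<union> E') d"
          using xs(6,7) s(3) E(2) conc unfolding ab s1 D'_def by (intro ring_chain.ring) auto
        then show ?thesis using E(1) unfolding s1 by simp
      qed
    qed
    ultimately show ?thesis by blast
  qed
qed

text \<open>A single edge e from a in \<open>D\<close> to u plays the role of the ear: u becomes a
  Dirichlet vertex of the rest, and what arrives there is led through e to a. In the equality case
  the whole rest hangs on u, so the edges line up in a simple path from d.\<close>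

lemma reach_flow:
  assumes "finite E" "\<forall>e\<in>E. 0 < l e" "\<forall>w\<in>ends E. reach E D w"
  shows "\<exists>\<phi>. pos_flow E D \<phi> \<and> energy E \<phi> \<le> sum l E ^ 3 / 3 \<and>
    (energy E \<phi> = sum l E ^ 3 / 3 \<longrightarrow> E \<noteq> {} \<longrightarrow> (\<forall>d. D \<inter> ends E \<subseteq> {d} \<longrightarrow>
      (\<exists>xs b. path d xs b \<and> E = set (map fst xs) \<and> distinct (map fst xs) \<and> distinct (d # map snd xs))))"
  using assms
proof (induction E arbitrary: D rule: finite_psubset_induct)
  case (psubset E)
  show ?case
  proof (cases "E = {}")
    case True
    then show ?thesis by (auto simp: pos_flow_def flow_def load_def energy_def)
  next
    case False
    then obtain e0 where "e0 \<in> E" by blast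
    then have "src e0 \<in> ends E" by (simp add: ends_def)
    with psubset.prems(2) reach_imp_edge obtain e a u where
      e: "e \<in> E" "a \<in> D" "{src e, tgt e} = {a, u}" by metis
    define E' where "E' = E - {e}"
    define D' where "D' = insert u D"
    let ?xs = "[(e, u)]"
    have E: "E = set (map fst ?xs) \<union> E'" "E' \<inter> set (map fst ?xs) = {}" "E' \<subset> E" "finite E'"
      using e psubset.hyps by (auto simp: E'_def)
    have endse: "ends {e} = {a, u}" using e(3) by (auto simp: ends_def)
    have "ends E = ends {e} \<union> ends E'" unfolding ends_Un[symmetric] using e(1) by (auto simp: E'_def insert_absorb)
    then have endsE: "ends E = {a, u} \<union> ends E'" unfolding endse .
    have xs: "path a ?xs u" "distinct (map fst ?xs)" "distinct (map snd ?xs)" using e by auto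
    have "\<forall>w\<in>ends E'. reach E' D' w"
    proof
      fix w assume "w \<in> ends E'"
      then have "reach E D w" using psubset.prems(2) E(1) by (auto simp: ends_def)
      then show "reach E' D' w"
        unfolding E'_def using e(2) endse by (intro reach_contract) (auto simp: D'_def)
    qed
    with psubset.IH[OF E(3), of D'] psubset.prems(1) E(1) obtain \<phi>' where
      \<phi>': "pos_flow E' D' \<phi>'" "energy E' \<phi>' \<le> sum l E' ^ 3 / 3"
      "energy E' \<phi>' = sum l E' ^ 3 / 3 \<Longrightarrow> E' \<noteq> {} \<Longrightarrow> D' \<inter> ends E' \<subseteq> {d} \<Longrightarrow>
        \<exists>xs b. path d xs b \<and> E' = set (map fst xs) \<and> distinct (map fst xs) \<and> distinct (d # map snd xs)" for d
      by blast
    define \<mu> where "\<mu> u = (if u \<in> D then 0 else load E' \<phi>' u)" for u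
    \<comment> \<open>If u is outside \<open>D\<close>, nothing may be left over there: with this z
      the flux remaining behind u is 0. If u is in \<open>D\<close>, the edge drains symmetrically
      to both ends.\<close>
    define z where "z = (if u \<in> D then l e / 2 else l e + \<mu> u)"
    define \<phi> where "\<phi> = (\<lambda>e. if e \<in> E' then \<phi>' e else path_flux \<mu> z a ?xs e)"
    have \<mu>: "0 \<le> \<mu> u" "\<mu> u \<le> load E' \<phi>' u"
      using pos_flow_nonneg[OF \<phi>'(1), of u] by (auto simp: \<mu>_def)
    have le0: "0 < l e" using psubset.prems(1) e(1) by blast
    have \<mu>L: "\<mu> u \<le> sum l E'"
      using pos_flow_sum_le[OF E(4) \<phi>'(1), of "{u}"] \<mu>(2) by simp
    have L: "sum l E = l e + sum l E'"
      using psubset.hyps e(1) by (simp add: E'_def sum.remove)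
    have load: "load E \<phi> w = of_bool (w = a) * z - (if w = u then \<mu> w else 0)
      - of_bool (w = u) * (z - l e - \<mu> u) + load E' \<phi>' w" for w
      unfolding E(1) using load_attach(1)[OF E(4) xs E(2) \<phi>_def] by simp
    have z0: "0 < z" using le0 \<mu> by (auto simp: z_def)
    have energy: "energy E \<phi> = (z ^ 3 - (z - l e) ^ 3) / 3 + energy E' \<phi>'"
      unfolding E(1) load_attach(2)[OF E(4) xs E(2) \<phi>_def] energy_path_flux[OF xs(1,2)] by simp
    have "pos_flow E D \<phi>"
      unfolding pos_flow_def flow_def
    proof (intro conjI allI ballI impI)
      fix w assume "w \<notin> D"
      with e(2) \<phi>'(1) show "load E \<phi> w = 0"
        by (auto simp: load \<mu>_def z_def pos_flow_def flow_def D'_def)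
    next
      fix w assume "w \<in> D"
      with pos_flow_nonneg[OF \<phi>'(1)] z0 le0 show "0 \<le> load E \<phi> w"
        by (auto simp: load \<mu>_def z_def)
    next
      fix w assume w: "w \<in> D \<inter> ends E"
      then have "w = a \<or> w = u \<or> w \<in> ends E'" using endsE by auto
      then have "w = a \<or> w = u \<or> 0 < load E' \<phi>' w" using w \<phi>'(1) by (auto simp: pos_flow_def D'_def)
      moreover have "load E \<phi> w = of_bool (w = a) * z + of_bool (w = u) * (l e / 2) + load E' \<phi>' w"
        using w by (auto simp: load \<mu>_def z_def)
      ultimately show "0 < load E \<phi> w"
        using pos_flow_nonneg[OF \<phi>'(1), of w] z0 le0 by (cases "w = a"; cases "w = u") simp_all
    qed
    moreover note cube = cube_diff_le[OF le0 \<mu>(1) \<mu>L, folded L]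
    have L'0: "0 \<le> sum l E'"
      using E(1) psubset.prems(1) by (intro sum_nonneg) (auto simp: less_imp_le)
    \<comment> \<open>An edge with both ends in \<open>D\<close> costs only a quarter of what the
      bound grants it even with an empty rest, so it is excluded in the equality case. This covers a
      loop at \<open>a\<close>.\<close>
    have in_D: "(z ^ 3 - (z - l e) ^ 3) / 3 < (sum l E ^ 3 - sum l E' ^ 3) / 3" if "u \<in> D"
    proof -
      have "z ^ 3 - (z - l e) ^ 3 = l e ^ 3 / 4" using that by (simp add: z_def power3_eq_cube field_simps)
      also have "\<dots> < l e ^ 3" using le0 by simp
      also have "\<dots> \<le> sum l E ^ 3 - sum l E' ^ 3"
        using cube_diff_le(1)[OF le0 order_refl L'0] L by simp
      finally show ?thesis by (rule divide_strict_right_mono) simp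
    qed
    have not_D: "z ^ 3 - (z - l e) ^ 3 = (l e + \<mu> u) ^ 3 - \<mu> u ^ 3" if "u \<notin> D"
      using that by (simp add: z_def)
    have edge: "(z ^ 3 - (z - l e) ^ 3) / 3 \<le> (sum l E ^ 3 - sum l E' ^ 3) / 3"
    proof (cases "u \<in> D")
      case True
      then show ?thesis using in_D by (simp only: less_imp_le)
    next
      case False
      show ?thesis unfolding not_D[OF False] by (rule divide_right_mono[OF cube(1)]) simp
    qed
    have le: "energy E \<phi> \<le> sum l E ^ 3 / 3" using edge \<phi>'(2) unfolding energy by (simp add: diff_divide_distrib)
    moreover have "\<exists>xs b. path d xs b \<and> E = set (map fst xs) \<and> distinct (map fst xs) \<and> distinct (d # map snd xs)"
      if eq: "energy E \<phi> = sum l E ^ 3 / 3" and d: "D \<inter> ends E \<subseteq> {d}" for d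
    proof -
      have ad: "a = d" using d e(2) endsE by auto
      have eqs: "(z ^ 3 - (z - l e) ^ 3) / 3 = (sum l E ^ 3 - sum l E' ^ 3) / 3" "energy E' \<phi>' = sum l E' ^ 3 / 3"
        using edge \<phi>'(2) eq unfolding energy diff_divide_distrib by linarith+
      then have u: "u \<notin> D" using in_D by auto
      show ?thesis
      proof (cases "E' = {}")
        case True
        then show ?thesis using E(1) xs ad u e(2) by (intro exI[of _ ?xs] exI[of _ u]) auto
      next
        case False
        have "\<mu> u = sum l E'" using cube(2) not_D[OF u] eqs(1) by simp
        then have conc: "D' \<inter> ends E' \<subseteq> {u}"
          using u by (intro pos_flow_concentrated[OF E(4) \<phi>'(1)]) (simp add: \<mu>_def)
        with \<phi>'(3) eqs(2) False obtain xs b where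
          x: "path u xs b" "E' = set (map fst xs)" "distinct (map fst xs)" "distinct (u # map snd xs)" by metis
        have "xs \<noteq> []" using False x(2) by auto
        \<comment> \<open>\<open>D'\<close> contains d and meets the rest in u at most, so the path
          through the rest never returns to d.\<close>
        then have "d \<notin> set (map snd xs)"
          using ends_path(2)[OF x(1)] conc ad e(2) u x(2) by (auto simp: D'_def)
        moreover have "e \<notin> set (map fst xs)" using x(2) by (auto simp: E'_def)
        ultimately show ?thesis
          using x E(1) e(2,3) ad u by (intro exI[of _ "(e, u) # xs"] exI[of _ b]) auto
      qed
    qed
    ultimately show ?thesis by blast
  qed
qed

end


section \<open>Reduction of the torsion problem to the vertex values\<close>

lemma lint_quadratic:
  fixes a b c x :: real
  assumes "0 \<le> x"
  shows "integrable (lebesgue_on {0..x}) (\<lambda>t. a + b * t + c * t\<^sup>2)"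
    and "(LINT t|lebesgue_on {0..x}. a + b * t + c * t\<^sup>2) = a * x + b * x\<^sup>2 / 2 + c * x ^ 3 / 3"
proof -
  let ?f = "\<lambda>t. a + b * t + c * t\<^sup>2"
  show i: "integrable (lebesgue_on {0..x}) ?f"
    by (intro continuous_imp_integrable_real continuous_intros)
  have "(?f has_integral (a * x + b * x\<^sup>2 / 2 + c * x ^ 3 / 3) - (a * 0 + b * 0\<^sup>2 / 2 + c * 0 ^ 3 / 3)) {0..x}"
    using assms
    by (intro fundamental_theorem_of_calculus[of 0 x "\<lambda>t. a * t + b * t\<^sup>2 / 2 + c * t ^ 3 / 3"])
      (auto simp: has_real_derivative_iff_has_vector_derivative[symmetric] power2_eq_square intro!: derivative_eq_intros)
  then show "(LINT t|lebesgue_on {0..x}. ?f t) = a * x + b * x\<^sup>2 / 2 + c * x ^ 3 / 3"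
    using lebesgue_integral_eq_integral[OF i] by (simp add: integral_unique)
qed

lemma lint_cong:
  assumes "\<And>t. t \<in> {0..x} \<Longrightarrow> f t = (g t :: real)"
  shows "(LINT t|lebesgue_on {0..x}. f t) = (LINT t|lebesgue_on {0..x}. g t)"
  using assms by (intro Bochner_Integration.integral_cong) auto

text \<open>The solution of -u'' = 1 on [0, L] with end values p and q.\<close>

definition edge_torsion :: "real \<Rightarrow> real \<Rightarrow> real \<Rightarrow> real \<Rightarrow> real" where
  "edge_torsion L p q x = p + ((q - p) / L + L / 2) * x - x\<^sup>2 / 2"

lemma edge_torsion_ends: "0 < L \<Longrightarrow> edge_torsion L p q 0 = p" "0 < L \<Longrightarrow> edge_torsion L p q L = q"
  by (simp_all add: edge_torsion_def field_simps power2_eq_square)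

lemma edge_torsion_integral:
  assumes "0 < L"
  shows "(LINT x|lebesgue_on {0..L}. edge_torsion L p q x) = L ^ 3 / 12 + L * (p + q) / 2"
proof -
  have "(LINT x|lebesgue_on {0..L}. edge_torsion L p q x)
    = (LINT x|lebesgue_on {0..L}. p + ((q - p) / L + L / 2) * x + (- 1 / 2) * x\<^sup>2)"
    by (simp add: edge_torsion_def)
  also have "\<dots> = p * L + ((q - p) / L + L / 2) * L\<^sup>2 / 2 + (- 1 / 2) * L ^ 3 / 3"
    using assms by (intro lint_quadratic) simp
  also have "\<dots> = L ^ 3 / 12 + L * (p + q) / 2"
    using assms by (simp add: field_simps power2_eq_square power3_eq_cube)
  finally show ?thesis .
qed

text \<open>Since u and u' are primitives, h = -1 almost everywhere determines them at every point
  of [0, L] up to the initial slope, which the value at L fixes.\<close>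

lemma H2_torsionD:
  assumes "0 < L" "H2_deriv2 L u h" "AE x in lebesgue_on {0..L}. - h x = 1"
    and x: "x \<in> {0..L}"
  shows "u x = edge_torsion L (u 0) (u L) x"
proof -
  from assms(2) obtain u' where u: "H1_deriv L u u'" "H1_deriv L u' h" by (auto simp: H2_deriv2_def)
  have u': "u' y = u' 0 - y" if y: "y \<in> {0..L}" for y
  proof -
    have "AE t in lebesgue. t \<in> {0..L} \<longrightarrow> - h t = 1"
      using assms(3) by (simp add: AE_restrict_space_iff)
    then have "AE t in lebesgue_on {0..y}. h t = - 1"
      using y by (subst AE_restrict_space_iff) (auto elim!: eventually_mono)
    moreover have "h \<in> borel_measurable (lebesgue_on {0..y})"
      using u(2) y by (auto simp: H1_deriv_def intro: measurable_restrict_mono)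
    ultimately have "(LINT t|lebesgue_on {0..y}. h t) = (LINT t|lebesgue_on {0..y}. - 1)"
      by (intro integral_cong_AE) auto
    also have "\<dots> = - y" using lint_quadratic(2)[of y "-1" 0 0] y by simp
    moreover have "u' y = u' 0 + (LINT t|lebesgue_on {0..y}. h t)"
      using u(2) y unfolding H1_deriv_def by blast
    ultimately show ?thesis by simp
  qed
  have quad: "u y = u 0 + u' 0 * y - y\<^sup>2 / 2" if y: "y \<in> {0..L}" for y
  proof -
    have "(LINT t|lebesgue_on {0..y}. u' t) = (LINT t|lebesgue_on {0..y}. u' 0 + (- 1) * t + 0 * t\<^sup>2)"
    proof (rule lint_cong)
      fix t assume "t \<in> {0..y}"
      then show "u' t = u' 0 + (- 1) * t + 0 * t\<^sup>2" using u'[of t] y by simp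
    qed
    also have "\<dots> = u' 0 * y - y\<^sup>2 / 2" using y by (subst lint_quadratic) auto
    moreover have "u y = u 0 + (LINT t|lebesgue_on {0..y}. u' t)"
      using u(1) y unfolding H1_deriv_def by blast
    ultimately show ?thesis by simp
  qed
  from quad[of L] assms(1) have "u' 0 = (u L - u 0) / L + L / 2"
    by (simp add: field_simps power2_eq_square)
  then show ?thesis using quad[OF x] by (simp add: edge_torsion_def)
qed

lemma H2_torsionI:
  assumes "0 < L" "\<And>x. x \<in> {0..L} \<Longrightarrow> u x = edge_torsion L p q x"
  shows "H2_deriv2 L u (\<lambda>_. - 1)"
proof -
  define b where "b = (q - p) / L + L / 2"
  have u: "u x = p + b * x - x\<^sup>2 / 2" if "x \<in> {0..L}" for x
    using assms(2)[OF that] by (simp add: edge_torsion_def b_def)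
  have "H1_deriv L (\<lambda>x. b - x) (\<lambda>_. - 1)"
    unfolding H1_deriv_def using lint_quadratic[of _ "-1" 0 0] lint_quadratic(1)[of L 1 0 0] assms(1) by auto
  moreover have "H1_deriv L u (\<lambda>x. b - x)"
    unfolding H1_deriv_def
  proof (intro conjI ballI)
    show "(\<lambda>x. b - x) \<in> borel_measurable (lebesgue_on {0..L})"
      using lint_quadratic(1)[of L b "-1" 0] assms(1) by (auto dest: borel_measurable_integrable)
    have "(\<lambda>x. (b - x)\<^sup>2) = (\<lambda>x. b\<^sup>2 + (- 2 * b) * x + 1 * x\<^sup>2)"
      by (auto simp: power2_eq_square algebra_simps)
    then show "integrable (lebesgue_on {0..L}) (\<lambda>x. (b - x)\<^sup>2)"
      using lint_quadratic(1)[of L "b\<^sup>2" "- 2 * b" 1] assms(1) by simp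
    fix x assume x: "x \<in> {0..L}"
    then show "u x = u 0 + (LINT t|lebesgue_on {0..x}. b - t)"
      using lint_quadratic(2)[of x b "-1" 0] u[of x] u[of 0] by simp
  qed
  ultimately show ?thesis unfolding H2_deriv2_def by blast
qed

lemma edge_torsion_vector_derivative:
  assumes "0 < L" "\<And>x. x \<in> {0..L} \<Longrightarrow> u x = edge_torsion L p q x" "y \<in> {0..L}"
  shows "vector_derivative u (at y within {0..L}) = (q - p) / L + L / 2 - y"
proof -
  have "(edge_torsion L p q has_vector_derivative (q - p) / L + L / 2 - y) (at y within {0..L})"
    unfolding edge_torsion_def has_real_derivative_iff_has_vector_derivative[symmetric]
    by (auto intro!: derivative_eq_intros)
  then have "(u has_vector_derivative (q - p) / L + L / 2 - y) (at y within {0..L})"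
    using assms by (auto intro: has_vector_derivative_transform)
  then show ?thesis
    using vector_derivative_within_cbox[of 0 L y u] assms by simp
qed

section \<open>Vertex values of the torsion function\<close>

definition graph_sol :: "('v, 'e) mgraph \<Rightarrow> ('v \<Rightarrow> real) \<Rightarrow> bool" where
  "graph_sol G = network.sol (tail (graph G)) (head (graph G)) (len G) (arcs (graph G)) (dirichlet G)"

definition graph_energy :: "('v, 'e) mgraph \<Rightarrow> ('v \<Rightarrow> real) \<Rightarrow> real" where
  "graph_energy G f = network.energy (len G) (arcs (graph G))
     (network.grad (tail (graph G)) (head (graph G)) (len G) f)"

text \<open>A relational form of \<open>torsional_rigidity\<close> that makes sense for every metric
  graph, connected or not, so it can be carried through the intermediate graphs of an identification
  without tracking reachability.\<close>

definition has_torsion :: "('v, 'e) mgraph \<Rightarrow> real \<Rightarrow> bool" where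
  "has_torsion G r \<longleftrightarrow> (\<exists>f. graph_sol G f \<and> r = graph_energy G f)"

abbreviation "graph_reach G \<equiv> network.reach (tail (graph G)) (head (graph G)) (arcs (graph G)) (dirichlet G)"
abbreviation "graph_two_reach G \<equiv> network.two_reach (tail (graph G)) (head (graph G)) (arcs (graph G)) (dirichlet G)"

definition torsion_of_vertex_values :: "('v, 'e) mgraph \<Rightarrow> ('v \<Rightarrow> real) \<Rightarrow> 'e \<Rightarrow> real \<Rightarrow> real" where
  "torsion_of_vertex_values G f = (\<lambda>e\<in>arcs (graph G). \<lambda>x\<in>{0..len G e}.
     edge_torsion (len G e) (f (tail (graph G) e)) (f (head (graph G) e)) x)"

lemma metric_graphD:
  assumes "metric_graph G"
  shows "finite (arcs (graph G))" "finite (verts (graph G))" "arcs (graph G) \<noteq> {}"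
    "\<forall>e\<in>arcs (graph G). 0 < len G e" "dirichlet G \<subseteq> verts (graph G)"
    "\<And>e. e \<in> arcs (graph G) \<Longrightarrow> tail (graph G) e \<in> verts (graph G)"
    "\<And>e. e \<in> arcs (graph G) \<Longrightarrow> head (graph G) e \<in> verts (graph G)"
    "network.ends (tail (graph G)) (head (graph G)) (arcs (graph G)) = verts (graph G)"
    "wf_digraph (graph G)"
proof -
  interpret fin_digraph "graph G" using assms by (simp add: metric_graph_def)
  show "finite (arcs (graph G))" "finite (verts (graph G))" "arcs (graph G) \<noteq> {}"
    "\<forall>e\<in>arcs (graph G). 0 < len G e" "dirichlet G \<subseteq> verts (graph G)"
    "\<And>e. e \<in> arcs (graph G) \<Longrightarrow> tail (graph G) e \<in> verts (graph G)"
    "\<And>e. e \<in> arcs (graph G) \<Longrightarrow> head (graph G) e \<in> verts (graph G)"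
    "wf_digraph (graph G)"
    using assms by (auto simp: metric_graph_def intro: wf_digraph_axioms)
  then show "network.ends (tail (graph G)) (head (graph G)) (arcs (graph G)) = verts (graph G)"
    using assms by (fastforce simp: metric_graph_def network.ends_def)
qed

text \<open>The slope of the edge parabola at y is \<open>grad f e + len G e / 2 - y\<close>, so its
  derivatives into the edge at the two ends are the two summands of \<open>load\<close>.\<close>

lemma normal_deriv_sum_eq_load:
  assumes "metric_graph G"
    and v: "\<And>e x. e \<in> arcs (graph G) \<Longrightarrow> x \<in> {0..len G e} \<Longrightarrow>
      v e x = edge_torsion (len G e) (f (tail (graph G) e)) (f (head (graph G) e)) x"
  shows "normal_deriv_sum G v w = network.load (tail (graph G)) (head (graph G)) (len G) (arcs (graph G))
    (network.grad (tail (graph G)) (head (graph G)) (len G) f) w"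
proof -
  interpret network "tail (graph G)" "head (graph G)" "len G" .
  note G = metric_graphD[OF assms(1)]
  have d: "vector_derivative (v e) (at y within {0..len G e}) = grad f e + len G e / 2 - y"
    if "e \<in> arcs (graph G)" "y \<in> {0..len G e}" for e y
    using edge_torsion_vector_derivative[OF _ v[OF that(1)] that(2)] that(1) G(4) unfolding grad_def by blast
  have "(\<Sum>e\<in>out_arcs (graph G) w. vector_derivative (v e) (at 0 within {0..len G e}))
    = (\<Sum>e\<in>arcs (graph G). of_bool (tail (graph G) e = w) * (len G e / 2 + grad f e))"
    unfolding out_arcs_def sum.inter_filter[OF G(1)]
    by (rule sum.cong) (auto simp: d G(4) less_imp_le)
  moreover have "(\<Sum>e\<in>in_arcs (graph G) w. vector_derivative (v e) (at (len G e) within {0..len G e}))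
    = (\<Sum>e\<in>arcs (graph G). - (of_bool (head (graph G) e = w) * (len G e / 2 - grad f e)))"
    unfolding in_arcs_def sum.inter_filter[OF G(1)]
    by (rule sum.cong) (auto simp: d G(4) less_imp_le)
  ultimately show ?thesis by (simp add: normal_deriv_sum_def load_def sum.distrib sum_negf)
qed

lemma is_torsion_function_iff:
  assumes "metric_graph G"
  shows "is_torsion_function G v \<longleftrightarrow> (\<exists>f. graph_sol G f \<and> v = torsion_of_vertex_values G f)"
proof
  interpret network "tail (graph G)" "head (graph G)" "len G" .
  note G = metric_graphD[OF assms]
  show "\<exists>f. graph_sol G f \<and> v = torsion_of_vertex_values G f" if v: "is_torsion_function G v"
  proof -
    from v obtain f where f: "continuous_on_graph G v f" "\<forall>w\<in>dirichlet G. f w = 0"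
      unfolding is_torsion_function_def by blast
    have eq: "v e x = edge_torsion (len G e) (f (tail (graph G) e)) (f (head (graph G) e)) x"
      if e: "e \<in> arcs (graph G)" and "x \<in> {0..len G e}" for e x
    proof -
      from v e obtain h where "H2_deriv2 (len G e) (v e) h" "AE x in lebesgue_on {0..len G e}. - h x = 1"
        unfolding is_torsion_function_def by blast
      with H2_torsionD[of "len G e" "v e" h x] that G(4) f(1) show ?thesis
        by (simp add: continuous_on_graph_def)
    qed
    have "load (arcs (graph G)) (grad f) w = 0" if "w \<notin> dirichlet G" for w
    proof (cases "w \<in> verts (graph G)")
      case True
      with that v normal_deriv_sum_eq_load[OF assms eq, of w] show ?thesis
        by (auto simp: is_torsion_function_def)
    qed (simp add: load_not_end G(8))
    with f(2) have "graph_sol G f" by (simp add: graph_sol_def sol_def flow_def)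
    moreover have "v = torsion_of_vertex_values G f"
    proof (intro ext)
      fix e x
      show "v e x = torsion_of_vertex_values G f e x"
      proof (cases "e \<in> arcs (graph G)")
        case True
        with v have "v e \<in> {0..len G e} \<rightarrow>\<^sub>E UNIV" by (auto simp: is_torsion_function_def)
        with True eq[of e x] show ?thesis
          by (cases "x \<in> {0..len G e}") (auto simp: torsion_of_vertex_values_def PiE_def extensional_def)
      next
        case False
        with v show ?thesis
          by (auto simp: is_torsion_function_def torsion_of_vertex_values_def PiE_def extensional_def)
      qed
    qed
    ultimately show ?thesis by blast
  qed
  show "is_torsion_function G v" if sol: "\<exists>f. graph_sol G f \<and> v = torsion_of_vertex_values G f"
  proof -
    from sol obtain f where f: "sol (arcs (graph G)) (dirichlet G) f" "v = torsion_of_vertex_values G f"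
      by (auto simp: graph_sol_def)
    have eq: "v e x = edge_torsion (len G e) (f (tail (graph G) e)) (f (head (graph G) e)) x"
      if "e \<in> arcs (graph G)" "x \<in> {0..len G e}" for e x
      using that by (simp add: f(2) torsion_of_vertex_values_def)
    have "v \<in> (\<Pi>\<^sub>E e\<in>arcs (graph G). {0..len G e} \<rightarrow>\<^sub>E UNIV)"
      by (auto simp: f(2) torsion_of_vertex_values_def)
    moreover have "continuous_on_graph G v f"
      unfolding continuous_on_graph_def
    proof (intro ballI conjI)
      fix e assume e: "e \<in> arcs (graph G)"
      then have L: "0 < len G e" using G(4) by blast
      have "continuous_on {0..len G e} (edge_torsion (len G e) (f (tail (graph G) e)) (f (head (graph G) e)))"
        unfolding edge_torsion_def by (intro continuous_intros) simp
      then show "continuous_on {0..len G e} (v e)"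
        by (rule continuous_on_eq) (simp add: eq[OF e])
      show "v e 0 = f (tail (graph G) e)" "v e (len G e) = f (head (graph G) e)"
        using eq[OF e] L by (simp_all add: edge_torsion_ends)
    qed
    moreover have "\<exists>h. H2_deriv2 (len G e) (v e) h \<and> (AE x in lebesgue_on {0..len G e}. - h x = 1)"
      if e: "e \<in> arcs (graph G)" for e
    proof (intro exI conjI)
      show "H2_deriv2 (len G e) (v e) (\<lambda>_. - 1)"
        using G(4) e by (intro H2_torsionI) (auto simp: eq[OF e])
    qed simp
    moreover have "normal_deriv_sum G v w = 0" if "w \<notin> dirichlet G" for w
      using f(1) that normal_deriv_sum_eq_load[OF assms eq, of w] by (simp add: sol_def flow_def)
    ultimately show ?thesis using f(1) unfolding is_torsion_function_def sol_def by blast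
  qed
qed

lemma graph_energy_eq:
  assumes "metric_graph G" "graph_sol G f"
  shows "graph_energy G f = (\<Sum>e\<in>arcs (graph G). len G e ^ 3 / 12 +
    len G e * (f (tail (graph G) e) + f (head (graph G) e)) / 2)"
  using network.energy_grad metric_graphD[OF assms(1)] assms(2)
  unfolding graph_energy_def graph_sol_def by blast

text \<open>Reachability makes the vertex values unique, so the definite description in
  \<open>torsion_function\<close> selects the function with vertex values \<open>f\<close>.\<close>

lemma torsional_rigidity_eq_energy:
  assumes "metric_graph G" "\<forall>w\<in>verts (graph G). graph_reach G w" "graph_sol G f"
  shows "torsional_rigidity G = graph_energy G f"
proof -
  note G = metric_graphD[OF assms(1)]
  have unique: "torsion_of_vertex_values G g = torsion_of_vertex_values G f" if "graph_sol G g" for g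
  proof -
    have "g w = f w" if "w \<in> verts (graph G)" for w
      using that assms(2)
      by (intro network.sol_unique[OF G(1,4) \<open>graph_sol G g\<close>[unfolded graph_sol_def] assms(3)[unfolded graph_sol_def]]) blast
    then show ?thesis using G(6,7) by (auto simp: torsion_of_vertex_values_def)
  qed
  have t: "torsion_function G = torsion_of_vertex_values G f"
    unfolding torsion_function_def is_torsion_function_iff[OF assms(1)]
    using assms(3) unique by (intro the_equality) blast+
  have "(LINT x|lebesgue_on {0..len G e}. torsion_function G e x) = len G e ^ 3 / 12 +
    len G e * (f (tail (graph G) e) + f (head (graph G) e)) / 2" if e: "e \<in> arcs (graph G)" for e
  proof -
    have "(LINT x|lebesgue_on {0..len G e}. torsion_function G e x)
      = (LINT x|lebesgue_on {0..len G e}. edge_torsion (len G e) (f (tail (graph G) e)) (f (head (graph G) e)) x)"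
      by (rule lint_cong) (simp add: e t torsion_of_vertex_values_def)
    then show ?thesis using G(4) e edge_torsion_integral by simp
  qed
  then show ?thesis unfolding torsional_rigidity_def graph_energy_eq[OF assms(1,3)] by simp
qed

lemma graph_sol_exists:
  assumes "metric_graph G" "\<forall>w\<in>verts (graph G). graph_reach G w"
  shows "\<exists>f. graph_sol G f"
  using network.sol_exists[of "arcs (graph G)" "len G" "tail (graph G)" "head (graph G)" "dirichlet G"]
    metric_graphD[OF assms(1)] assms(2) by (simp add: graph_sol_def)

lemma torsional_rigidity_iff:
  assumes "metric_graph G" "\<forall>w\<in>verts (graph G). graph_reach G w"
  shows "torsional_rigidity G = r \<longleftrightarrow> has_torsion G r"
  using torsional_rigidity_eq_energy[OF assms] graph_sol_exists[OF assms] by (auto simp: has_torsion_def)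

section \<open>Connectivity expressed by reachability\<close>

lemma connected_imp_reach:
  assumes "Digraph_Component.connected H" "d \<in> verts H" "w \<in> verts H"
  shows "network.reach (tail H) (head H) (arcs H) {d} w"
proof -
  interpret network "tail H" "head H" "\<lambda>_. 1" .
  have "(w, d) \<in> rtrancl_on (verts H) (parcs (mk_symmetric H))"
    using assms by (auto simp: connected_def strongly_connected_def reachable_def)
  then show ?thesis
  proof (induction rule: converse_rtrancl_on_induct)
    case base
    then show ?case by (simp add: reach.base)
  next
    case (step w u)
    then obtain e where "e \<in> arcs H" "(w, u) \<in> {(tail H e, head H e), (head H e, tail H e)}"
      by (auto simp: parcs_mk_symmetric)
    with step show ?case by (intro reach.step[of e _ w u]) auto
  qed
qed

text \<open>All classes other than \<open>D\<close> are singletons, so a walk in the quotient lifts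
  edge by edge until it meets the class \<open>D\<close>.\<close>

lemma reach_glued_imp_reach:
  fixes t h :: "'e \<Rightarrow> 'v" and D :: "'v set"
  defines "\<gamma> \<equiv> \<lambda>w. if w \<in> D then D else {w}"
  assumes "network.reach (\<gamma> \<circ> t) (\<gamma> \<circ> h) E {D} W" "\<gamma> w = W"
  shows "network.reach t h E D w"
proof -
  interpret N: network t h "\<lambda>_. 1" .
  interpret M: network "\<gamma> \<circ> t" "\<gamma> \<circ> h" "\<lambda>_. 1" .
  have "M.reach E {D} W \<Longrightarrow> \<gamma> w = W \<Longrightarrow> N.reach E D w" for w
  proof (induction arbitrary: w rule: M.reach.induct)
    case (base W)
    then show ?case by (intro N.reach.base) (auto simp: \<gamma>_def split: if_splits)
  next
    case (step e W U)
    show ?case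
    proof (cases "w \<in> D")
      case False
      then have w: "\<gamma> x = W \<Longrightarrow> x = w" for x using step.prems by (auto simp: \<gamma>_def split: if_splits)
      from step(2) consider "\<gamma> (t e) = W" "\<gamma> (h e) = U" | "\<gamma> (t e) = U" "\<gamma> (h e) = W"
        by (auto simp: doubleton_eq_iff)
      then show ?thesis
      proof cases
        case 1
        with step w show ?thesis by (intro N.reach.step[of e _ w "h e"]) auto
      next
        case 2
        with step w show ?thesis by (intro N.reach.step[of e _ w "t e"]) auto
      qed
    qed (rule N.reach.base)
  qed
  then show ?thesis using assms by blast
qed

lemma glue_set_simps:
  "verts (glue_set D H) = (\<lambda>w. if w \<in> D then D else {w}) ` verts H" "arcs (glue_set D H) = arcs H"
  "tail (glue_set D H) = (\<lambda>w. if w \<in> D then D else {w}) \<circ> tail H"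
  "head (glue_set D H) = (\<lambda>w. if w \<in> D then D else {w}) \<circ> head H"
  by (simp_all add: glue_set_def map_verts_def)

lemma connected_graph_reach:
  assumes "metric_graph G" "Digraph_Component.connected (graph G)" "dirichlet G \<noteq> {}" "w \<in> verts (graph G)"
  shows "graph_reach G w"
proof -
  from assms(3) obtain d where d: "d \<in> dirichlet G" by blast
  with metric_graphD(5)[OF assms(1)] connected_imp_reach[OF assms(2) _ assms(4), of d] show ?thesis
    by (auto intro: network.reach_mono)
qed

lemma doubly_connected_graph_two_reach:
  assumes "metric_graph G" "doubly_connected (glue_set (dirichlet G) (graph G))" "dirichlet G \<noteq> {}"
  shows "graph_two_reach G"
  unfolding network.two_reach_def
proof (intro ballI)
  fix w e
  let ?D = "dirichlet G" and ?H = "graph G"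
  let ?\<gamma> = "\<lambda>w. if w \<in> ?D then ?D else {w}"
  let ?K = "pre_digraph.del_arc (glue_set ?D ?H) e"
  assume "w \<in> network.ends (tail ?H) (head ?H) (arcs ?H)" and e: "e \<in> arcs ?H"
  then have w: "w \<in> verts ?H" using metric_graphD(8)[OF assms(1)] by simp
  from assms(3) obtain d where "d \<in> ?D" by blast
  then have "?D \<in> verts (glue_set ?D ?H)"
    using metric_graphD(5)[OF assms(1)] by (auto simp: glue_set_simps intro!: image_eqI[of _ _ d])
  moreover have "Digraph_Component.connected ?K"
    using assms(2) e by (simp add: doubly_connected_def glue_set_simps)
  ultimately have "network.reach (tail ?K) (head ?K) (arcs ?K) {?D} (?\<gamma> w)"
    using w by (intro connected_imp_reach) (auto simp: pre_digraph.verts_del_arc glue_set_simps)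
  then have "network.reach (?\<gamma> \<circ> tail ?H) (?\<gamma> \<circ> head ?H) (arcs ?H - {e}) {?D} (?\<gamma> w)"
    by (simp add: pre_digraph.del_arc_simps glue_set_simps)
  then show "network.reach (tail ?H) (head ?H) (arcs ?H - {e}) ?D w"
    by (rule reach_glued_imp_reach) simp
qed


section \<open>Invariance of torsion under identification\<close>

lemma mgraph_iso_sym:
  assumes "metric_graph G" "mgraph_iso G H"
  shows "mgraph_iso H G"
proof -
  let ?G = "graph G" and ?H = "graph H"
  from assms(2) obtain f g where f: "bij_betw f (verts ?G) (verts ?H)" and g: "bij_betw g (arcs ?G) (arcs ?H)"
    and D: "f ` dirichlet G = dirichlet H"
    and e: "\<forall>e\<in>arcs ?G. len H (g e) = len G e \<and> {tail ?H (g e), head ?H (g e)} = f ` {tail ?G e, head ?G e}"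
    unfolding mgraph_iso_def by blast
  define f' where "f' = inv_into (verts ?G) f"
  define g' where "g' = inv_into (arcs ?G) g"
  have ff: "f' (f w) = w" if "w \<in> verts ?G" for w
    using f that by (auto simp: f'_def bij_betw_def)
  have gg: "g' e \<in> arcs ?G" "g (g' e) = e" if "e \<in> arcs ?H" for e
    using g that by (auto simp: g'_def bij_betw_def inv_into_into f_inv_into_f)
  note G = metric_graphD[OF assms(1)]
  show ?thesis
    unfolding mgraph_iso_def
  proof (intro exI conjI ballI)
    show "bij_betw f' (verts ?H) (verts ?G)" unfolding f'_def by (rule bij_betw_inv_into[OF f])
    show "bij_betw g' (arcs ?H) (arcs ?G)" unfolding g'_def by (rule bij_betw_inv_into[OF g])
    show "f' ` dirichlet H = dirichlet G" unfolding D[symmetric] using G(5) ff by force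
    fix e' assume e': "e' \<in> arcs ?H"
    then show "len G (g' e') = len H e'" using e gg[OF e'] by metis
    have "{tail ?H e', head ?H e'} = f ` {tail ?G (g' e'), head ?G (g' e')}" using e gg[OF e'] by metis
    then show "{tail ?G (g' e'), head ?G (g' e')} = f' ` {tail ?H e', head ?H e'}"
      using G(6,7) gg(1)[OF e'] ff by simp
  qed
qed

lemma mgraph_iso_metric_graph:
  assumes "metric_graph G" "mgraph_iso G H"
  shows "metric_graph H"
proof -
  let ?G = "graph G" and ?H = "graph H"
  from assms(2) obtain f g where f: "bij_betw f (verts ?G) (verts ?H)" and g: "bij_betw g (arcs ?G) (arcs ?H)"
    and D: "f ` dirichlet G = dirichlet H"
    and e: "\<forall>e\<in>arcs ?G. len H (g e) = len G e \<and> {tail ?H (g e), head ?H (g e)} = f ` {tail ?G e, head ?G e}"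
    unfolding mgraph_iso_def by blast
  note G = metric_graphD[OF assms(1)]
  have aH: "arcs ?H = g ` arcs ?G" and vH: "verts ?H = f ` verts ?G" using f g by (auto simp: bij_betw_def)
  have ends: "tail ?H e' \<in> verts ?H \<and> head ?H e' \<in> verts ?H" if "e' \<in> arcs ?H" for e'
  proof -
    from that obtain x where x: "x \<in> arcs ?G" "e' = g x" by (auto simp: aH)
    then have "{tail ?H e', head ?H e'} \<subseteq> verts ?H" using e G(6,7) by (simp add: vH)
    then show ?thesis by simp
  qed
  have "fin_digraph ?H"
    by unfold_locales (use ends G(1,2) in \<open>auto simp: aH vH\<close>)
  moreover have "\<exists>e\<in>arcs ?H. w \<in> {tail ?H e, head ?H e}" if "w \<in> verts ?H" for w
  proof -
    from that obtain v where v: "v \<in> verts ?G" "w = f v" by (auto simp: vH)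
    then obtain x where x: "x \<in> arcs ?G" "v \<in> {tail ?G x, head ?G x}"
      using assms(1) unfolding metric_graph_def by blast
    then have "w \<in> {tail ?H (g x), head ?H (g x)}" using e v by blast
    then show ?thesis using x(1) by (auto simp: aH)
  qed
  moreover have "dirichlet H \<subseteq> verts ?H" unfolding D[symmetric] vH using G(5) by (rule image_mono)
  moreover have "\<forall>e\<in>arcs ?H. 0 < len H e" unfolding aH using G(4) e by simp
  ultimately show ?thesis
    unfolding metric_graph_def using G(3) aH by blast
qed

text \<open>Reversing an edge swaps the two summands of \<open>load\<close> and changes the sign of
  \<open>grad\<close>, so loads and energy do not depend on the orientation.\<close>

lemma mgraph_iso_has_torsion:
  assumes "metric_graph G" "mgraph_iso G H" "has_torsion H r"
  shows "has_torsion G r"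
proof -
  let ?G = "graph G" and ?H = "graph H"
  interpret N: network "tail ?G" "head ?G" "len G" .
  interpret M: network "tail ?H" "head ?H" "len H" .
  from assms(2) obtain f g where f: "bij_betw f (verts ?G) (verts ?H)" and g: "bij_betw g (arcs ?G) (arcs ?H)"
    and D: "f ` dirichlet G = dirichlet H"
    and e: "\<And>e. e \<in> arcs ?G \<Longrightarrow> len H (g e) = len G e"
      "\<And>e. e \<in> arcs ?G \<Longrightarrow> {tail ?H (g e), head ?H (g e)} = {f (tail ?G e), f (head ?G e)}"
    unfolding mgraph_iso_def by auto
  note G = metric_graphD[OF assms(1)]
  from assms(3) obtain val where val: "M.sol (arcs ?H) (dirichlet H) val" "r = M.energy (arcs ?H) (M.grad val)"
    by (auto simp: has_torsion_def graph_sol_def graph_energy_def)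
  define u where "u = val \<circ> f"
  have inj: "f v = f w \<longleftrightarrow> v = w" if "v \<in> verts ?G" "w \<in> verts ?G" for v w
    using f that by (auto simp: bij_betw_def inj_on_def)
  have load: "M.load (arcs ?H) (M.grad val) (f w) = N.load (arcs ?G) (N.grad u) w" if w: "w \<in> verts ?G" for w
    unfolding M.load_def N.load_def sum.reindex_bij_betw[OF g, symmetric]
  proof (rule sum.cong)
    fix x assume x: "x \<in> arcs ?G"
    from e(2)[OF x] consider "tail ?H (g x) = f (tail ?G x)" "head ?H (g x) = f (head ?G x)"
      | "tail ?H (g x) = f (head ?G x)" "head ?H (g x) = f (tail ?G x)" by (auto simp: doubleton_eq_iff)
    then show "of_bool (tail ?H (g x) = f w) * (len H (g x) / 2 + M.grad val (g x)) +
        of_bool (head ?H (g x) = f w) * (len H (g x) / 2 - M.grad val (g x)) =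
        of_bool (tail ?G x = w) * (len G x / 2 + N.grad u x) + of_bool (head ?G x = w) * (len G x / 2 - N.grad u x)"
      using x w G(6,7) by cases (simp_all add: e(1) inj M.grad_def N.grad_def u_def diff_divide_distrib)
  qed simp
  have "M.energy (arcs ?H) (M.grad val) = N.energy (arcs ?G) (N.grad u)"
    unfolding M.energy_def N.energy_def sum.reindex_bij_betw[OF g, symmetric]
  proof (rule sum.cong)
    fix x assume x: "x \<in> arcs ?G"
    from e(2)[OF x] consider "tail ?H (g x) = f (tail ?G x)" "head ?H (g x) = f (head ?G x)"
      | "tail ?H (g x) = f (head ?G x)" "head ?H (g x) = f (tail ?G x)" by (auto simp: doubleton_eq_iff)
    then show "len H (g x) ^ 3 / 12 + len H (g x) * (M.grad val (g x))\<^sup>2 =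
        len G x ^ 3 / 12 + len G x * (N.grad u x)\<^sup>2"
      using x by cases (simp_all add: e(1) M.grad_def N.grad_def u_def power_divide power2_commute)
  qed simp
  moreover have "N.sol (arcs ?G) (dirichlet G) u"
    unfolding N.sol_def N.flow_def
  proof (intro conjI ballI allI impI)
    fix w assume "w \<in> dirichlet G"
    then show "u w = 0" using val(1) D by (auto simp: u_def M.sol_def)
  next
    fix w assume w: "w \<notin> dirichlet G"
    show "N.load (arcs ?G) (N.grad u) w = 0"
    proof (cases "w \<in> verts ?G")
      case True
      with w G(5) have "f w \<notin> dirichlet H" unfolding D[symmetric] using inj by blast
      then show ?thesis using val(1) load[OF True] by (simp add: M.sol_def M.flow_def)
    qed (simp add: N.load_not_end G(8))
  qed
  ultimately show ?thesis using val(2) by (auto simp: has_torsion_def graph_sol_def graph_energy_def)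
qed

section \<open>Gluing of Dirichlet vertices\<close>

lemma glue_two_simps [simp]:
  "verts (graph (glue_two a b G)) = (\<lambda>w. if w = b then a else w) ` verts (graph G)"
  "arcs (graph (glue_two a b G)) = arcs (graph G)"
  "tail (graph (glue_two a b G)) = (\<lambda>w. if w = b then a else w) \<circ> tail (graph G)"
  "head (graph (glue_two a b G)) = (\<lambda>w. if w = b then a else w) \<circ> head (graph G)"
  "len (glue_two a b G) = len G"
  "dirichlet (glue_two a b G) = dirichlet G - {b}"
  by (simp_all add: glue_two_def map_verts_def)

lemma glue_two_metric_graph:
  assumes "metric_graph G" "a \<in> dirichlet G" "a \<noteq> b"
  shows "metric_graph (glue_two a b G)"
proof -
  note G = metric_graphD[OF assms(1)]
  have "fin_digraph (graph (glue_two a b G))"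
    by unfold_locales (use G in auto)
  then show ?thesis using assms G(5) unfolding metric_graph_def by auto
qed

text \<open>A solution is 0 at both \<open>a\<close> and \<open>b\<close>, so gluing them changes no
  difference along an edge; loads change only at these two vertices.\<close>

lemma glue_two_has_torsion:
  assumes ab: "a \<in> dirichlet G" "b \<in> dirichlet G" "a \<noteq> b"
  shows "has_torsion (glue_two a b G) r \<longleftrightarrow> has_torsion G r"
proof -
  let ?G = "graph G" and ?H = "graph (glue_two a b G)" and ?g = "\<lambda>w. if w = b then a else w"
  interpret N: network "tail ?G" "head ?G" "len G" .
  interpret M: network "tail ?H" "head ?H" "len G" .
  have grad: "M.grad f = N.grad (f \<circ> ?g)" for f
    unfolding M.grad_def N.grad_def by auto
  have energy: "graph_energy (glue_two a b G) f = graph_energy G (f \<circ> ?g)" for f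
    unfolding graph_energy_def glue_two_simps(2,5) grad ..
  have load: "M.load (arcs ?G) \<phi> w = N.load (arcs ?G) \<phi> w" if "w \<noteq> a" "w \<noteq> b" for \<phi> w
    unfolding M.load_def N.load_def using that by (auto intro!: sum.cong)
  \<comment> \<open>After gluing, \<open>b\<close> has left the Dirichlet set, so balance is
    demanded there; it holds because no edge ends at \<open>b\<close> any more.\<close>
  have load_b: "M.load (arcs ?G) \<phi> b = 0" for \<phi>
    using ab(3) by (intro M.load_not_end) (unfold M.ends_def, auto)
  have sol: "graph_sol (glue_two a b G) f \<longleftrightarrow> (\<forall>w\<in>dirichlet G - {b}. f w = 0) \<and>
      (\<forall>w. w \<notin> dirichlet G \<longrightarrow> N.load (arcs ?G) (N.grad (f \<circ> ?g)) w = 0)" for f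
  proof -
    have "(w \<notin> dirichlet G - {b} \<longrightarrow> M.load (arcs ?G) \<phi> w = 0) \<longleftrightarrow> (w \<notin> dirichlet G \<longrightarrow> N.load (arcs ?G) \<phi> w = 0)" for \<phi> w
      using load[of w \<phi>] load_b[of \<phi>] ab by (cases "w = b"; cases "w = a") auto
    then show ?thesis unfolding graph_sol_def glue_two_simps(2,5,6) M.sol_def M.flow_def grad by simp
  qed
  show ?thesis
  proof
    assume "has_torsion (glue_two a b G) r"
    then obtain f where f: "graph_sol (glue_two a b G) f" "r = graph_energy G (f \<circ> ?g)"
      by (auto simp: has_torsion_def energy)
    moreover have "graph_sol G (f \<circ> ?g)"
      using f(1) ab unfolding sol by (auto simp: graph_sol_def N.sol_def N.flow_def)
    ultimately show "has_torsion G r" by (auto simp: has_torsion_def)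
  next
    assume "has_torsion G r"
    then obtain f where f: "graph_sol G f" "r = graph_energy G f" by (auto simp: has_torsion_def)
    then have "f \<circ> ?g = f" using ab by (auto simp: graph_sol_def N.sol_def)
    with f have "graph_sol (glue_two a b G) f" "r = graph_energy (glue_two a b G) f"
      unfolding sol energy by (auto simp: graph_sol_def N.sol_def N.flow_def)
    then show "has_torsion (glue_two a b G) r" by (auto simp: has_torsion_def)
  qed
qed

section \<open>Subdivision of an edge\<close>

lemma subdivide_edge_simps [simp]:
  "verts (graph (subdivide_edge e e' w s G)) = insert w (verts (graph G))"
  "arcs (graph (subdivide_edge e e' w s G)) = insert e' (arcs (graph G))"
  "tail (graph (subdivide_edge e e' w s G)) = (tail (graph G))(e' := w)"
  "head (graph (subdivide_edge e e' w s G)) = (head (graph G))(e := w, e' := head (graph G) e)"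
  "len (subdivide_edge e e' w s G) = (len G)(e := s, e' := len G e - s)"
  "dirichlet (subdivide_edge e e' w s G) = dirichlet G"
  by (simp_all add: subdivide_edge_def)

lemma subdivide_edge_metric_graph:
  assumes "metric_graph G" "e \<in> arcs (graph G)" "e' \<notin> arcs (graph G)" "w \<notin> verts (graph G)"
    "0 < s" "s < len G e"
  shows "metric_graph (subdivide_edge e e' w s G)"
proof -
  note G = metric_graphD[OF assms(1)]
  let ?H = "graph (subdivide_edge e e' w s G)"
  have "fin_digraph ?H"
    by unfold_locales (use G assms in auto)
  moreover have "\<exists>x\<in>arcs ?H. v \<in> {tail ?H x, head ?H x}" if v: "v \<in> verts ?H" for v
  proof (cases "v = w")
    case True
    then show ?thesis by (intro bexI[of _ e']) auto
  next
    case False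
    with v have "v \<in> verts (graph G)" by simp
    then obtain x where x: "x \<in> arcs (graph G)" "v \<in> {tail (graph G) x, head (graph G) x}"
      using assms(1) unfolding metric_graph_def by blast
    show ?thesis
    proof (cases "x = e \<and> v = head (graph G) e")
      case True
      then show ?thesis by (intro bexI[of _ e']) auto
    next
      case False
      then show ?thesis using x assms(2,3) by (intro bexI[of _ x]) auto
    qed
  qed
  ultimately show ?thesis using assms G(3-5) unfolding metric_graph_def by auto
qed

text \<open>Hypothesis \<alpha> is the Kirchhoff condition at the new vertex \<open>w\<close>. It
  makes the parabolas on the two parts pieces of the parabola on the old edge.\<close>

lemma subdivide_edge_potential:
  fixes G :: "('v, 'e) mgraph"
  assumes G: "metric_graph G" and e: "e \<in> arcs (graph G)" "e' \<notin> arcs (graph G)"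
    and w: "w \<notin> verts (graph G)" and s: "0 < s" "s < len G e"
    and f: "\<And>v. v \<in> verts (graph G) \<Longrightarrow> f' v = f v"
    and \<alpha>: "(f' w - f (tail (graph G) e)) / s - (f (head (graph G) e) - f' w) / (len G e - s) = len G e / 2"
  defines "H \<equiv> subdivide_edge e e' w s G"
  shows "x \<noteq> w \<Longrightarrow> network.load (tail (graph H)) (head (graph H)) (len H) (arcs (graph H))
      (network.grad (tail (graph H)) (head (graph H)) (len H) f') x
    = network.load (tail (graph G)) (head (graph G)) (len G) (arcs (graph G))
      (network.grad (tail (graph G)) (head (graph G)) (len G) f) x"
    and "graph_energy H f' = graph_energy G f"
proof -
  let ?G = "graph G" and ?H = "graph H"
  interpret N: network "tail ?G" "head ?G" "len G" .
  interpret M: network "tail ?H" "head ?H" "len H" .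
  note G' = metric_graphD[OF G]
  define L where "L = len G e"
  define p where "p = f (tail ?G e)"
  define q where "q = f (head ?G e)"
  define A where "A = arcs ?G - {e}"
  have H: "arcs ?H = insert e' (insert e A)" "arcs ?G = insert e A" "finite A" "e' \<noteq> e" "e \<notin> A" "e' \<notin> A"
    using e G'(1) by (auto simp: A_def H_def)
  have A: "tail ?H x = tail ?G x" "head ?H x = head ?G x" "len H x = len G x" "M.grad f' x = N.grad f x"
    if "x \<in> A" for x
    unfolding M.grad_def N.grad_def using that e f G'(6,7) by (auto simp: A_def H_def)
  have ends: "tail ?H e = tail ?G e" "head ?H e = w" "tail ?H e' = w" "head ?H e' = head ?G e"
    "len H e = s" "len H e' = L - s"
    using H(4) by (auto simp: H_def L_def)
  define \<alpha> where "\<alpha> = (f' w - p) / s"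
  define \<beta> where "\<beta> = (q - f' w) / (L - s)"
  define \<psi> where "\<psi> = (q - p) / L"
  have Ls: "0 < L" "0 < L - s" using s by (auto simp: L_def)
  have fe: "f' (tail ?G e) = p" "f' (head ?G e) = q"
    using f G'(6,7) e by (auto simp: p_def q_def)
  have grad: "M.grad f' e = \<alpha>" "M.grad f' e' = \<beta>" "N.grad f e = \<psi>"
    by (simp_all add: M.grad_def N.grad_def ends fe \<alpha>_def \<beta>_def \<psi>_def p_def[symmetric] q_def[symmetric] L_def[symmetric])
  have "\<alpha> - \<beta> = L / 2" using \<alpha> by (simp add: \<alpha>_def \<beta>_def L_def p_def q_def)
  moreover have "s * \<alpha> + (L - s) * \<beta> = L * \<psi>"
    using s Ls by (simp add: \<alpha>_def \<beta>_def \<psi>_def)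
  \<comment> \<open>The midpoints of the parts lie at s/2 and (L + s)/2. The flux has slope -1 and
    value \<psi> at L/2, so there it is \<psi> + (L - s)/2 and \<psi> - s/2.\<close>
  ultimately have "L * \<alpha> = L * (\<psi> + (L - s) / 2)" by algebra
  then have \<alpha>': "\<alpha> = \<psi> + (L - s) / 2" using Ls(1) by simp
  with \<open>\<alpha> - \<beta> = L / 2\<close> have \<beta>': "\<beta> = \<psi> - s / 2" by (simp add: field_simps)
  show "M.load (arcs ?H) (M.grad f') x = N.load (arcs ?G) (N.grad f) x" if "x \<noteq> w"
  proof -
    have "(\<Sum>y\<in>A. of_bool (tail ?H y = x) * (len H y / 2 + M.grad f' y) + of_bool (head ?H y = x) * (len H y / 2 - M.grad f' y))
      = (\<Sum>y\<in>A. of_bool (tail ?G y = x) * (len G y / 2 + N.grad f y) + of_bool (head ?G y = x) * (len G y / 2 - N.grad f y))"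
      by (rule sum.cong) (simp_all add: A)
    then show ?thesis
      unfolding M.load_def N.load_def H(1,2) using H(3-) that
      by (simp add: ends grad L_def[symmetric] \<alpha>' \<beta>' diff_divide_distrib)
  qed
  have "(\<Sum>y\<in>A. len H y ^ 3 / 12 + len H y * (M.grad f' y)\<^sup>2) = (\<Sum>y\<in>A. len G y ^ 3 / 12 + len G y * (N.grad f y)\<^sup>2)"
    by (rule sum.cong) (simp_all add: A)
  moreover have "(s ^ 3 / 12 + s * \<alpha>\<^sup>2) + ((L - s) ^ 3 / 12 + (L - s) * \<beta>\<^sup>2) = L ^ 3 / 12 + L * \<psi>\<^sup>2"
    unfolding \<alpha>' \<beta>' by (simp add: power2_eq_square power3_eq_cube field_simps)
  ultimately show "graph_energy H f' = graph_energy G f"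
    unfolding graph_energy_def M.energy_def N.energy_def H(1,2) using H(3-)
    by (simp add: ends grad L_def[symmetric])
qed

lemma subdivide_edge_has_torsion:
  fixes G :: "('v, 'e) mgraph"
  assumes G: "metric_graph G" and e: "e \<in> arcs (graph G)" "e' \<notin> arcs (graph G)"
    and w: "w \<notin> verts (graph G)" and s: "0 < s" "s < len G e"
  shows "has_torsion (subdivide_edge e e' w s G) r \<longleftrightarrow> has_torsion G r"
proof -
  let ?G = "graph G"
  define H where "H = subdivide_edge e e' w s G"
  let ?H = "graph H"
  interpret N: network "tail ?G" "head ?G" "len G" .
  interpret M: network "tail ?H" "head ?H" "len H" .
  note G' = metric_graphD[OF G]
  note pot = subdivide_edge_potential[OF G e w s, folded H_def]
  have ee: "e' \<noteq> e" using e by auto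
  have D: "dirichlet H = dirichlet G" "w \<notin> dirichlet G" using w G'(5) by (auto simp: H_def)
  have load_w: "M.load (arcs ?H) (M.grad f) w = len G e / 2
      - (f w - f (tail ?G e)) / s + (f (head ?G e) - f w) / (len G e - s)" for f
  proof -
    define A where "A = arcs ?G - {e}"
    have A: "arcs ?H = insert e' (insert e A)" "finite A" "e \<notin> A" "e' \<notin> A"
      using e G'(1) by (auto simp: A_def H_def)
    have ends: "tail ?H e = tail ?G e" "head ?H e = w" "tail ?H e' = w" "head ?H e' = head ?G e"
      "len H e = s" "len H e' = len G e - s"
      using ee by (auto simp: H_def)
    have "tail ?H y \<noteq> w" "head ?H y \<noteq> w" if "y \<in> A" for y
      using that w e G'(6,7) by (auto simp: H_def A_def)
    then have "(\<Sum>y\<in>A. of_bool (tail ?H y = w) * (len H y / 2 + M.grad f y) +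
        of_bool (head ?H y = w) * (len H y / 2 - M.grad f y)) = 0"
      by (intro sum.neutral) simp
    moreover have "tail ?G e \<noteq> w" "head ?G e \<noteq> w" using w e G'(6,7) by auto
    ultimately show ?thesis
      unfolding M.load_def A(1) using ee A(2-)
      by (simp add: ends M.grad_def diff_divide_distrib)
  qed
  have sol: "graph_sol H f' \<longleftrightarrow> graph_sol G f"
    if f: "\<And>v. v \<in> verts ?G \<Longrightarrow> f' v = f v"
      and *: "(f' w - f (tail ?G e)) / s - (f (head ?G e) - f' w) / (len G e - s) = len G e / 2" for f f'
  proof -
    have "M.load (arcs ?H) (M.grad f') w = 0"
    proof -
      have "f' (tail ?G e) = f (tail ?G e)" "f' (head ?G e) = f (head ?G e)" using f G'(6,7) e(1) by auto
      then show ?thesis using * by (simp only: load_w)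
    qed
    moreover have "N.load (arcs ?G) (N.grad f) w = 0" using w by (intro N.load_not_end) (simp add: G'(8))
    ultimately have "M.load (arcs ?H) (M.grad f') x = N.load (arcs ?G) (N.grad f) x" for x
      using pot(1)[OF f *] by (cases "x = w") auto
    moreover have "f' v = f v" if "v \<in> dirichlet G" for v using f that G'(5) by blast
    ultimately show ?thesis by (simp add: graph_sol_def M.sol_def N.sol_def M.flow_def N.flow_def D)
  qed
  show ?thesis
    unfolding H_def[symmetric]
  proof
    assume "has_torsion H r"
    then obtain f where f: "graph_sol H f" "r = graph_energy H f" by (auto simp: has_torsion_def)
    then have "M.load (arcs ?H) (M.grad f) w = 0" using D by (auto simp: graph_sol_def M.sol_def M.flow_def)
    then have "(f w - f (tail ?G e)) / s - (f (head ?G e) - f w) / (len G e - s) = len G e / 2"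
      unfolding load_w by linarith
    with f sol[of f f] pot(2)[of f f] show "has_torsion G r" by (auto simp: has_torsion_def)
  next
    assume "has_torsion G r"
    then obtain f where f: "graph_sol G f" "r = graph_energy G f" by (auto simp: has_torsion_def)
    define p q L where "p = f (tail ?G e)" and "q = f (head ?G e)" and "L = len G e"
    \<comment> \<open>The new value is that of \<open>edge_torsion L p q\<close> at s.\<close>
    define f' where "f' = f(w := p + s * ((q - p) / L + (L - s) / 2))"
    have 1: "f' v = f v" if "v \<in> verts ?G" for v using that w by (auto simp: f'_def)
    have 2: "(f' w - f (tail ?G e)) / s - (f (head ?G e) - f' w) / (len G e - s) = len G e / 2"
      using s unfolding p_def[symmetric] q_def[symmetric] L_def[symmetric]
      by (simp add: f'_def) (simp add: field_simps)
    show "has_torsion H r"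
      using f sol[OF 1 2] pot(2)[OF 1 2] by (auto simp: has_torsion_def)
  qed
qed

lemma elementary_step_metric_graph:
  assumes "elementary_step G H"
  shows "metric_graph G" "metric_graph H"
  using assms
  by (induction rule: elementary_step.induct) (simp_all add: glue_two_metric_graph subdivide_edge_metric_graph)

lemma mgraph_iso_total_length:
  assumes "mgraph_iso G H"
  shows "total_length G = total_length H"
proof -
  from assms obtain g where g: "bij_betw g (arcs (graph G)) (arcs (graph H))"
    "\<forall>e\<in>arcs (graph G). len H (g e) = len G e"
    unfolding mgraph_iso_def by blast
  show ?thesis unfolding total_length_def sum.reindex_bij_betw[OF g(1), symmetric] using g(2) by simp
qed

lemma elementary_step_invariant:
  assumes "elementary_step G H"
  shows "has_torsion G r \<longleftrightarrow> has_torsion H r" "total_length G = total_length H"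
proof -
  show "has_torsion G r \<longleftrightarrow> has_torsion H r"
    using assms
    by (induction rule: elementary_step.induct)
      (auto simp: glue_two_has_torsion subdivide_edge_has_torsion intro: mgraph_iso_has_torsion mgraph_iso_sym)
  show "total_length G = total_length H"
    using assms
  proof (induction rule: elementary_step.induct)
    case (subdivide G e e' w s)
    note G = metric_graphD[OF subdivide(1)]
    define A where "A = arcs (graph G) - {e}"
    have A: "arcs (graph G) = insert e A" "finite A" "e \<notin> A" "e' \<notin> A" "e' \<noteq> e"
      using subdivide G(1) by (auto simp: A_def)
    have "sum ((len G)(e := s, e' := len G e - s)) A = sum (len G) A"
      using A by (intro sum.cong) auto
    then show ?case
      unfolding total_length_def subdivide_edge_simps A(1) using A by simp
  next
    case (iso G H)
    then show ?case by (intro mgraph_iso_total_length)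
  qed (simp add: total_length_def)
qed

lemma equivclp_invariant:
  assumes "equivclp elementary_step G H"
  shows "has_torsion G r \<longleftrightarrow> has_torsion H r" "total_length G = total_length H"
  using assms
  by (induction rule: equivclp_induct) (auto simp: elementary_step_invariant)

lemma identified_invariant:
  assumes "metric_graph G" "identified G K"
  shows "has_torsion G r \<longleftrightarrow> has_torsion K r" "total_length G = total_length K"
proof -
  from assms(2) obtain G' where G': "mgraph_iso G G'" "equivclp elementary_step G' K"
    by (auto simp: identified_def)
  have "metric_graph G'" by (rule mgraph_iso_metric_graph[OF assms(1) G'(1)])
  then have "has_torsion G r \<longleftrightarrow> has_torsion G' r" "total_length G = total_length G'"
    using mgraph_iso_has_torsion[OF assms(1) G'(1)] mgraph_iso_has_torsion[OF _ mgraph_iso_sym[OF assms(1) G'(1)]]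
      mgraph_iso_total_length[OF G'(1)] by auto
  with equivclp_invariant[OF G'(2)] show "has_torsion G r \<longleftrightarrow> has_torsion K r" "total_length G = total_length K"
    by auto
qed

section \<open>Torsion of the two extremal families\<close>

lemma mixed_interval_has_torsion:
  assumes "mixed_interval K"
  shows "has_torsion K (total_length K ^ 3 / 3)"
proof -
  let ?K = "graph K"
  interpret network "tail ?K" "head ?K" "len K" .
  from assms obtain a b e where K: "metric_graph K" "a \<noteq> b" "arcs ?K = {e}"
    "{tail ?K e, head ?K e} = {a, b}" "dirichlet K = {a}"
    unfolding mixed_interval_def by blast
  have pos: "0 < len K e" using metric_graphD(4)[OF K(1)] K(3) by simp
  \<comment> \<open>At distance x from the Dirichlet end the torsion function is x (L - x / 2),
    which is L^2 / 2 at the Neumann end.\<close>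
  define f where "f = (\<lambda>w. if w = b then (len K e)\<^sup>2 / 2 else 0)"
  from K(2,4) have *: "(tail ?K e = a \<and> head ?K e = b) \<or> (tail ?K e = b \<and> head ?K e = a)"
    by (auto simp: doubleton_eq_iff)
  have "grad f e = (if head ?K e = b then len K e / 2 else - len K e / 2)"
    using * K(2) pos by (auto simp: grad_def f_def power2_eq_square)
  with * K(2) have "sol (arcs ?K) (dirichlet K) f" "energy (arcs ?K) (grad f) = total_length K ^ 3 / 3"
    by (auto simp: sol_def flow_def load_def energy_def K(3,5) f_def total_length_def power2_eq_square power3_eq_cube)
  then show ?thesis unfolding has_torsion_def graph_sol_def graph_energy_def by metis
qed

lemma sum_telescope_pred:
  fixes g :: "nat \<Rightarrow> real"
  shows "(\<Sum>j\<in>{1..m}. g (j - 1) - g j) = g 0 - g m"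
  by (induction m) auto

text \<open>The solution is explicit: everything from ring j on, of length \<open>M j\<close>,
  drains through ring j and splits evenly between its two edges.\<close>

lemma caterpillar_has_torsion:
  assumes "caterpillar K"
  shows "has_torsion K (total_length K ^ 3 / 12)"
proof -
  let ?K = "graph K"
  interpret network "tail ?K" "head ?K" "len K" .
  from assms obtain m :: nat and p where K: "metric_graph K"
    and m: "1 \<le> m" and p: "bij_betw p {0..m} (verts ?K)"
    and ring: "\<forall>j\<in>{1..m}. card (edges_between ?K (p (j - 1)) (p j)) = 2 \<and>
      (\<forall>e\<in>edges_between ?K (p (j - 1)) (p j). \<forall>e'\<in>edges_between ?K (p (j - 1)) (p j). len K e = len K e')"
    and arcs: "arcs ?K = (\<Union>j\<in>{1..m}. edges_between ?K (p (j - 1)) (p j))"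
    and D: "dirichlet K = {p 0}"
    unfolding caterpillar_def by blast
  define B where "B j = edges_between ?K (p (j - 1)) (p j)" for j
  define r where "r j = len K (SOME e. e \<in> B j)" for j
  have inj: "p i = p j \<longleftrightarrow> i = j" if "i \<le> m" "j \<le> m" for i j
    using p that by (auto simp: bij_betw_def inj_on_def)
  have card: "card (B j) = 2" if "j \<in> {1..m}" for j using ring that by (simp add: B_def)
  have fin: "finite (B j)" if "j \<in> {1..m}" for j using card[OF that] by (simp add: card_ge_0_finite)
  have r: "len K e = r j" if "j \<in> {1..m}" "e \<in> B j" for j e
    unfolding r_def using ring that someI[of "\<lambda>e. e \<in> B j" e] unfolding B_def by blast
  have disj: "B i \<inter> B j = {}" if "i \<in> {1..m}" "j \<in> {1..m}" "i \<noteq> j" for i j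
  proof (rule ccontr)
    assume "B i \<inter> B j \<noteq> {}"
    then have "{p (i - 1), p i} = {p (j - 1), p j}" by (auto simp: B_def edges_between_def)
    with that show False by (auto simp: doubleton_eq_iff inj)
  qed
  have split: "sum g (arcs ?K) = (\<Sum>j\<in>{1..m}. 2 * c j)"
    if "\<And>j e. j \<in> {1..m} \<Longrightarrow> e \<in> B j \<Longrightarrow> g e = c j" for g and c :: "nat \<Rightarrow> real"
  proof -
    have "sum g (arcs ?K) = (\<Sum>j\<in>{1..m}. sum g (B j))"
      unfolding arcs B_def[symmetric] using fin disj by (intro sum.UNION_disjoint) auto
    also have "\<dots> = (\<Sum>j\<in>{1..m}. 2 * c j)"
      using that card by (intro sum.cong) auto
    finally show ?thesis .
  qed
  define M where "M j = (\<Sum>i\<in>{j..m}. 2 * r i)" for j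
  define V where "V j = (\<Sum>i\<in>{1..j}. r i * (M i - r i) / 2)" for j
  \<comment> \<open>Each edge of ring j delivers M j / 2 at its near end, so half an edge further
    the flux is this value.\<close>
  define \<psi> where "\<psi> j = (M j - r j) / 2" for j
  have M: "M (Suc j) = M j - 2 * r j" if "j \<in> {1..m}" for j
    using that by (simp add: M_def sum.atLeast_Suc_atMost)
  have M_end: "M (Suc m) = 0" by (simp add: M_def)
  have V: "V j - V (j - 1) = r j * \<psi> j" if "j \<in> {1..m}" for j
    using that by (cases j) (simp_all add: V_def \<psi>_def)
  define val where "val w = V (inv_into {0..m} p w)" for w
  have val: "val (p j) = V j" if "j \<le> m" for j
    using p that by (simp add: val_def bij_betw_def)
  have pos: "0 < r j" if "j \<in> {1..m}" for j
  proof -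
    from card[OF that] obtain e where "e \<in> B j" by (metis card.empty ex_in_conv zero_neq_numeral)
    moreover from this have "e \<in> arcs ?K" by (simp add: B_def edges_between_def)
    ultimately show ?thesis using r[OF that] metric_graphD(4)[OF K] by metis
  qed
  have orient: "(tail ?K e = p (j - 1) \<and> head ?K e = p j \<and> grad val e = \<psi> j) \<or>
      (tail ?K e = p j \<and> head ?K e = p (j - 1) \<and> grad val e = - \<psi> j)" if "j \<in> {1..m}" "e \<in> B j" for j e
  proof -
    have "(tail ?K e = p (j - 1) \<and> head ?K e = p j) \<or> (tail ?K e = p j \<and> head ?K e = p (j - 1))"
      using that(2) by (auto simp: B_def edges_between_def doubleton_eq_iff)
    moreover have "(V j - V (j - 1)) / r j = \<psi> j" "(V (j - 1) - V j) / r j = - \<psi> j"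
      using V[OF that(1)] pos[OF that(1)] by (auto simp: field_simps)
    ultimately show ?thesis using that r[OF that] val[of j] val[of "j - 1"] by (auto simp: grad_def)
  qed
  have half: "2 * (x / 2) = x" for x :: real by simp
  have "load (arcs ?K) (grad val) w = 0" if "w \<noteq> p 0" for w
  proof -
    \<comment> \<open>Each edge of ring j delivers M j / 2 to p (j - 1) and takes M (j + 1) / 2 from
      p j. The sum over the rings telescopes, and nothing remains away from p 0 because
      \<open>M (Suc m)\<close> is 0.\<close>
    let ?g = "\<lambda>j. of_bool (w = p j) * M (Suc j)"
    have "load (arcs ?K) (grad val) w = (\<Sum>j\<in>{1..m}. 2 * ((?g (j - 1) - ?g j) / 2))"
      unfolding load_def
    proof (rule split)
      fix j e assume j: "j \<in> {1..m}" and e: "e \<in> B j"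
      have "p (j - 1) \<noteq> p j" "Suc (j - 1) = j" using j by (auto simp: inj)
      then show "of_bool (tail ?K e = w) * (len K e / 2 + grad val e) + of_bool (head ?K e = w) * (len K e / 2 - grad val e)
        = (?g (j - 1) - ?g j) / 2"
        using orient[OF j e] r[OF j e] M[OF j] by (auto simp: \<psi>_def diff_divide_distrib)
    qed
    also have "\<dots> = (\<Sum>j\<in>{1..m}. ?g (j - 1) - ?g j)" unfolding half ..
    also have "\<dots> = 0" using sum_telescope_pred[of ?g m] that M_end by simp
    finally show ?thesis .
  qed
  then have "graph_sol K val"
    using val[of 0] by (auto simp: graph_sol_def sol_def flow_def D V_def)
  moreover have "graph_energy K val = total_length K ^ 3 / 12"
  proof -
    \<comment> \<open>The energy of ring j is the integral of (s/2)^2 over [M (j + 1), M j].\<close>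
    let ?h = "\<lambda>j. M (Suc j) ^ 3 / 12"
    have "graph_energy K val = (\<Sum>j\<in>{1..m}. 2 * ((?h (j - 1) - ?h j) / 2))"
      unfolding graph_energy_def energy_def
    proof (rule split)
      fix j e assume j: "j \<in> {1..m}" and e: "e \<in> B j"
      have "(grad val e)\<^sup>2 = (\<psi> j)\<^sup>2" using orient[OF j e] by auto
      then have "len K e ^ 3 / 12 + len K e * (grad val e)\<^sup>2 = r j ^ 3 / 12 + r j * ((M j - r j) / 2)\<^sup>2"
        by (simp only: r[OF j e] \<psi>_def)
      also have "\<dots> = (M j ^ 3 / 12 - (M j - 2 * r j) ^ 3 / 12) / 2"
        by (simp add: power2_eq_square power3_eq_cube field_simps)
      moreover have "Suc (j - 1) = j" using j by simp
      ultimately show "len K e ^ 3 / 12 + len K e * (grad val e)\<^sup>2 = (?h (j - 1) - ?h j) / 2"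
        by (simp only: M[OF j])
    qed
    also have "\<dots> = (\<Sum>j\<in>{1..m}. ?h (j - 1) - ?h j)" unfolding half ..
    also have "\<dots> = M 1 ^ 3 / 12" using sum_telescope_pred[of ?h m] M_end by simp
    also have "M 1 = total_length K"
      unfolding total_length_def M_def by (rule split[symmetric]) (rule r)
    finally show ?thesis .
  qed
  ultimately show ?thesis by (auto simp: has_torsion_def)
qed


section \<open>Contraction of paths\<close>

lemma (in network) path_cong:
  assumes "\<And>e. e \<in> set (map fst xs) \<Longrightarrow> {src e, tgt e} = {src' e, tgt' e}"
  shows "path a xs b \<longleftrightarrow> network.path src' tgt' a xs b"
proof -
  interpret N: network src' tgt' l .
  show ?thesis using assms
    by (induction a xs b rule: path.induct) auto
qed

definition merge_edges :: "'e \<Rightarrow> 'e \<Rightarrow> 'v \<Rightarrow> 'v \<Rightarrow> 'v \<Rightarrow> ('v, 'e) mgraph \<Rightarrow> ('v, 'e) mgraph" where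
  "merge_edges e e' a u b G =
     \<lparr> graph = \<lparr> verts = verts (graph G) - {u}, arcs = arcs (graph G) - {e'},
                 tail = (tail (graph G))(e := a), head = (head (graph G))(e := b) \<rparr>,
       len = (len G)(e := len G e + len G e'), dirichlet = dirichlet G \<rparr>"

lemma merge_edges_simps [simp]:
  "verts (graph (merge_edges e e' a u b G)) = verts (graph G) - {u}"
  "arcs (graph (merge_edges e e' a u b G)) = arcs (graph G) - {e'}"
  "tail (graph (merge_edges e e' a u b G)) = (tail (graph G))(e := a)"
  "head (graph (merge_edges e e' a u b G)) = (head (graph G))(e := b)"
  "len (merge_edges e e' a u b G) = (len G)(e := len G e + len G e')"
  "dirichlet (merge_edges e e' a u b G) = dirichlet G"
  by (simp_all add: merge_edges_def)

text \<open>Subdividing the merged edge at \<open>len G e\<close> gives back \<open>G\<close> up to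
  the orientation of the two edges, so merging is an isomorphism followed by an inverse
  subdivision.\<close>

lemma merge_edges_step:
  assumes G: "metric_graph G" and e: "e \<in> arcs (graph G)" "e' \<in> arcs (graph G)" "e \<noteq> e'"
    and ends: "{tail (graph G) e, head (graph G) e} = {a, u}" "{tail (graph G) e', head (graph G) e'} = {u, b}"
    and u: "u \<notin> dirichlet G" "u \<noteq> a" "u \<noteq> b"
    and other: "\<And>x. x \<in> arcs (graph G) - {e, e'} \<Longrightarrow> tail (graph G) x \<noteq> u \<and> head (graph G) x \<noteq> u"
  defines "H \<equiv> merge_edges e e' a u b G"
  shows "metric_graph H" "equivclp elementary_step G H"
proof -
  note G' = metric_graphD[OF G]
  have ab: "a \<in> verts (graph G)" "b \<in> verts (graph G)" "u \<in> verts (graph G)"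
    using ends e(1,2) G'(6,7) by (auto simp: doubleton_eq_iff)
  have "fin_digraph (graph H)"
    by unfold_locales (use G' other ab u e in \<open>auto simp: H_def\<close>)
  moreover have "\<exists>x\<in>arcs (graph H). w \<in> {tail (graph H) x, head (graph H) x}" if w: "w \<in> verts (graph H)" for w
  proof -
    from w have "w \<in> verts (graph G)" "w \<noteq> u" by (auto simp: H_def)
    then obtain x where x: "x \<in> arcs (graph G)" "w \<in> {tail (graph G) x, head (graph G) x}"
      using G unfolding metric_graph_def by blast
    show ?thesis
    proof (cases "x = e \<or> x = e'")
      case True
      with x ends \<open>w \<noteq> u\<close> have "w = a \<or> w = b" by auto
      then show ?thesis using e by (intro bexI[of _ e]) (auto simp: H_def)
    next
      case False
      then show ?thesis using x by (intro bexI[of _ x]) (auto simp: H_def)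
    qed
  qed
  moreover have "e \<in> arcs (graph H)" using e by (simp add: H_def)
  moreover have "\<forall>x\<in>arcs (graph H). 0 < len H x" using G'(4) e by (auto simp: H_def add_pos_pos)
  moreover have "dirichlet H \<subseteq> verts (graph H)" using G'(5) u(1) by (auto simp: H_def)
  ultimately show H: "metric_graph H" unfolding metric_graph_def by blast
  define K where "K = subdivide_edge e e' u (len G e) H"
  have cond: "e \<in> arcs (graph H)" "e' \<notin> arcs (graph H)" "u \<notin> verts (graph H)" "0 < len G e" "len G e < len H e"
    using e G'(4) by (auto simp: H_def)
  have step: "elementary_step H K" unfolding K_def by (rule elementary_step.subdivide[OF H cond])
  have K: "metric_graph K" by (rule elementary_step_metric_graph(2)[OF step])
  have "mgraph_iso K G"
    unfolding mgraph_iso_def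
  proof (intro exI[of _ id] conjI ballI)
    show "bij_betw id (verts (graph K)) (verts (graph G))"
      using ab by (simp add: K_def H_def insert_absorb)
    show "bij_betw id (arcs (graph K)) (arcs (graph G))"
      using e by (simp add: K_def H_def insert_absorb)
    show "id ` dirichlet K = dirichlet G" by (simp add: K_def H_def)
    fix x assume "x \<in> arcs (graph K)"
    show "len G (id x) = len K x" using e(3) by (auto simp: K_def H_def)
    show "{tail (graph G) (id x), head (graph G) (id x)} = id ` {tail (graph K) x, head (graph K) x}"
      using e(3) ends by (auto simp: K_def H_def)
  qed
  then have "elementary_step K G" by (rule elementary_step.iso[OF K G])
  with step show "equivclp elementary_step G H"
    by (meson converse_r_into_equivclp equivclp_sym equivclp_trans r_into_equivclp)
qed

text \<open>Each induction step merges the first two edges. The hypotheses on \<open>butlast\<close>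
  say that the inner vertices have degree two and are not Dirichlet. The ends may coincide, and the
  path then becomes a loop.\<close>

lemma contract_path:
  fixes G :: "('v, 'e) mgraph"
  assumes "metric_graph G" "network.path (tail (graph G)) (head (graph G)) a ((e, u) # xs) b"
    and "set (map fst ((e, u) # xs)) \<subseteq> arcs (graph G)" "distinct (map fst ((e, u) # xs))"
    and "distinct (butlast (map snd ((e, u) # xs)))"
    and "set (butlast (map snd ((e, u) # xs))) \<inter> ({a, b} \<union> dirichlet G) = {}"
    and "\<And>x. x \<in> arcs (graph G) - set (map fst ((e, u) # xs)) \<Longrightarrow>
      {tail (graph G) x, head (graph G) x} \<inter> set (butlast (map snd ((e, u) # xs))) = {}"
  shows "\<exists>H. metric_graph H \<and> equivclp elementary_step G H \<and> dirichlet H = dirichlet G \<and>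
    arcs (graph H) = insert e (arcs (graph G) - set (map fst ((e, u) # xs))) \<and>
    {tail (graph H) e, head (graph H) e} = {a, b} \<and> len H e = network.path_len (len G) ((e, u) # xs) \<and>
    (\<forall>x\<in>arcs (graph G) - set (map fst ((e, u) # xs)). tail (graph H) x = tail (graph G) x \<and>
      head (graph H) x = head (graph G) x \<and> len H x = len G x)"
  using assms
proof (induction xs arbitrary: G u)
  case Nil
  interpret network "tail (graph G)" "head (graph G)" "len G" .
  show ?case
    using Nil by (intro exI[of _ G]) (auto simp: insert_absorb)
next
  case (Cons x xs)
  interpret network "tail (graph G)" "head (graph G)" "len G" .
  obtain e' u' where x: "x = (e', u')" by (cases x)
  note prems = Cons.prems[unfolded x]
  let ?S = "set (map fst ((e, u) # (e', u') # xs))"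
  let ?I = "set (butlast (map snd ((e, u') # xs)))"
  have I: "set (butlast (map snd ((e, u) # (e', u') # xs))) = insert u ?I" "u \<notin> ?I"
    using prems(5) by auto
  have e: "e \<in> arcs (graph G)" "e' \<in> arcs (graph G)" "e \<noteq> e'" "e \<notin> set (map fst xs)" "e' \<notin> set (map fst xs)"
    using prems(3,4) by auto
  have ends: "{tail (graph G) e, head (graph G) e} = {a, u}" "{tail (graph G) e', head (graph G) e'} = {u, u'}"
    and p: "path u' xs b"
    using prems(2) by auto
  have u: "u \<notin> dirichlet G" "u \<noteq> a" "u \<noteq> b" using prems(6) unfolding I by auto
  have u': "u \<noteq> u'"
    using I(2) u(3) p by (cases xs) auto
  have other: "tail (graph G) y \<noteq> u \<and> head (graph G) y \<noteq> u" if y: "y \<in> arcs (graph G) - {e, e'}" for y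
  proof (cases "y \<in> set (map fst xs)")
    case True
    then have "xs \<noteq> []" by auto
    have "u \<notin> insert u' (set (map snd xs))"
    proof -
      have "insert u' (set (map snd xs)) = insert b ?I"
        using path_last[OF p \<open>xs \<noteq> []\<close>] \<open>xs \<noteq> []\<close>
        by (cases xs rule: rev_cases) (auto simp: butlast_append)
      then show ?thesis using I(2) u(3) by simp
    qed
    moreover have "tail (graph G) y \<in> ends (set (map fst xs))" "head (graph G) y \<in> ends (set (map fst xs))"
      unfolding ends_def by (intro UnI1 UnI2 imageI True)+
    ultimately show ?thesis using ends_path(1)[OF p] by blast
  next
    case False
    with y prems(7)[of y] show ?thesis unfolding I by auto
  qed
  define H where "H = merge_edges e e' a u u' G"
  have H: "metric_graph H" "equivclp elementary_step G H"
    unfolding H_def by (rule merge_edges_step[OF prems(1) e(1-3) ends u(1,2) u' other]; assumption)+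
  have same: "tail (graph H) y = tail (graph G) y" "head (graph H) y = head (graph G) y" "len H y = len G y"
    if "y \<noteq> e" for y using that by (simp_all add: H_def)
  have arcsH: "arcs (graph H) - set (map fst ((e, u') # xs)) = arcs (graph G) - ?S" by (auto simp: H_def)
  have "\<exists>K. metric_graph K \<and> equivclp elementary_step H K \<and> dirichlet K = dirichlet H \<and>
    arcs (graph K) = insert e (arcs (graph H) - set (map fst ((e, u') # xs))) \<and>
    {tail (graph K) e, head (graph K) e} = {a, b} \<and> len K e = network.path_len (len H) ((e, u') # xs) \<and>
    (\<forall>x\<in>arcs (graph H) - set (map fst ((e, u') # xs)). tail (graph K) x = tail (graph H) x \<and>
      head (graph K) x = head (graph H) x \<and> len K x = len H x)"
  proof (rule Cons.IH[OF H(1)])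
    have "path u' xs b \<longleftrightarrow> network.path (tail (graph H)) (head (graph H)) u' xs b"
    proof (rule path_cong)
      fix y assume "y \<in> set (map fst xs)"
      then have "y \<noteq> e" using e(4) by blast
      from same[OF this] show "{tail (graph G) y, head (graph G) y} = {tail (graph H) y, head (graph H) y}" by simp
    qed
    then show "network.path (tail (graph H)) (head (graph H)) a ((e, u') # xs) b"
      using p by (simp add: network.path.simps H_def)
    show "set (map fst ((e, u') # xs)) \<subseteq> arcs (graph H)" using prems(3) e by (auto simp: H_def)
    show "distinct (map fst ((e, u') # xs))" using prems(4) by auto
    show "distinct (butlast (map snd ((e, u') # xs)))" using prems(5) by auto
    show "?I \<inter> ({a, b} \<union> dirichlet H) = {}" using prems(6) unfolding I by (auto simp: H_def)
    fix y assume "y \<in> arcs (graph H) - set (map fst ((e, u') # xs))"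
    then have y: "y \<in> arcs (graph G) - ?S" "y \<noteq> e" unfolding arcsH by auto
    then show "{tail (graph H) y, head (graph H) y} \<inter> ?I = {}"
      using prems(7)[OF y(1)] unfolding I same[OF y(2)] by auto
  qed
  then obtain K where K: "metric_graph K" "equivclp elementary_step H K" "dirichlet K = dirichlet H"
    "arcs (graph K) = insert e (arcs (graph G) - ?S)"
    "{tail (graph K) e, head (graph K) e} = {a, b}" "len K e = network.path_len (len H) ((e, u') # xs)"
    "\<forall>x\<in>arcs (graph G) - ?S. tail (graph K) x = tail (graph H) x \<and>
      head (graph K) x = head (graph H) x \<and> len K x = len H x"
    unfolding arcsH by blast
  have "network.path_len (len H) xs = path_len xs"
    unfolding network.path_len_def using e(4) same(3)
    by (intro arg_cong[of _ _ sum_list] map_cong) force+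
  then have len: "len K e = path_len ((e, u) # (e', u') # xs)"
    unfolding K(6) network.path_len_simps by (simp add: H_def)
  show ?case
    unfolding x
  proof (intro exI[of _ K] conjI)
    show "equivclp elementary_step G K" using H(2) K(2) by (rule equivclp_trans)
    show "\<forall>x\<in>arcs (graph G) - ?S. tail (graph K) x = tail (graph G) x \<and>
      head (graph K) x = head (graph G) x \<and> len K x = len G x"
      using K(7) same by auto
  qed (use K len in \<open>auto simp: H_def\<close>)
qed

text \<open>The edges \<open>A\<close> form the first \<open>k\<close> rings of a caterpillar with vertices \<open>p 0, \<dots>, p k\<close>.\<close>

definition double_chain :: "('v, 'e) mgraph \<Rightarrow> 'e set \<Rightarrow> nat \<Rightarrow> (nat \<Rightarrow> 'v) \<Rightarrow> bool" where
  "double_chain G A k p \<longleftrightarrow> inj_on p {0..k} \<and>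
     (\<forall>j\<in>{1..k}. card {e \<in> A. {tail (graph G) e, head (graph G) e} = {p (j - 1), p j}} = 2 \<and>
       (\<forall>e\<in>A. \<forall>e'\<in>A. {tail (graph G) e, head (graph G) e} = {p (j - 1), p j} \<longrightarrow>
         {tail (graph G) e', head (graph G) e'} = {p (j - 1), p j} \<longrightarrow> len G e = len G e')) \<and>
     (\<forall>e\<in>A. \<exists>j\<in>{1..k}. {tail (graph G) e, head (graph G) e} = {p (j - 1), p j})"

lemma double_chain_cong:
  assumes "\<And>e. e \<in> A \<Longrightarrow> tail (graph H) e = tail (graph G) e \<and> head (graph H) e = head (graph G) e \<and> len H e = len G e"
  shows "double_chain H A k p \<longleftrightarrow> double_chain G A k p"
proof -
  have "{e \<in> A. {tail (graph H) e, head (graph H) e} = X} = {e \<in> A. {tail (graph G) e, head (graph G) e} = X}" for X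
    using assms by auto
  then show ?thesis unfolding double_chain_def using assms by (simp cong: ball_cong)
qed

lemma double_chain_ends:
  assumes "double_chain G A k p" "e \<in> A"
  shows "{tail (graph G) e, head (graph G) e} \<subseteq> p ` {0..k}"
proof -
  from assms obtain j where "j \<in> {1..k}" "{tail (graph G) e, head (graph G) e} = {p (j - 1), p j}"
    unfolding double_chain_def by blast
  then show ?thesis by auto
qed

lemma double_chain_extend:
  assumes dc: "double_chain G A k p" and e: "e1 \<noteq> e2" "e1 \<notin> A" "e2 \<notin> A"
    and v: "v \<notin> p ` {0..k}" and len: "len G e1 = len G e2"
    and ends: "{tail (graph G) e1, head (graph G) e1} = {p k, v}" "{tail (graph G) e2, head (graph G) e2} = {p k, v}"
  shows "double_chain G (insert e1 (insert e2 A)) (Suc k) (p(Suc k := v))"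
proof -
  let ?p = "p(Suc k := v)" and ?A = "insert e1 (insert e2 A)"
  let ?E = "\<lambda>e. {tail (graph G) e, head (graph G) e}"
  have new: "{e \<in> ?A. ?E e = {?p k, ?p (Suc k)}} = {e1, e2}"
    using double_chain_ends[OF dc] v ends by fastforce
  have old: "{e \<in> ?A. ?E e = {?p (j - 1), ?p j}} = {e \<in> A. ?E e = {p (j - 1), p j}}" if j: "j \<in> {1..k}" for j
  proof -
    have "v \<notin> {p (j - 1), p j}" using j v by auto
    then have "?E e1 \<noteq> {p (j - 1), p j}" "?E e2 \<noteq> {p (j - 1), p j}" unfolding ends by blast+
    moreover have "?p (j - 1) = p (j - 1)" "?p j = p j" using j by auto
    ultimately show ?thesis by (simp only:) blast
  qed
  have "inj_on ?p {0..Suc k}"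
    using dc v by (auto simp: double_chain_def inj_on_def)
  moreover have "card {e \<in> ?A. ?E e = {?p (j - 1), ?p j}} = 2 \<and>
      (\<forall>e\<in>?A. \<forall>e'\<in>?A. ?E e = {?p (j - 1), ?p j} \<longrightarrow> ?E e' = {?p (j - 1), ?p j} \<longrightarrow> len G e = len G e')"
    if "j \<in> {1..Suc k}" for j
  proof (cases "j = Suc k")
    case True
    then have "?p (j - 1) = ?p k" "?p j = ?p (Suc k)" by simp_all
    then have set: "{e \<in> ?A. ?E e = {?p (j - 1), ?p j}} = {e1, e2}" using new by (simp only:)
    have "len G x = len G e1" if "x \<in> ?A" "?E x = {?p (j - 1), ?p j}" for x
    proof -
      from that have "x \<in> {e \<in> ?A. ?E e = {?p (j - 1), ?p j}}" by blast
      then have "x = e1 \<or> x = e2" unfolding set by blast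
      then show ?thesis using len by auto
    qed
    moreover have "card {e1, e2} = 2" using e(1) by simp
    ultimately show ?thesis unfolding set by metis
  next
    case False
    with that have j: "j \<in> {1..k}" by auto
    have mem: "x \<in> A \<and> ?E x = {p (j - 1), p j}" if "x \<in> ?A" "?E x = {?p (j - 1), ?p j}" for x
      using old[OF j] that by blast
    have "\<forall>j\<in>{1..k}. card {e \<in> A. ?E e = {p (j - 1), p j}} = 2 \<and>
       (\<forall>e\<in>A. \<forall>e'\<in>A. ?E e = {p (j - 1), p j} \<longrightarrow> ?E e' = {p (j - 1), p j} \<longrightarrow> len G e = len G e')"
      using dc unfolding double_chain_def by (elim conjE)
    note dcj = bspec[OF this j]
    show ?thesis unfolding old[OF j]
    proof (intro conjI ballI impI)
      fix e e' assume "e \<in> ?A" "e' \<in> ?A" "?E e = {?p (j - 1), ?p j}" "?E e' = {?p (j - 1), ?p j}"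
      with mem[of e] mem[of e'] show "len G e = len G e'" using conjunct2[OF dcj] by blast
    qed (rule conjunct1[OF dcj])
  qed
  moreover have "\<exists>j\<in>{1..Suc k}. ?E e = {?p (j - 1), ?p j}" if "e \<in> ?A" for e
  proof (cases "e \<in> A")
    case True
    with dc obtain j where "j \<in> {1..k}" "?E e = {p (j - 1), p j}" unfolding double_chain_def by blast
    moreover from this have "?p (j - 1) = p (j - 1)" "?p j = p j" "j \<in> {1..Suc k}" by auto
    ultimately show ?thesis by metis
  next
    case False
    with that ends have "?E e = {p k, v}" by blast
    moreover have "?p (Suc k - 1) = p k" "?p (Suc k) = v" "Suc k \<in> {1..Suc k}" by auto
    ultimately show ?thesis by metis
  qed
  ultimately show ?thesis unfolding double_chain_def by blast
qed

lemma double_chain_caterpillar: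
  assumes G: "metric_graph G" and dc: "double_chain G (arcs (graph G)) k p" and k: "1 \<le> k"
    and D: "dirichlet G = {p 0}"
  shows "caterpillar G"
proof -
  let ?E = "\<lambda>e. {tail (graph G) e, head (graph G) e}"
  have "verts (graph G) = p ` {0..k}"
  proof
    show "verts (graph G) \<subseteq> p ` {0..k}"
      using double_chain_ends[OF dc] unfolding metric_graphD(8)[OF G, symmetric] network.ends_def by blast
    show "p ` {0..k} \<subseteq> verts (graph G)"
    proof
      fix w assume "w \<in> p ` {0..k}"
      then obtain i where i: "i \<le> k" "w = p i" by auto
      define j where "j = (if i = 0 then 1 else i)"
      have j: "j \<in> {1..k}" "w \<in> {p (j - 1), p j}" using i k by (auto simp: j_def)
      with dc have "card {e \<in> arcs (graph G). ?E e = {p (j - 1), p j}} = 2" unfolding double_chain_def by blast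
      then obtain e where e: "e \<in> arcs (graph G)" "?E e = {p (j - 1), p j}"
        by (metis (mono_tags, lifting) card.empty ex_in_conv mem_Collect_eq zero_neq_numeral)
      have "?E e \<subseteq> verts (graph G)" using metric_graphD(6,7)[OF G e(1)] by simp
      then show "w \<in> verts (graph G)" using j(2) unfolding e(2) by blast
    qed
  qed
  then have "bij_betw p {0..k} (verts (graph G))" using dc by (simp add: double_chain_def bij_betw_def)
  moreover have "\<forall>j\<in>{1..k}. card (edges_between (graph G) (p (j - 1)) (p j)) = 2 \<and>
      (\<forall>e\<in>edges_between (graph G) (p (j - 1)) (p j). \<forall>e'\<in>edges_between (graph G) (p (j - 1)) (p j). len G e = len G e')"
    "arcs (graph G) = (\<Union>j\<in>{1..k}. edges_between (graph G) (p (j - 1)) (p j))"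
    using dc unfolding double_chain_def edges_between_def by blast+
  ultimately show ?thesis unfolding caterpillar_def using G k D by blast
qed


section \<open>Normal forms of the extremal graphs\<close>

lemma last_notin_butlast: "distinct xs \<Longrightarrow> xs \<noteq> [] \<Longrightarrow> last xs \<notin> set (butlast xs)"
  by (cases xs rule: rev_cases) auto

lemma path_len_cong:
  assumes "\<And>e. e \<in> set (map fst xs) \<Longrightarrow> l e = l' e"
  shows "network.path_len l xs = network.path_len l' xs"
  using assms by (induction xs) (auto simp: network.path_len_simps)

text \<open>\<open>A\<close> is the part already in caterpillar form, and \<open>E\<close> hangs on
  its last vertex \<open>d\<close>. A ring becomes two parallel edges of equal length; the final
  cycle becomes a loop, which is then halved. The data \<open>t\<close>, \<open>h\<close>,
  \<open>l\<close> stay fixed while \<open>G\<close> changes step by step, so \<open>G\<close> is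
  compared with them on the untouched edges \<open>E\<close> only.\<close>

lemma ring_chain_reduce:
  fixes G :: "(nat, nat) mgraph"
  assumes "network.ring_chain t h l E d"
    and "metric_graph G" "arcs (graph G) = A \<union> E" "A \<inter> E = {}"
    and "\<And>e. e \<in> E \<Longrightarrow> tail (graph G) e = t e \<and> head (graph G) e = h e \<and> len G e = l e"
    and "double_chain G A k p" "p k = d" "dirichlet G = {p 0}" "network.ends t h E \<inter> p ` {0..k} \<subseteq> {d}"
  shows "\<exists>K. caterpillar K \<and> equivclp elementary_step G K"
  using assms
proof (induction E d arbitrary: G A k p rule: network.ring_chain.induct[consumes 1, case_names loop ring])
  case (loop d xs)
  interpret network t h l .
  note prems = loop.prems
  let ?I = "set (butlast (map snd xs))"
  obtain e u xs' where xs: "xs = (e, u) # xs'" using loop.hyps(2) by (metis list.exhaust surj_pair)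
  have last: "d \<notin> ?I" "?I \<subseteq> set (map snd xs)"
    using last_notin_butlast[of "map snd xs"] loop.hyps(2,4) path_last[OF loop.hyps(1,2)]
    by (auto simp: last_map dest: in_set_butlastD)
  have I: "?I \<inter> p ` {0..k} = {}"
    using prems(8) last unfolding ends_path(2)[OF loop.hyps(1,2)] by blast
  have path: "network.path (tail (graph G)) (head (graph G)) d xs d"
    using loop.hyps(1) prems(4) by (subst path_cong[symmetric]) auto
  have rest: "arcs (graph G) - set (map fst xs) = A" using prems(2,3) by blast
  have "\<exists>H. metric_graph H \<and> equivclp elementary_step G H \<and> dirichlet H = dirichlet G \<and>
    arcs (graph H) = insert e (arcs (graph G) - set (map fst xs)) \<and>
    {tail (graph H) e, head (graph H) e} = {d, d} \<and> len H e = network.path_len (len G) xs \<and>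
    (\<forall>x\<in>arcs (graph G) - set (map fst xs). tail (graph H) x = tail (graph G) x \<and>
      head (graph H) x = head (graph G) x \<and> len H x = len G x)"
    unfolding xs
  proof (rule contract_path[OF prems(1)], fold xs)
    show "?I \<inter> ({d, d} \<union> dirichlet G) = {}" using last(1) I prems(7) by auto
    show "{tail (graph G) x, head (graph G) x} \<inter> ?I = {}" if "x \<in> arcs (graph G) - set (map fst xs)" for x
      using double_chain_ends[OF prems(5), of x] that I unfolding rest by blast
  qed (use path loop.hyps prems(2) in \<open>auto intro: distinct_butlast\<close>)
  then obtain H where H: "metric_graph H" "equivclp elementary_step G H" "dirichlet H = {p 0}"
    "arcs (graph H) = insert e A" "tail (graph H) e = d" "head (graph H) e = d"
    "\<And>x. x \<in> A \<Longrightarrow> tail (graph H) x = tail (graph G) x \<and> head (graph H) x = head (graph G) x \<and> len H x = len G x"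
    unfolding rest prems(7) by auto
  obtain e' where e': "e' \<notin> arcs (graph H)" using ex_new_if_finite[OF infinite_UNIV_nat metric_graphD(1)[OF H(1)]] by blast
  have "finite (verts (graph H) \<union> p ` {0..k})" using metric_graphD(2)[OF H(1)] by simp
  from ex_new_if_finite[OF infinite_UNIV_nat this] obtain w where w: "w \<notin> verts (graph H)" "w \<notin> p ` {0..k}" by blast
  have e: "e \<in> arcs (graph H)" "e \<notin> A" using H(4) prems(3) xs by auto
  \<comment> \<open>Cutting the loop at its midpoint makes it the last ring, with far vertex
    \<open>w\<close>.\<close>
  define K where "K = subdivide_edge e e' w (len H e / 2) H"
  have pos: "0 < len H e / 2" "len H e / 2 < len H e" using metric_graphD(4)[OF H(1)] e(1) by auto
  have step: "elementary_step H K" unfolding K_def by (rule elementary_step.subdivide[OF H(1) e(1) e' w(1) pos])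
  have ee: "e \<noteq> e'" "e' \<notin> A" using e e' H(4) by auto
  have "double_chain K A k p \<longleftrightarrow> double_chain G A k p"
    using H(7) e(2) ee(2) by (intro double_chain_cong) (auto simp: K_def)
  then have "double_chain K (insert e (insert e' A)) (Suc k) (p(Suc k := w))"
    using prems(5,6) e(2) ee w(2) H(5,6) by (intro double_chain_extend) (auto simp: K_def)
  moreover have "arcs (graph K) = insert e (insert e' A)" using H(4) by (auto simp: K_def)
  ultimately have "caterpillar K"
    using elementary_step_metric_graph(2)[OF step] H(3)
    by (intro double_chain_caterpillar[of K "Suc k" "p(Suc k := w)"]) (auto simp: K_def)
  moreover have "equivclp elementary_step G K" using H(2) step by (rule equivclp_into_equivclp[OF _ disjI1])
  ultimately show ?case by blast
next
  case (ring d xs b ys E')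
  interpret network t h l .
  note prems = ring.prems and hyps = ring.hyps
  let ?I = "set (butlast (map snd xs))" and ?J = "set (butlast (map snd ys))"
  let ?S = "set (map fst xs)" and ?T = "set (map fst ys)"
  obtain e1 u1 xs' where xs: "xs = (e1, u1) # xs'" using hyps(3) by (metis list.exhaust surj_pair)
  obtain e2 u2 ys' where ys: "ys = (e2, u2) # ys'" using hyps(4) by (metis list.exhaust surj_pair)
  have lasts: "last (map snd xs) = b" "last (map snd ys) = d"
    using path_last[OF hyps(1,3)] path_last[OF hyps(2,4)] hyps(3,4) by (auto simp: last_map)
  have mem: "b \<in> set (map snd xs)" "d \<in> set (map snd ys)"
    using last_in_set[of "map snd xs", unfolded lasts] last_in_set[of "map snd ys", unfolded lasts] hyps(3,4)
    by simp_all
  have I: "?I \<subseteq> set (map snd xs)" "b \<notin> ?I" and J: "?J \<subseteq> set (map snd ys)" "d \<notin> ?J"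
    using last_notin_butlast[of "map snd xs"] last_notin_butlast[of "map snd ys"] hyps(3,4,7) lasts
    by (auto dest: in_set_butlastD)
  have disj: "set (map snd xs) \<inter> set (map snd ys) = {}" "?S \<inter> ?T = {}" using hyps(6,7) by auto
  have ends: "ends ?S = insert d (set (map snd xs))" "ends ?T = insert b (set (map snd ys))"
    by (rule ends_path(2)[OF hyps(1,3)], rule ends_path(2)[OF hyps(2,4)])
  have all_ends: "ends (set (map fst (xs @ ys)) \<union> E') = ends ?S \<union> ends ?T \<union> ends E'" by simp
  \<comment> \<open>All vertices of the ring except \<open>d\<close> are new to the chain.\<close>
  have pI: "(set (map snd xs) \<union> ?J) \<inter> p ` {0..k} = {}"
    using prems(8) disj mem J unfolding all_ends ends by blast
  have E': "ends E' \<inter> (?I \<union> ?J) = {}" "d \<notin> ends E'"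
    using hyps(9) I J disj mem unfolding map_append set_append by blast+
  have arcs: "arcs (graph G) - ?S = A \<union> ?T \<union> E'" "?S \<subseteq> arcs (graph G)" "?T \<subseteq> arcs (graph G)"
    using prems(2,3) hyps(8) disj(2) by auto
  have same: "tail (graph G) e = t e \<and> head (graph G) e = h e \<and> len G e = l e" if "e \<in> ?S \<union> ?T \<union> E'" for e
    using prems(4)[of e] that by auto
  have endsG: "{tail (graph G) x, head (graph G) x} \<subseteq> ends B" if "x \<in> B" "B \<subseteq> ?S \<union> ?T \<union> E'" for x B
    using same[of x] that by (auto simp: ends_def)
  have pathG: "network.path (tail (graph G)) (head (graph G)) d xs b" "network.path (tail (graph G)) (head (graph G)) b ys d"
    using hyps(1,2) same by (subst path_cong[symmetric]; auto)+
  have "\<exists>H. metric_graph H \<and> equivclp elementary_step G H \<and> dirichlet H = dirichlet G \<and>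
    arcs (graph H) = insert e1 (arcs (graph G) - ?S) \<and>
    {tail (graph H) e1, head (graph H) e1} = {d, b} \<and> len H e1 = network.path_len (len G) xs \<and>
    (\<forall>x\<in>arcs (graph G) - ?S. tail (graph H) x = tail (graph G) x \<and>
      head (graph H) x = head (graph G) x \<and> len H x = len G x)"
    unfolding xs
  proof (rule contract_path[OF prems(1)], fold xs)
    show "?I \<inter> ({d, b} \<union> dirichlet G) = {}" using I mem disj pI prems(7) by auto
    show "{tail (graph G) x, head (graph G) x} \<inter> ?I = {}" if "x \<in> arcs (graph G) - ?S" for x
    proof -
      from that consider "x \<in> A" | "x \<in> ?T" | "x \<in> E'" unfolding arcs(1) by blast
      then show ?thesis
      proof cases
        case 1
        then show ?thesis using double_chain_ends[OF prems(5), of x] pI I by blast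
      next
        case 2
        then show ?thesis using endsG[of x ?T] I disj unfolding ends by blast
      next
        case 3
        then show ?thesis using endsG[of x E'] E' by blast
      qed
    qed
  qed (use pathG hyps(6,7) arcs(2) in \<open>auto intro: distinct_butlast\<close>)
  then obtain H where H: "metric_graph H" "equivclp elementary_step G H" "dirichlet H = {p 0}"
    "arcs (graph H) = insert e1 (A \<union> ?T \<union> E')" "{tail (graph H) e1, head (graph H) e1} = {d, b}"
    "len H e1 = network.path_len (len G) xs"
    "\<And>x. x \<in> A \<union> ?T \<union> E' \<Longrightarrow> tail (graph H) x = tail (graph G) x \<and> head (graph H) x = head (graph G) x \<and> len H x = len G x"
    unfolding arcs(1) prems(7) by blast
  have e1: "e1 \<in> ?S" "e1 \<notin> ?T" "e1 \<notin> A" "e1 \<notin> E'" and e2: "e2 \<in> ?T" "e2 \<notin> A" "e2 \<notin> E'" "e1 \<noteq> e2"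
    using xs ys disj(2) prems(3) hyps(8) by auto
  have arcsH: "arcs (graph H) - ?T = insert e1 (A \<union> E')"
    using H(4) e1 prems(3) hyps(8) by auto
  have pathH: "network.path (tail (graph H)) (head (graph H)) b ys d"
    using hyps(2) same H(7) by (subst path_cong[symmetric]) auto
  have "\<exists>K. metric_graph K \<and> equivclp elementary_step H K \<and> dirichlet K = dirichlet H \<and>
    arcs (graph K) = insert e2 (arcs (graph H) - ?T) \<and>
    {tail (graph K) e2, head (graph K) e2} = {b, d} \<and> len K e2 = network.path_len (len H) ys \<and>
    (\<forall>x\<in>arcs (graph H) - ?T. tail (graph K) x = tail (graph H) x \<and>
      head (graph K) x = head (graph H) x \<and> len K x = len H x)"
    unfolding ys
  proof (rule contract_path[OF H(1)], fold ys)
    show "?J \<inter> ({b, d} \<union> dirichlet H) = {}" using J mem disj pI H(3) by auto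
    show "{tail (graph H) x, head (graph H) x} \<inter> ?J = {}" if "x \<in> arcs (graph H) - ?T" for x
    proof -
      from that consider "x = e1" | "x \<in> A" | "x \<in> E'" unfolding arcsH by blast
      then show ?thesis
      proof cases
        case 1
        then show ?thesis using H(5) J mem disj by auto
      next
        case 2
        then show ?thesis using double_chain_ends[OF prems(5), of x] pI J H(7)[of x] by auto
      next
        case 3
        then show ?thesis using endsG[of x E'] E' H(7)[of x] by auto
      qed
    qed
  qed (use pathH hyps(6,7) H(4) in \<open>auto intro: distinct_butlast\<close>)
  then obtain K where K: "metric_graph K" "equivclp elementary_step H K" "dirichlet K = {p 0}"
    "arcs (graph K) = insert e2 (insert e1 (A \<union> E'))" "{tail (graph K) e2, head (graph K) e2} = {b, d}"
    "len K e2 = network.path_len (len H) ys"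
    "\<And>x. x \<in> insert e1 (A \<union> E') \<Longrightarrow> tail (graph K) x = tail (graph H) x \<and> head (graph K) x = head (graph H) x \<and> len K x = len H x"
    unfolding arcsH H(3) by blast
  have "network.path_len (len G) xs = path_len xs"
    by (rule path_len_cong) (use same in blast)
  then have "len K e1 = path_len xs" using K(7)[of e1] H(6) by simp
  moreover have "len K e2 = path_len ys"
    unfolding K(6)
  proof (rule path_len_cong)
    fix e assume "e \<in> ?T"
    then show "len H e = l e" using H(7)[of e] same[of e] by simp
  qed
  ultimately have len: "len K e1 = len K e2" using hyps(5) by simp
  have b: "b \<notin> p ` {0..k}" using pI mem by blast
  have "double_chain K A k p \<longleftrightarrow> double_chain G A k p"
    using H(7) K(7) by (intro double_chain_cong) simp
  then have dc: "double_chain K (insert e1 (insert e2 A)) (Suc k) (p(Suc k := b))"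
    using prems(5,6) e1 e2 b len H(5) K(5) K(7)[of e1]
    by (intro double_chain_extend) (auto simp: insert_commute)
  \<comment> \<open>The chain has grown by one ring and now ends in \<open>b\<close>, where
    \<open>E'\<close> hangs.\<close>
  have "\<exists>C. caterpillar C \<and> equivclp elementary_step K C"
  proof (rule ring.IH[OF K(1) _ _ _ dc])
    show "arcs (graph K) = insert e1 (insert e2 A) \<union> E'" using K(4) by auto
    show "insert e1 (insert e2 A) \<inter> E' = {}" using e1 e2 prems(3) by auto
    show "tail (graph K) e = t e \<and> head (graph K) e = h e \<and> len K e = l e" if "e \<in> E'" for e
      using that K(7)[of e] H(7)[of e] same[of e] by simp
    show "dirichlet K = {(p(Suc k := b)) 0}" using K(3) by simp
    have "ends E' \<inter> p ` {0..k} \<subseteq> {}" using prems(8) E'(2) unfolding all_ends by blast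
    moreover have "(p(Suc k := b)) ` {0..Suc k} = insert b (p ` {0..k})" by (auto simp: atLeast0_atMost_Suc)
    ultimately show "ends E' \<inter> (p(Suc k := b)) ` {0..Suc k} \<subseteq> {b}" by auto
  qed simp
  then show ?case using H(2) K(2) by (meson equivclp_trans)
qed

section \<open>Reduction to a single Dirichlet vertex\<close>

lemma reach_map:
  assumes "network.reach t h E D w"
    and "\<And>e. e \<in> E \<Longrightarrow> g e \<in> E' \<and> {t' (g e), h' (g e)} = f ` {t e, h e}" and "f ` D \<subseteq> D'"
  shows "network.reach t' h' E' D' (f w)"
  using assms(1)
proof (induction rule: network.reach.induct[consumes 1, case_names base step])
  case (base w)
  then show ?case using assms(3) by (intro network.reach.base) auto
next
  case (step e w u)
  then show ?case using assms(2)[of e] by (intro network.reach.step[of "g e" _ _ _ "f w" "f u"]) auto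
qed

lemma two_reach_map:
  assumes "network.two_reach t h E D" "bij_betw g E E'"
    and "\<And>e. e \<in> E \<Longrightarrow> {t' (g e), h' (g e)} = f ` {t e, h e}" and "f ` D \<subseteq> D'"
  shows "network.two_reach t' h' E' D'"
  unfolding network.two_reach_def
proof (intro ballI)
  fix w' e' assume w': "w' \<in> network.ends t' h' E'" and e': "e' \<in> E'"
  from e' assms(2) obtain e0 where e0: "e0 \<in> E" "e' = g e0" by (auto simp: bij_betw_def)
  from w' assms(2) obtain e where "e \<in> E" "w' \<in> {t' (g e), h' (g e)}" by (auto simp: bij_betw_def network.ends_def)
  with assms(3) obtain w where w: "w' = f w" "w \<in> {t e, h e}" "e \<in> E" by auto
  then have "network.reach t h (E - {e0}) D w"
    using assms(1) e0(1) by (auto simp: network.two_reach_def network.ends_def)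
  then show "network.reach t' h' (E' - {e'}) D' w'"
    unfolding w(1) using assms(2-4) e0
    by (elim reach_map[where g = g]) (auto simp: bij_betw_def inj_on_def)
qed

text \<open>The equality cases of \<open>reach_flow\<close> and \<open>two_reach_flow\<close>
  determine the graph once \<open>D\<close> meets it in one vertex. Gluing two Dirichlet vertices at
  a time leads there and preserves both kinds of reachability.\<close>

lemma glue_dirichlet:
  fixes G :: "('v, 'e) mgraph"
  assumes "metric_graph G" "dirichlet G \<noteq> {}" "\<forall>w\<in>verts (graph G). graph_reach G w"
  shows "\<exists>H d. metric_graph H \<and> equivclp elementary_step G H \<and> dirichlet H = {d} \<and>
    (\<forall>w\<in>verts (graph H). graph_reach H w) \<and> (graph_two_reach G \<longrightarrow> graph_two_reach H)"
  using assms
proof (induction "card (dirichlet G)" arbitrary: G rule: less_induct)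
  case less
  have fin: "finite (dirichlet G)" using metric_graphD(2,5)[OF less.prems(1)] by (rule finite_subset[rotated])
  from less.prems(2) obtain a where a: "a \<in> dirichlet G" by blast
  show ?case
  proof (cases "dirichlet G = {a}")
    case True
    then show ?thesis using less.prems by (intro exI[of _ G] exI[of _ a]) auto
  next
    case False
    with a obtain b where b: "b \<in> dirichlet G" "a \<noteq> b" by blast
    let ?H = "glue_two a b G" and ?f = "\<lambda>w. if w = b then a else w"
    have H: "metric_graph ?H" by (rule glue_two_metric_graph[OF less.prems(1) a b(2)])
    have D: "?f ` dirichlet G \<subseteq> dirichlet ?H" using a b by auto
    have "\<forall>w\<in>verts (graph ?H). graph_reach ?H w"
    proof
      fix w assume "w \<in> verts (graph ?H)"
      then obtain v where v: "v \<in> verts (graph G)" "w = ?f v" by auto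
      with less.prems(3) have "graph_reach G v" by blast
      then show "graph_reach ?H w" unfolding v(2) by (rule reach_map[where g = id and f = ?f]) (use a b in auto)
    qed
    moreover have "graph_two_reach ?H" if "graph_two_reach G"
      using that by (rule two_reach_map[where g = id and f = ?f]) (use a b in auto)
    moreover have "card (dirichlet ?H) < card (dirichlet G)" unfolding glue_two_simps by (rule card_Diff1_less[OF fin b(1)])
    moreover have "dirichlet ?H \<noteq> {}" using a b by auto
    ultimately obtain K d where "metric_graph K" "equivclp elementary_step ?H K" "dirichlet K = {d}"
      "\<forall>w\<in>verts (graph K). graph_reach K w" "graph_two_reach G \<longrightarrow> graph_two_reach K"
      using less.hyps[of ?H] H by blast
    moreover have "equivclp elementary_step G ?H"
      using elementary_step.glue[OF less.prems(1) a b] by (rule r_into_equivclp)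
    ultimately show ?thesis by (meson equivclp_trans)
  qed
qed

lemma mgraph_nat_copy:
  assumes "metric_graph G"
  shows "\<exists>G' :: (nat, nat) mgraph. mgraph_iso G G'"
proof -
  note G = metric_graphD[OF assms]
  obtain f :: "'a \<Rightarrow> nat" where f: "inj_on f (verts (graph G))" using finite_imp_inj_to_nat_seg[OF G(2)] by blast
  obtain g :: "'b \<Rightarrow> nat" where g: "inj_on g (arcs (graph G))" using finite_imp_inj_to_nat_seg[OF G(1)] by blast
  let ?i = "inv_into (arcs (graph G)) g"
  let ?G' = "\<lparr> graph = \<lparr> verts = f ` verts (graph G), arcs = g ` arcs (graph G),
    tail = f \<circ> tail (graph G) \<circ> ?i, head = f \<circ> head (graph G) \<circ> ?i \<rparr>,
    len = len G \<circ> ?i, dirichlet = f ` dirichlet G \<rparr>"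
  have "mgraph_iso G ?G'"
    unfolding mgraph_iso_def using f g
    by (intro exI[of _ f] exI[of _ g]) (auto simp: bij_betw_def)
  then show ?thesis by blast
qed

lemma normal_form:
  fixes G :: "('v, 'e) mgraph"
  assumes G: "metric_graph G" "dirichlet G \<noteq> {}" and reach: "\<forall>w\<in>verts (graph G). graph_reach G w"
  obtains G' :: "(nat, nat) mgraph" and H d where "mgraph_iso G G'" "equivclp elementary_step G' H"
    "metric_graph H" "dirichlet H = {d}" "\<forall>w\<in>verts (graph H). graph_reach H w"
    "graph_two_reach G \<Longrightarrow> graph_two_reach H"
    "\<And>r. has_torsion G r \<longleftrightarrow> has_torsion H r" "total_length G = total_length H"
proof -
  obtain G' :: "(nat, nat) mgraph" where iso: "mgraph_iso G G'" using mgraph_nat_copy[OF G(1)] by blast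
  then obtain f g where f: "bij_betw f (verts (graph G)) (verts (graph G'))"
    and g: "bij_betw g (arcs (graph G)) (arcs (graph G'))" and D: "f ` dirichlet G = dirichlet G'"
    and len_ends: "\<forall>e\<in>arcs (graph G). len G' (g e) = len G e \<and>
      {tail (graph G') (g e), head (graph G') (g e)} = f ` {tail (graph G) e, head (graph G) e}"
    unfolding mgraph_iso_def by blast
  have e: "{tail (graph G') (g e), head (graph G') (g e)} = f ` {tail (graph G) e, head (graph G) e}"
    if "e \<in> arcs (graph G)" for e
    using bspec[OF len_ends that] by (rule conjunct2)
  have G': "metric_graph G'" by (rule mgraph_iso_metric_graph[OF G(1) iso])
  have "\<forall>w\<in>verts (graph G'). graph_reach G' w"
  proof
    fix w assume "w \<in> verts (graph G')"
    then obtain v where v: "v \<in> verts (graph G)" "w = f v" using f by (auto simp: bij_betw_def)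
    with reach have "graph_reach G v" by blast
    then show "graph_reach G' w" unfolding v(2)
    proof (rule reach_map)
      show "g x \<in> arcs (graph G') \<and> {tail (graph G') (g x), head (graph G') (g x)} = f ` {tail (graph G) x, head (graph G) x}"
        if "x \<in> arcs (graph G)" for x
        using e[OF that] g that unfolding bij_betw_def by blast
    qed (simp add: D)
  qed
  moreover have two: "graph_two_reach G'" if "graph_two_reach G"
    using that g e by (rule two_reach_map) (use D in auto)
  moreover have "dirichlet G' \<noteq> {}" using G(2) D by auto
  ultimately obtain H d where H: "metric_graph H" "equivclp elementary_step G' H" "dirichlet H = {d}"
    "\<forall>w\<in>verts (graph H). graph_reach H w" "graph_two_reach G' \<longrightarrow> graph_two_reach H"
    using glue_dirichlet[OF G'] by blast
  have "identified G H" unfolding identified_def using iso H(2) by blast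
  show ?thesis
    by (rule that[OF iso H(2,1,3,4) _ identified_invariant[OF G(1) \<open>identified G H\<close>]]) (use two H(5) in blast)
qed

text \<open>The torsion is at most the energy of the flux from \<open>reach_flow\<close>. If it
  attains the bound, that energy does so too, hence the graph is a simple path from d, and its inner
  vertices can be removed.\<close>

lemma extremal_interval:
  assumes G: "metric_graph G" "dirichlet G = {d}" "\<forall>w\<in>verts (graph G). graph_reach G w"
    and T: "has_torsion G (total_length G ^ 3 / 3)"
  shows "\<exists>K. mixed_interval K \<and> equivclp elementary_step G K"
proof -
  interpret network "tail (graph G)" "head (graph G)" "len G" .
  note G' = metric_graphD[OF G(1)]
  from T obtain f where f: "sol (arcs (graph G)) {d} f" "energy (arcs (graph G)) (grad f) = sum (len G) (arcs (graph G)) ^ 3 / 3"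
    unfolding has_torsion_def graph_sol_def graph_energy_def total_length_def G(2) by metis
  obtain \<phi> where \<phi>: "pos_flow (arcs (graph G)) {d} \<phi>" "energy (arcs (graph G)) \<phi> \<le> sum (len G) (arcs (graph G)) ^ 3 / 3"
    "energy (arcs (graph G)) \<phi> = sum (len G) (arcs (graph G)) ^ 3 / 3 \<Longrightarrow>
      \<exists>xs b. path d xs b \<and> arcs (graph G) = set (map fst xs) \<and> distinct (map fst xs) \<and> distinct (d # map snd xs)"
    using reach_flow[OF G'(1,4), of "{d}"] G(2,3) G'(3) unfolding G'(8) by (metis inf_le1)
  have "energy (arcs (graph G)) (grad f) \<le> energy (arcs (graph G)) \<phi>"
    using energy_grad_le[OF G'(1,4) f(1)] \<phi>(1) by (simp add: pos_flow_def)
  with f(2) \<phi>(2) have "energy (arcs (graph G)) \<phi> = sum (len G) (arcs (graph G)) ^ 3 / 3" by linarith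
  from \<phi>(3)[OF this] obtain xs b where xs: "path d xs b" "arcs (graph G) = set (map fst xs)"
    "distinct (map fst xs)" "distinct (d # map snd xs)" by blast
  then have ne: "xs \<noteq> []" using G'(3) by auto
  then obtain e u xs' where eq: "xs = (e, u) # xs'" by (metis list.exhaust surj_pair)
  have b: "b \<in> set (map snd xs)" "b \<notin> set (butlast (map snd xs))"
    using path_last[OF xs(1) ne] ne last_notin_butlast[of "map snd xs"] xs(4) by (auto simp: last_map)
  have "\<exists>H. metric_graph H \<and> equivclp elementary_step G H \<and> dirichlet H = dirichlet G \<and>
    arcs (graph H) = insert e (arcs (graph G) - set (map fst xs)) \<and>
    {tail (graph H) e, head (graph H) e} = {d, b} \<and> len H e = network.path_len (len G) xs \<and>
    (\<forall>x\<in>arcs (graph G) - set (map fst xs). tail (graph H) x = tail (graph G) x \<and>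
      head (graph H) x = head (graph G) x \<and> len H x = len G x)"
    unfolding eq
  proof (rule contract_path[OF G(1)], fold eq)
    show "set (butlast (map snd xs)) \<inter> ({d, b} \<union> dirichlet G) = {}"
      using b xs(4) G(2) by (auto dest: in_set_butlastD)
  qed (use xs in \<open>auto intro: distinct_butlast\<close>)
  then obtain H where H: "metric_graph H" "equivclp elementary_step G H" "dirichlet H = {d}"
    "arcs (graph H) = {e}" "{tail (graph H) e, head (graph H) e} = {d, b}"
    unfolding xs(2) G(2) by auto
  have "verts (graph H) = {d, b}"
    unfolding metric_graphD(8)[OF H(1), symmetric] H(5)[symmetric] network.ends_def H(4) by auto
  moreover have "d \<noteq> b" using b(1) xs(4) by auto
  ultimately have "mixed_interval H" unfolding mixed_interval_def using H by blast
  with H(2) show ?thesis by blast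
qed

lemma extremal_caterpillar:
  fixes G :: "(nat, nat) mgraph"
  assumes G: "metric_graph G" "dirichlet G = {d}" "graph_two_reach G"
    and T: "has_torsion G (total_length G ^ 3 / 12)"
  shows "\<exists>K. caterpillar K \<and> equivclp elementary_step G K"
proof -
  interpret network "tail (graph G)" "head (graph G)" "len G" .
  note G' = metric_graphD[OF G(1)]
  from T obtain f where f: "sol (arcs (graph G)) {d} f" "energy (arcs (graph G)) (grad f) = sum (len G) (arcs (graph G)) ^ 3 / 12"
    unfolding has_torsion_def graph_sol_def graph_energy_def total_length_def G(2) by metis
  obtain \<phi> where \<phi>: "pos_flow (arcs (graph G)) {d} \<phi>" "energy (arcs (graph G)) \<phi> \<le> sum (len G) (arcs (graph G)) ^ 3 / 12"
    "energy (arcs (graph G)) \<phi> = sum (len G) (arcs (graph G)) ^ 3 / 12 \<Longrightarrow> ring_chain (arcs (graph G)) d"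
    using two_reach_flow[OF G'(1,4), of "{d}"] G(2,3) G'(3) by (metis inf_le1)
  have "energy (arcs (graph G)) (grad f) \<le> energy (arcs (graph G)) \<phi>"
    using energy_grad_le[OF G'(1,4) f(1)] \<phi>(1) by (simp add: pos_flow_def)
  with f(2) \<phi>(2) have "energy (arcs (graph G)) \<phi> = sum (len G) (arcs (graph G)) ^ 3 / 12" by linarith
  \<comment> \<open>The reduction starts with the empty chain, consisting of the vertex d
    alone.\<close>
  from \<phi>(3)[OF this] show ?thesis
    by (rule ring_chain_reduce[where A = "{}" and k = 0 and p = "\<lambda>_. d"])
      (use G in \<open>auto simp: double_chain_def\<close>)
qed

theorem theorem4p6:
  fixes G :: "('v, 'e) mgraph"
  assumes "metric_graph G"
    and "Digraph_Component.connected (graph G)"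
    and "dirichlet G \<noteq> {}"
  shows "torsional_rigidity G \<le> total_length G ^ 3 / 3 \<and>
         (torsional_rigidity G = total_length G ^ 3 / 3 \<longleftrightarrow> is_mixed_interval G) \<and>
         (doubly_connected (glue_set (dirichlet G) (graph G)) \<longrightarrow>
            torsional_rigidity G \<le> total_length G ^ 3 / 12 \<and>
            (torsional_rigidity G = total_length G ^ 3 / 12 \<longleftrightarrow> is_caterpillar G))"
proof -
  interpret network "tail (graph G)" "head (graph G)" "len G" .
  note G = metric_graphD[OF assms(1)]
  have conn: "\<forall>w\<in>verts (graph G). graph_reach G w"
    using connected_graph_reach[OF assms] by blast
  note T_iff = torsional_rigidity_iff[OF assms(1) conn]
  have bound: "torsional_rigidity G \<le> energy (arcs (graph G)) \<phi>"
    if "pos_flow (arcs (graph G)) (dirichlet G) \<phi>" for \<phi>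
  proof -
    obtain f where f: "graph_sol G f" using graph_sol_exists[OF assms(1) conn] by blast
    then show ?thesis
      using torsional_rigidity_eq_energy[OF assms(1) conn f] energy_grad_le[OF G(1,4), of "dirichlet G" f \<phi>] that
      by (simp add: graph_sol_def graph_energy_def pos_flow_def)
  qed
  \<comment> \<open>The inequalities are proved on \<open>G\<close> with all its Dirichlet vertices;
    the shape in the equality cases is read off from \<open>H\<close>, where they are glued to
    one.\<close>
  obtain G' :: "(nat, nat) mgraph" and H d where H: "mgraph_iso G G'" "equivclp elementary_step G' H"
    "metric_graph H" "dirichlet H = {d}" "\<forall>w\<in>verts (graph H). graph_reach H w"
    "graph_two_reach G \<Longrightarrow> graph_two_reach H"
    "\<And>r. has_torsion G r \<longleftrightarrow> has_torsion H r" "total_length G = total_length H"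
    using normal_form[OF assms(1,3) conn] by metis
  have ident: "identified G K" if "equivclp elementary_step H K" for K
    unfolding identified_def using H(1,2) that equivclp_trans by metis
  have "torsional_rigidity G \<le> total_length G ^ 3 / 3"
    using reach_flow[OF G(1,4), of "dirichlet G"] conn bound unfolding G(8) total_length_def
    by (meson order_trans)
  moreover have "torsional_rigidity G = total_length G ^ 3 / 3 \<longleftrightarrow> is_mixed_interval G"
  proof
    assume "torsional_rigidity G = total_length G ^ 3 / 3"
    then have "has_torsion H (total_length H ^ 3 / 3)" unfolding T_iff H(7,8) .
    then show "is_mixed_interval G"
      using extremal_interval[OF H(3,4,5)] ident unfolding is_mixed_interval_def by blast
  next
    \<comment> \<open>Conversely, the extremal value is computed on the model graph and carried back
      by invariance.\<close>
    assume "is_mixed_interval G"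
    then obtain K where "identified G K" "mixed_interval K" unfolding is_mixed_interval_def by blast
    then show "torsional_rigidity G = total_length G ^ 3 / 3"
      using mixed_interval_has_torsion identified_invariant[OF assms(1)] T_iff by metis
  qed
  moreover have "torsional_rigidity G \<le> total_length G ^ 3 / 12 \<and>
      (torsional_rigidity G = total_length G ^ 3 / 12 \<longleftrightarrow> is_caterpillar G)"
    if dc: "doubly_connected (glue_set (dirichlet G) (graph G))"
  proof -
    have two: "graph_two_reach G" by (rule doubly_connected_graph_two_reach[OF assms(1) dc assms(3)])
    have "torsional_rigidity G \<le> total_length G ^ 3 / 12"
      using two_reach_flow[OF G(1,4) two] bound unfolding total_length_def
      by (meson order_trans)
    moreover have "torsional_rigidity G = total_length G ^ 3 / 12 \<longleftrightarrow> is_caterpillar G"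
    proof
      assume "torsional_rigidity G = total_length G ^ 3 / 12"
      then have "has_torsion H (total_length H ^ 3 / 12)" unfolding T_iff H(7,8) .
      then show "is_caterpillar G"
        using extremal_caterpillar[OF H(3,4) H(6)[OF two]] ident unfolding is_caterpillar_def by blast
    next
      assume "is_caterpillar G"
      then obtain K where "identified G K" "caterpillar K" unfolding is_caterpillar_def by blast
      then show "torsional_rigidity G = total_length G ^ 3 / 12"
        using caterpillar_has_torsion identified_invariant[OF assms(1)] T_iff by metis
    qed
    ultimately show ?thesis ..
  qed
  ultimately show ?thesis by blast
qed

end
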